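(* Let $\Gamma$ be a crystallographic group in dimension $n$, with point group $\Pi$, dual lattice $\mathcal{L}^*$, and fundamental domain $R$ for $\Gamma^*$ as in the context. There is a unitary transformation $$U: L^2(\mathbb{R}^n) \to L^2\big(R;l^2(\Pi)\otimes l^2(\mathcal{L}^* )\big)$$ under which the natural shift representation $\pi$ of $\Gamma$ on $L^2(\mathbb{R}^n)$ is equivalent to $$\tau = \int_{R}^\oplus U^r \otimes I \,dr ,$$ i.e. $U\pi[x,L]U^{-1}=\tau[x,L]$ for all $[x,L]\in\Gamma$.
   Context: For $x\in\mathbb{R}^n$ and $L\in \mathrm{GL}(n,\mathbb{R})$, $[x,L]$ denotes the affine map $[x,L]u=L(u+x)$; thus $[x,L][y,M]=[M^{-1}x+y,LM]$ and $[x,L]^{-1}=[-Lx,L^{-1}]$. A crystallographic group $\Gamma$ in dimension $n$ is a discrete subgroup of $\{[x,L]:x\in\mathbb{R}^n, L\in \mathrm{O}(n)\}$ with $\mathbb{R}^n/\Gamma$ compact. Its point group is the finite group $\Pi=\{L:[x,L]\in\Gamma\text{ for some }x\}$; its lattice is $\mathcal{L}=\{x:[x,\mathrm{id}]\in\Gamma\}$; the dual lattice is $\mathcal{L}^*=\{z: x\cdot z\in\mathbb{Z}\ \forall x\in\mathcal{L}\}$; and $\Gamma^*=\{[z,M]:z\in\mathcal{L}^*,M\in\Pi\}$, again a crystallographic group. Fix a cross-section $\gamma:\Pi\to\Gamma$, $\gamma(M)=[x_M,M]$, with $\gamma(\mathrm{id})=[0,\mathrm{id}]$. $R$ is a fixed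 fundamental domain for $\Gamma^*$: $R$ is open and connected, the sets $gR$ ($g\in\Gamma^*$) are mutually disjoint, and $\bigcup_{g\in\Gamma^*} g\overline{R}=\mathbb{R}^n$; moreover $R$ is convex and locally finite (each point has a neighbourhood meeting only finitely many $g\overline R$). $R$ carries Lebesgue measure. $\pi$ is given by $(\pi[x,L]f)(u)=f([x,L]^{-1}u)=f(L^{-1}u-x)$. For $y\in\mathbb{R}^n$, $\chi_y(u)=e^{2\pi i y\cdot u}$. For $r\in R$, $U^r$ is the unitary representation of $\Gamma$ on $l^2(\Pi)$ given by $$[U^r[x,L]\zeta](M)=\chi_r(x_{L^{-1}M}-x_M+M^{-1}Lx)\,\zeta(L^{-1}M),\quad \zeta\in l^2(\Pi),\ M\in\Pi$$ (it is unitarily equivalent to the representation of $\Gamma$ induced from the character $[y,\mathrm{id}]\mapsto e^{2\pi i r\cdot y}$ of the translation subgroup). $I$ is the identity on $l^2(\mathcal{L}^* )$. $\tau$ is the unitary representation on $L^2(R;l^2(\Pi)\otimes l^2(\mathcal{L}^* ))$ given by $(\tau[x,L]F)(r)=(U^r[x,L]\otimes I)F(r)$ for a.e. $r$. *)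

theory Defs
  imports "HOL-Analysis.Analysis" "HOL-Algebra.Group"
begin

section \<open>Euclidean isometries and crystallographic groups\<close>

text \<open>The pair \<open>(x, L)\<close> stands for the affine map \<open>[x,L]\<close>, in which the translation is applied
  before the linear part.\<close>

type_synonym 'n aff = "(real ^ 'n) \<times> (real ^ 'n ^ 'n)"

fun aff_act :: "'n::finite aff \<Rightarrow> real ^ 'n \<Rightarrow> real ^ 'n" where
  "aff_act (x, L) u = L *v (u + x)"

fun aff_mult :: "'n::finite aff \<Rightarrow> 'n aff \<Rightarrow> 'n aff" where
  "aff_mult (x, L) (y, M) = (matrix_inv M *v x + y, L ** M)"

definition isom_group :: "('n::finite aff) monoid" where
  "isom_group = \<lparr>carrier = {(x, L). orthogonal_matrix L}, mult = aff_mult, one = (0, mat 1)\<rparr>"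

text \<open>The topology of the orbit space: a set of orbits is open iff the union of its members is.\<close>

definition orbit :: "('n::finite aff) set \<Rightarrow> real ^ 'n \<Rightarrow> (real ^ 'n) set" where
  "orbit \<Gamma> u = (\<lambda>g. aff_act g u) ` \<Gamma>"

definition orbit_space :: "('n::finite aff) set \<Rightarrow> (real ^ 'n) set topology" where
  "orbit_space \<Gamma> = topology (\<lambda>W. W \<subseteq> range (orbit \<Gamma>) \<and> open (orbit \<Gamma> -` W))"

text \<open>\<^const>\<open>discrete\<close> refers to the product topology on pairs, which is the usual topology of the
  group of isometries.\<close>

definition crystallographic :: "('n::finite aff) set \<Rightarrow> bool" where
  "crystallographic \<Gamma> \<longleftrightarrow>
     subgroup \<Gamma> isom_group \<and> discrete \<Gamma> \<and> compact_space (orbit_space \<Gamma>)"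

definition point_group :: "('n::finite aff) set \<Rightarrow> (real ^ 'n ^ 'n) set" where
  "point_group \<Gamma> = {L. \<exists>x. (x, L) \<in> \<Gamma>}"

definition translation_lattice :: "('n::finite aff) set \<Rightarrow> (real ^ 'n) set" where
  "translation_lattice \<Gamma> = {x. (x, mat 1) \<in> \<Gamma>}"

definition dual_lattice :: "('n::finite aff) set \<Rightarrow> (real ^ 'n) set" where
  "dual_lattice \<Gamma> = {z. \<forall>x\<in>translation_lattice \<Gamma>. x \<bullet> z \<in> \<int>}"

definition dual_group :: "('n::finite aff) set \<Rightarrow> ('n aff) set" where
  "dual_group \<Gamma> = dual_lattice \<Gamma> \<times> point_group \<Gamma>"

text \<open>\<open>\<xi> M\<close> is the translation part of the chosen lift \<open>(\<xi> M, M)\<close> of \<open>M\<close> to \<open>\<Gamma>\<close>.\<close>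

definition cross_section :: "('n::finite aff) set \<Rightarrow> (real ^ 'n ^ 'n \<Rightarrow> real ^ 'n) \<Rightarrow> bool" where
  "cross_section \<Gamma> \<xi> \<longleftrightarrow> (\<forall>M\<in>point_group \<Gamma>. (\<xi> M, M) \<in> \<Gamma>) \<and> \<xi> (mat 1) = 0"

definition fundamental_domain :: "('n::finite aff) set \<Rightarrow> (real ^ 'n) set \<Rightarrow> bool" where
  "fundamental_domain G R \<longleftrightarrow>
     open R \<and> connected R \<and>
     (\<forall>g\<in>G. \<forall>h\<in>G. g \<noteq> h \<longrightarrow> aff_act g ` R \<inter> aff_act h ` R = {}) \<and>
     (\<Union>g\<in>G. aff_act g ` closure R) = UNIV \<and>
     convex R \<and>
     (\<forall>u. \<exists>N. open N \<and> u \<in> N \<and> finite {g \<in> G. aff_act g ` closure R \<inter> N \<noteq> {}})"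


section \<open>Hilbert spaces on explicit carriers\<close>

text \<open>Inner products are linear in the first argument.\<close>

record 'v hspace =
  vecs :: "'v set"
  vadd :: "'v \<Rightarrow> 'v \<Rightarrow> 'v"
  vscale :: "complex \<Rightarrow> 'v \<Rightarrow> 'v"
  vinner :: "'v \<Rightarrow> 'v \<Rightarrow> complex"

definition unitary_map :: "'v hspace \<Rightarrow> 'w hspace \<Rightarrow> ('v \<Rightarrow> 'w) \<Rightarrow> bool" where
  "unitary_map H K U \<longleftrightarrow>
     bij_betw U (vecs H) (vecs K) \<and>
     (\<forall>f\<in>vecs H. \<forall>g\<in>vecs H. U (vadd H f g) = vadd K (U f) (U g)) \<and>
     (\<forall>c. \<forall>f\<in>vecs H. U (vscale H c f) = vscale K c (U f)) \<and>
     (\<forall>f\<in>vecs H. \<forall>g\<in>vecs H. vinner K (U f) (U g) = vinner H f g)"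

definition complex_hspace :: "complex hspace" where
  "complex_hspace =
     \<lparr>vecs = UNIV, vadd = (+), vscale = (*), vinner = (\<lambda>a b. a * cnj b)\<rparr>"

definition ell2 :: "'i set \<Rightarrow> ('i \<Rightarrow> complex) hspace" where
  "ell2 I =
     \<lparr>vecs = {\<zeta>. (\<forall>i. i \<notin> I \<longrightarrow> \<zeta> i = 0) \<and> (\<lambda>i. (cmod (\<zeta> i))\<^sup>2) summable_on I},
      vadd = (\<lambda>\<zeta> \<eta> i. \<zeta> i + \<eta> i),
      vscale = (\<lambda>c \<zeta> i. c * \<zeta> i),
      vinner = (\<lambda>\<zeta> \<eta>. \<Sum>\<^sub>\<infinity>i\<in>I. \<zeta> i * cnj (\<eta> i))\<rparr>"

text \<open>The Hilbert tensor product of \<open>l\<^sup>2(I)\<close> and \<open>l\<^sup>2(J)\<close> is realised as \<open>l\<^sup>2(I \<times> J)\<close>, with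
  \<open>\<zeta> \<otimes> \<eta>\<close> the function \<open>(i, j) \<mapsto> \<zeta> i * \<eta> j\<close>; the tensor products of the standard unit vectors are
  exactly the standard unit vectors of \<open>l\<^sup>2(I \<times> J)\<close>. The operator \<open>A \<otimes> B\<close> applies \<open>B\<close> in the second
  variable and then \<open>A\<close> in the first, which for bounded linear \<open>A\<close>, \<open>B\<close> is the unique bounded
  extension of \<open>\<zeta> \<otimes> \<eta> \<mapsto> A \<zeta> \<otimes> B \<eta>\<close>.\<close>

definition ell2_tensor :: "'i set \<Rightarrow> 'j set \<Rightarrow> ('i \<times> 'j \<Rightarrow> complex) hspace" where
  "ell2_tensor I J = ell2 (I \<times> J)"

definition elem_tensor :: "('i \<Rightarrow> complex) \<Rightarrow> ('j \<Rightarrow> complex) \<Rightarrow> 'i \<times> 'j \<Rightarrow> complex" where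
  "elem_tensor \<zeta> \<eta> = (\<lambda>(i, j). \<zeta> i * \<eta> j)"

definition op_tensor ::
  "(('i \<Rightarrow> complex) \<Rightarrow> 'k \<Rightarrow> complex) \<Rightarrow> (('j \<Rightarrow> complex) \<Rightarrow> 'l \<Rightarrow> complex) \<Rightarrow>
   ('i \<times> 'j \<Rightarrow> complex) \<Rightarrow> 'k \<times> 'l \<Rightarrow> complex" where
  "op_tensor A B G = (\<lambda>(k, l). A (\<lambda>i. B (\<lambda>j. G (i, j)) l) k)"

text \<open>\<open>L\<^sup>2(M; H)\<close> consists of almost-everywhere classes of square-integrable functions.
  Measurability is weak measurability, the usual notion for separable \<open>H\<close>. The values of a
  representative outside \<^term>\<open>space M\<close> are irrelevant.\<close>

definition L2_fun :: "'a measure \<Rightarrow> 'v hspace \<Rightarrow> ('a \<Rightarrow> 'v) set" where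
  "L2_fun M H =
     {f. f \<in> space M \<rightarrow> vecs H \<and>
         (\<forall>v\<in>vecs H. (\<lambda>x. vinner H (f x) v) \<in> borel_measurable M) \<and>
         integrable M (\<lambda>x. vinner H (f x) (f x))}"

definition ae_class :: "'a measure \<Rightarrow> 'v hspace \<Rightarrow> ('a \<Rightarrow> 'v) \<Rightarrow> ('a \<Rightarrow> 'v) set" where
  "ae_class M H f = {g \<in> L2_fun M H. AE x in M. g x = f x}"

definition rep :: "('a \<Rightarrow> 'v) set \<Rightarrow> 'a \<Rightarrow> 'v" where
  "rep F = (SOME f. f \<in> F)"

definition L2 :: "'a measure \<Rightarrow> 'v hspace \<Rightarrow> ('a \<Rightarrow> 'v) set hspace" where
  "L2 M H =
     \<lparr>vecs = ae_class M H ` L2_fun M H,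
      vadd = (\<lambda>F G. ae_class M H (\<lambda>x. vadd H (rep F x) (rep G x))),
      vscale = (\<lambda>c F. ae_class M H (\<lambda>x. vscale H c (rep F x))),
      vinner = (\<lambda>F G. \<integral>x. vinner H (rep F x) (rep G x) \<partial>M)\<rparr>"


section \<open>The representations\<close>

definition L2_Rn :: "(real ^ 'n::finite \<Rightarrow> complex) set hspace" where
  "L2_Rn = L2 lebesgue complex_hspace"

fun shift_rep ::
  "'n::finite aff \<Rightarrow> (real ^ 'n \<Rightarrow> complex) set \<Rightarrow> (real ^ 'n \<Rightarrow> complex) set" where
  "shift_rep (x, L) F = ae_class lebesgue complex_hspace (\<lambda>u. rep F (matrix_inv L *v u - x))"

definition char_fun :: "real ^ 'n::finite \<Rightarrow> real ^ 'n \<Rightarrow> complex" where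
  "char_fun y u = exp (2 * of_real pi * \<i> * of_real (y \<bullet> u))"

fun U_rep ::
  "('n::finite aff) set \<Rightarrow> (real ^ 'n ^ 'n \<Rightarrow> real ^ 'n) \<Rightarrow> real ^ 'n \<Rightarrow> 'n aff \<Rightarrow>
   (real ^ 'n ^ 'n \<Rightarrow> complex) \<Rightarrow> real ^ 'n ^ 'n \<Rightarrow> complex" where
  "U_rep \<Gamma> \<xi> r (x, L) \<zeta> M =
     (if M \<in> point_group \<Gamma>
      then char_fun r (\<xi> (matrix_inv L ** M) - \<xi> M + matrix_inv M *v (L *v x))
             * \<zeta> (matrix_inv L ** M)
      else 0)"

definition fibre :: "('n::finite aff) set \<Rightarrow> ((real ^ 'n ^ 'n) \<times> (real ^ 'n) \<Rightarrow> complex) hspace" where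
  "fibre \<Gamma> = ell2_tensor (point_group \<Gamma>) (dual_lattice \<Gamma>)"

definition L2_R ::
  "('n::finite aff) set \<Rightarrow> (real ^ 'n) set \<Rightarrow>
   (real ^ 'n \<Rightarrow> (real ^ 'n ^ 'n) \<times> (real ^ 'n) \<Rightarrow> complex) set hspace" where
  "L2_R \<Gamma> R = L2 (lebesgue_on R) (fibre \<Gamma>)"

definition tau_rep ::
  "('n::finite aff) set \<Rightarrow> (real ^ 'n ^ 'n \<Rightarrow> real ^ 'n) \<Rightarrow> (real ^ 'n) set \<Rightarrow> 'n aff \<Rightarrow>
   (real ^ 'n \<Rightarrow> (real ^ 'n ^ 'n) \<times> (real ^ 'n) \<Rightarrow> complex) set \<Rightarrow>
   (real ^ 'n \<Rightarrow> (real ^ 'n ^ 'n) \<times> (real ^ 'n) \<Rightarrow> complex) set" where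
  "tau_rep \<Gamma> \<xi> R g F =
     ae_class (lebesgue_on R) (fibre \<Gamma>) (\<lambda>r. op_tensor (U_rep \<Gamma> \<xi> r g) id (rep F r))"


section \<open>Consistency of the encodings\<close>

lemma orthogonal_inv:
  fixes L :: "real ^ 'n::finite ^ 'n"
  assumes "orthogonal_matrix L"
  shows "matrix_inv L = transpose L"
proof -
  have tL: "L ** transpose L = mat 1" "transpose L ** L = mat 1"
    using assms by (auto simp: orthogonal_matrix_def)
  then have "matrix_inv L ** L = mat 1"
    using someI[of "\<lambda>A. L ** A = mat 1 \<and> A ** L = mat 1" "transpose L"]
    by (simp add: matrix_inv_def)
  then show ?thesis
    using tL by (metis matrix_mul_assoc matrix_mul_lid matrix_mul_rid)
qed

lemma matrix_vector_neg:
  fixes L :: "real ^ 'n::finite ^ 'n"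
  shows "L *v (- x) = - (L *v x)"
  by (rule linear_neg) simp

lemma aff_act_mult:
  assumes "h \<in> carrier isom_group"
  shows "aff_act (g \<otimes>\<^bsub>isom_group\<^esub> h) u = aff_act g (aff_act h u)"
proof -
  obtain x L y M where gh: "g = (x, L)" "h = (y, M)"
    by (metis surj_pair)
  have M: "orthogonal_matrix M"
    using assms gh by (auto simp: isom_group_def)
  have "M ** matrix_inv M = mat 1"
    using M by (simp add: orthogonal_inv orthogonal_matrix_def)
  then have "L ** M ** matrix_inv M = L"
    by (simp flip: matrix_mul_assoc)
  then show ?thesis
    by (simp add: gh isom_group_def matrix_vector_right_distrib matrix_vector_mul_assoc add_ac)
qed

lemma group_isom_group: "group (isom_group :: ('n::finite aff) monoid)"
proof (rule groupI)
  fix g h k :: "'n aff"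
  assume "g \<in> carrier isom_group" "h \<in> carrier isom_group" "k \<in> carrier isom_group"
  moreover obtain x L y M z N where "g = (x, L)" "h = (y, M)" "k = (z, N)"
    by (metis surj_pair)
  ultimately show "g \<otimes>\<^bsub>isom_group\<^esub> h \<otimes>\<^bsub>isom_group\<^esub> k = g \<otimes>\<^bsub>isom_group\<^esub> (h \<otimes>\<^bsub>isom_group\<^esub> k)"
    by (simp add: isom_group_def orthogonal_inv orthogonal_matrix_mul matrix_transpose_mul
        matrix_mul_assoc matrix_vector_right_distrib matrix_vector_mul_assoc
        del: transpose_matrix_vector)
next
  fix g :: "'n aff"
  assume g: "g \<in> carrier isom_group"
  obtain x L where xL: "g = (x, L)"
    by (metis surj_pair)
  have L: "orthogonal_matrix L" "orthogonal_matrix (transpose L)"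
    using g xL by (auto simp: isom_group_def orthogonal_matrix_def)
  have 1: "transpose L ** L = mat 1"
    using L by (simp add: orthogonal_matrix_def)
  show "\<exists>h\<in>carrier isom_group. h \<otimes>\<^bsub>isom_group\<^esub> g = \<one>\<^bsub>isom_group\<^esub>"
    by (rule bexI[of _ "(- (L *v x), transpose L)"])
      (use L in \<open>auto simp: xL isom_group_def orthogonal_inv matrix_vector_mul_assoc 1
        matrix_vector_neg simp del: transpose_matrix_vector\<close>)
  show "\<one>\<^bsub>isom_group\<^esub> \<otimes>\<^bsub>isom_group\<^esub> g = g"
    by (simp add: xL isom_group_def)
qed (auto simp: isom_group_def orthogonal_matrix_mul orthogonal_matrix_id)

lemma inv_isom_group:
  assumes "(x, L) \<in> carrier isom_group"
  shows "inv\<^bsub>isom_group\<^esub> (x, L) = (- (L *v x), matrix_inv L)"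
proof (rule group.inv_equality[OF group_isom_group])
  have L: "orthogonal_matrix L" "orthogonal_matrix (transpose L)"
    using assms by (auto simp: isom_group_def orthogonal_matrix_def)
  have 1: "transpose L ** L = mat 1"
    using L by (simp add: orthogonal_matrix_def)
  show "(- (L *v x), matrix_inv L) \<otimes>\<^bsub>isom_group\<^esub> (x, L) = \<one>\<^bsub>isom_group\<^esub>"
    using L by (simp add: isom_group_def orthogonal_inv matrix_vector_mul_assoc 1
        matrix_vector_neg del: transpose_matrix_vector)
  show "(- (L *v x), matrix_inv L) \<in> carrier isom_group"
    using L by (simp add: isom_group_def orthogonal_inv)
qed (use assms in auto)

lemma openin_orbit_space:
  "openin (orbit_space \<Gamma>) W \<longleftrightarrow> W \<subseteq> range (orbit \<Gamma>) \<and> open (orbit \<Gamma> -` W)"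
proof -
  have "istopology (\<lambda>W. W \<subseteq> range (orbit \<Gamma>) \<and> open (orbit \<Gamma> -` W))"
    unfolding istopology_def by (auto simp: vimage_Union intro: open_UN)
  then show ?thesis
    by (simp add: orbit_space_def topology_inverse')
qed

lemma ae_class_eq_iff:
  assumes "f \<in> L2_fun M H" "g \<in> L2_fun M H"
  shows "ae_class M H f = ae_class M H g \<longleftrightarrow> (AE x in M. f x = g x)"
proof
  assume "ae_class M H f = ae_class M H g"
  then have "f \<in> ae_class M H g"
    using assms by (auto simp: ae_class_def)
  then show "AE x in M. f x = g x"
    by (simp add: ae_class_def)
next
  assume *: "AE x in M. f x = g x"
  have "(AE x in M. h x = f x) \<longleftrightarrow> (AE x in M. h x = g x)" for h
    using * by (auto elim: eventually_elim2)
  then show "ae_class M H f = ae_class M H g"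
    by (simp add: ae_class_def)
qed

lemma rep_ae_class:
  assumes "f \<in> L2_fun M H"
  shows "rep (ae_class M H f) \<in> L2_fun M H" "AE x in M. rep (ae_class M H f) x = f x"
proof -
  have "f \<in> ae_class M H f"
    using assms by (simp add: ae_class_def)
  then have "rep (ae_class M H f) \<in> ae_class M H f"
    unfolding rep_def by (rule someI[where P = "\<lambda>h. h \<in> ae_class M H f"])
  then show "rep (ae_class M H f) \<in> L2_fun M H" "AE x in M. rep (ae_class M H f) x = f x"
    by (auto simp: ae_class_def)
qed

lemma op_tensor_elem_tensor:
  fixes A :: "('i \<Rightarrow> complex) \<Rightarrow> 'k \<Rightarrow> complex" and B :: "('j \<Rightarrow> complex) \<Rightarrow> 'l \<Rightarrow> complex"
  assumes "\<And>c \<zeta>. A (\<lambda>i. c * \<zeta> i) = (\<lambda>k. c * A \<zeta> k)" "\<And>c \<eta>. B (\<lambda>j. c * \<eta> j) = (\<lambda>l. c * B \<eta> l)"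
  shows "op_tensor A B (elem_tensor \<zeta> \<eta>) = elem_tensor (A \<zeta>) (B \<eta>)"
proof (rule ext)
  fix p :: "'k \<times> 'l"
  obtain k l where p: "p = (k, l)"
    by fastforce
  have "op_tensor A B (elem_tensor \<zeta> \<eta>) p = A (\<lambda>i. \<zeta> i * B \<eta> l) k"
    by (simp add: op_tensor_def elem_tensor_def p assms(2))
  also have "\<dots> = A (\<lambda>i. B \<eta> l * \<zeta> i) k"
    by (simp only: mult.commute)
  finally show "op_tensor A B (elem_tensor \<zeta> \<eta>) p = elem_tensor (A \<zeta>) (B \<eta>) p"
    by (simp add: assms(1) elem_tensor_def p)
qed

lemma elem_tensor_unit:
  "elem_tensor (\<lambda>i'. of_bool (i' = i)) (\<lambda>j'. of_bool (j' = j)) = (\<lambda>p. of_bool (p = (i, j)))"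
  by (auto simp: elem_tensor_def fun_eq_iff)

end

theory Submission
  imports Defs "HOL-Probability.Characteristic_Functions"
begin

text \<open>
The Fourier transform turns the shift representation into something almost diagonal. Write \<open>V\<close> for
the unitary Fourier transform on \<open>L\<^sup>2(\<real>\<^sup>n)\<close> with kernel \<open>exp(2\<pi>i x\<bullet>u)\<close>. If \<open>g = V f\<close>, then the
transform of \<open>\<pi>[x,L] f\<close> is the function \<open>v \<mapsto> \<chi>\<^sub>v(L x) g(L\<^sup>T v)\<close>, where \<open>L\<^sup>T\<close> is the inverse of \<open>L\<close>. Up
to a null set, \<open>\<real>\<^sup>n\<close> is the disjoint union of the tiles \<open>M(R + z)\<close>, with \<open>M\<close> in the point group and
\<open>z\<close> in the dual lattice, because the frontier of the convex set \<open>R\<close> is null. Recording a function by its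
values at the points \<open>M(r + z)\<close>, as a function of \<open>r \<in> R\<close> with values in \<open>l\<^sup>2\<close> of the pairs \<open>(M, z)\<close>, is
unitary, and remains so after multiplying the entry \<open>(M, z)\<close> by a factor of modulus \<open>1\<close>. The required
map sends \<open>f\<close> to

  \<open>(U f)(r)(M, z) = \<chi>\<^bsub>r+z\<^esub>(- x\<^sub>M) (V f)(M(r + z))\<close>.

The matrix \<open>L\<^sup>T\<close> permutes the tiles by \<open>(M, z) \<mapsto> (N, z)\<close> with \<open>N = L\<^sup>T M\<close>. Comparing the factors on both
sides of the intertwining relation leaves \<open>\<chi>\<^bsub>r+z\<^esub>(\<eta>)\<close> with \<open>\<eta> = x\<^sub>N - x\<^sub>M + M\<^sup>T L x\<close>. This \<open>\<eta>\<close> is the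
translation part of the product of the inverse of \<open>\<gamma>(M)\<close>, of \<open>[x,L]\<close> and of \<open>\<gamma>(N)\<close>, whose linear part is
trivial. Hence it is a lattice vector (\<open>lattice_cocycle\<close>), so \<open>\<chi>\<^sub>z(\<eta>) = 1\<close>, and what remains is
exactly the factor \<open>\<chi>\<^sub>r(\<eta>)\<close> in the definition of \<open>U\<^sup>r\<close> (\<open>unfolds_tau\<close>). The variable \<open>z\<close> is only
carried along, which accounts for the tensor factor \<open>I\<close>.

The Plancherel theorem (\<open>plancherel\<close>) comes from Gaussians. For the functions
\<open>exp(- \<pi>s|u|\<^sup>2 + 2\<pi>(a + ib)\<bullet>u)\<close> the transform and all inner products are explicit, and completing
squares shows that the transform preserves the inner products (\<open>ip_gauss\<close>, \<open>ip_gauss_hat\<close>). The Gaussians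
span a dense subspace (\<open>total_gauss_family\<close>): a continuous function of compact support, divided by a
Gaussian, is uniformly approximated by polynomials in Gaussians by the Stone-Weierstrass theorem, and
multiplying back gives an approximation in norm. Two total families with equal Gram matrices determine a
unitary map (\<open>unitary_relation_matches\<close>), and the transform of \<open>f\<close> is characterised by its inner
products with the transformed Gaussians. In this form its behaviour under Euclidean isometries
(\<open>fourier_pair_isometry\<close>) has to be checked on Gaussians only.

Elements of \<open>L\<^sup>2\<close> are classes of functions. The Fourier transform and the passage to the tiles are
therefore stated as relations between functions; the relations are composed, and the composite is turned
into a map of classes by \<open>induced\<close>.
\<close>

section \<open>Unitary maps from relations between representatives\<close>

lemma rep_in_L2_fun:
  assumes "F \<in> vecs (L2 M' H')"
  shows "rep F \<in> L2_fun M' H'" "ae_class M' H' (rep F) = F"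
proof -
  obtain f where f: "f \<in> L2_fun M' H'" "F = ae_class M' H' f"
    using assms by (auto simp: L2_def)
  show "rep F \<in> L2_fun M' H'"
    using rep_ae_class[OF f(1)] f(2) by simp
  then show "ae_class M' H' (rep F) = F"
    using rep_ae_class[OF f(1)] f by (simp add: ae_class_eq_iff)
qed

text \<open>
The graph of a unitary map, lifted to representatives. The condition \<open>ae_closed\<close> says that the
relation does not see changes on null sets, and \<open>ae_iff\<close> that it is single-valued and injective on
classes.
\<close>

locale unitary_relation =
  fixes M :: "'a measure" and H :: "'v hspace" and N :: "'b measure" and K :: "'w hspace"
    and Q :: "('a \<Rightarrow> 'v) \<Rightarrow> ('b \<Rightarrow> 'w) \<Rightarrow> bool"
  assumes dom: "Q f g \<Longrightarrow> f \<in> L2_fun M H"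
    and ran: "Q f g \<Longrightarrow> g \<in> L2_fun N K"
    and left_total: "f \<in> L2_fun M H \<Longrightarrow> \<exists>g. Q f g"
    and right_total: "g \<in> L2_fun N K \<Longrightarrow> \<exists>f. Q f g"
    and ae_closed: "\<lbrakk>Q f g; f' \<in> L2_fun M H; AE x in M. f' x = f x;
       g' \<in> L2_fun N K; AE y in N. g' y = g y\<rbrakk> \<Longrightarrow> Q f' g'"
    and ae_iff: "\<lbrakk>Q f g; Q f' g'\<rbrakk> \<Longrightarrow> (AE x in M. f x = f' x) \<longleftrightarrow> (AE y in N. g y = g' y)"
    and add: "\<lbrakk>Q f g; Q f' g'\<rbrakk> \<Longrightarrow> Q (\<lambda>x. vadd H (f x) (f' x)) (\<lambda>y. vadd K (g y) (g' y))"
    and scale: "Q f g \<Longrightarrow> Q (\<lambda>x. vscale H c (f x)) (\<lambda>y. vscale K c (g y))"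
    and inner: "\<lbrakk>Q f g; Q f' g'\<rbrakk> \<Longrightarrow>
       (\<integral>x. vinner H (f x) (f' x) \<partial>M) = (\<integral>y. vinner K (g y) (g' y) \<partial>N)"
begin

text \<open>
The relation carries the members of one class onto the members of another, so the image of a class can be
formed without choosing a representative.
\<close>

definition induced :: "('a \<Rightarrow> 'v) set \<Rightarrow> ('b \<Rightarrow> 'w) set" where
  "induced F = {g. \<exists>f\<in>F. Q f g}"

lemma induced_ae_class:
  assumes "Q f g"
  shows "induced (ae_class M H f) = ae_class N K g"
proof (intro equalityI subsetI)
  fix g' assume "g' \<in> induced (ae_class M H f)"
  then obtain f' where f': "f' \<in> L2_fun M H" "AE x in M. f' x = f x" "Q f' g'"
    by (auto simp: induced_def ae_class_def)
  then show "g' \<in> ae_class N K g"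
    using ae_iff[OF f'(3) assms] ran[OF f'(3)] by (simp add: ae_class_def)
next
  fix g' assume "g' \<in> ae_class N K g"
  then have "g' \<in> L2_fun N K" "AE x in N. g' x = g x"
    by (auto simp: ae_class_def)
  then have "Q f g'"
    using ae_closed[OF assms dom[OF assms]] by simp
  then show "g' \<in> induced (ae_class M H f)"
    using dom by (auto simp: induced_def ae_class_def)
qed

lemma induced_in_vecs:
  assumes "F \<in> vecs (L2 M H)"
  shows "induced F \<in> vecs (L2 N K)"
proof -
  obtain g where "Q (rep F) g"
    using left_total rep_in_L2_fun[OF assms] by blast
  then show ?thesis
    using induced_ae_class[of "rep F" g] rep_in_L2_fun[OF assms] ran by (auto simp: L2_def)
qed

lemma related_rep_induced:
  assumes "F \<in> vecs (L2 M H)"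
  shows "Q (rep F) (rep (induced F))"
proof -
  obtain g where g: "Q (rep F) g"
    using left_total rep_in_L2_fun[OF assms] by blast
  then have "induced F = ae_class N K g"
    using induced_ae_class[of "rep F" g] rep_in_L2_fun[OF assms] by simp
  then have "rep (induced F) \<in> L2_fun N K" "AE y in N. rep (induced F) y = g y"
    using rep_ae_class[OF ran[OF g]] by simp_all
  then show ?thesis
    using ae_closed[OF g dom[OF g]] by simp
qed

theorem unitary_map_induced: "unitary_map (L2 M H) (L2 N K) induced"
  unfolding unitary_map_def
proof (intro conjI ballI allI)
  show "bij_betw induced (vecs (L2 M H)) (vecs (L2 N K))"
  proof (rule bij_betw_imageI)
    show "inj_on induced (vecs (L2 M H))"
    proof (rule inj_onI)
      fix F G assume FG: "F \<in> vecs (L2 M H)" "G \<in> vecs (L2 M H)" "induced F = induced G"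
      have "AE x in M. rep F x = rep G x"
        using ae_iff[OF FG(1,2)[THEN related_rep_induced]] FG(3) by simp
      then have "ae_class M H (rep F) = ae_class M H (rep G)"
        using rep_in_L2_fun(1)[OF FG(1)] rep_in_L2_fun(1)[OF FG(2)] by (simp add: ae_class_eq_iff)
      then show "F = G"
        using rep_in_L2_fun(2)[OF FG(1)] rep_in_L2_fun(2)[OF FG(2)] by simp
    qed
    show "induced ` vecs (L2 M H) = vecs (L2 N K)"
    proof (intro equalityI subsetI)
      fix G assume G: "G \<in> vecs (L2 N K)"
      obtain f where f: "Q f (rep G)" "ae_class N K (rep G) = G"
        using right_total[OF rep_in_L2_fun(1)[OF G]] rep_in_L2_fun(2)[OF G] by auto
      have "G = induced (ae_class M H f)"
        using induced_ae_class[OF f(1)] f(2) by simp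
      moreover have "ae_class M H f \<in> vecs (L2 M H)"
        using dom[OF f(1)] by (simp add: L2_def)
      ultimately show "G \<in> induced ` vecs (L2 M H)"
        by (rule image_eqI)
    qed (use induced_in_vecs in auto)
  qed
next
  fix F G assume "F \<in> vecs (L2 M H)" "G \<in> vecs (L2 M H)"
  note r = this[THEN related_rep_induced]
  show "induced (vadd (L2 M H) F G) = vadd (L2 N K) (induced F) (induced G)"
    using induced_ae_class[OF add[OF r]] by (simp add: L2_def)
  show "vinner (L2 N K) (induced F) (induced G) = vinner (L2 M H) F G"
    using inner[OF r] by (simp add: L2_def)
next
  fix c F assume "F \<in> vecs (L2 M H)"
  note r = this[THEN related_rep_induced]
  show "induced (vscale (L2 M H) c F) = vscale (L2 N K) c (induced F)"
    using induced_ae_class[OF scale[OF r]] by (simp add: L2_def)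
qed

text \<open>
Operators on classes are given by applying an operator on functions to a representative; the choice is
harmless because the representative of \<open>F\<close> is related to the representative of its image.
\<close>

theorem induced_intertwines:
  assumes "\<And>f g. Q f g \<Longrightarrow> Q (\<sigma> f) (\<tau> g)" and G: "G \<in> vecs (L2 N K)"
  shows "induced (ae_class M H (\<sigma> (rep (inv_into (vecs (L2 M H)) induced G))))
       = ae_class N K (\<tau> (rep G))"
proof -
  have bij: "bij_betw induced (vecs (L2 M H)) (vecs (L2 N K))"
    using unitary_map_induced by (simp add: unitary_map_def)
  define F where "F = inv_into (vecs (L2 M H)) induced G"
  have F: "F \<in> vecs (L2 M H)" "induced F = G"
    using bij G by (auto simp: F_def bij_betw_def inv_into_into f_inv_into_f)
  have "Q (\<sigma> (rep F)) (\<tau> (rep G))"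
    using assms(1)[OF related_rep_induced[OF F(1)]] F(2) by simp
  then show ?thesis
    using induced_ae_class F_def by simp
qed

end

lemma unitary_relation_relcompp:
  assumes "unitary_relation M H N K P" "unitary_relation N K N' K' Q"
  shows "unitary_relation M H N' K' (P OO Q)"
proof -
  interpret P: unitary_relation M H N K P by fact
  interpret Q: unitary_relation N K N' K' Q by fact
  show ?thesis
  proof
    fix f h f' h' assume "(P OO Q) f h" and f': "f' \<in> L2_fun M H" "AE x in M. f' x = f x"
      and h': "h' \<in> L2_fun N' K'" "AE x in N'. h' x = h x"
    then obtain g where g: "P f g" "Q g h"
      by auto
    have "P f' g"
      using P.ae_closed[OF g(1) f' P.ran[OF g(1)]] by simp
    moreover have "Q g h'"
      using Q.ae_closed[OF g(2) P.ran[OF g(1)] _ h'] by simp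
    ultimately show "(P OO Q) f' h'"
      by auto
  next
    fix f h f' h' assume "(P OO Q) f h" "(P OO Q) f' h'"
    then obtain g g' where g: "P f g" "Q g h" "P f' g'" "Q g' h'"
      by auto
    show "(AE x in M. f x = f' x) \<longleftrightarrow> (AE x in N'. h x = h' x)"
      using P.ae_iff[OF g(1,3)] Q.ae_iff[OF g(2,4)] by simp
    show "(P OO Q) (\<lambda>x. vadd H (f x) (f' x)) (\<lambda>y. vadd K' (h y) (h' y))"
      using P.add[OF g(1,3)] Q.add[OF g(2,4)] by auto
    show "(\<integral>x. vinner H (f x) (f' x) \<partial>M) = (\<integral>y. vinner K' (h y) (h' y) \<partial>N')"
      using P.inner[OF g(1,3)] Q.inner[OF g(2,4)] by simp
  next
    fix f assume "f \<in> L2_fun M H"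
    then show "\<exists>h. (P OO Q) f h"
      using P.left_total[of f] P.ran[of f] Q.left_total by (meson relcompp.relcompI)
  next
    fix h assume "h \<in> L2_fun N' K'"
    then show "\<exists>f. (P OO Q) f h"
      using Q.right_total[of h] Q.dom[of _ h] P.right_total by (meson relcompp.relcompI)
  next
    fix c f h assume "(P OO Q) f h"
    then obtain g where "P f g" "Q g h"
      by auto
    then show "(P OO Q) (\<lambda>x. vscale H c (f x)) (\<lambda>y. vscale K' c (h y))"
      using P.scale[of f g c] Q.scale[of g h c] by auto
  qed (elim relcomppE, erule P.dom Q.ran)+
qed

section \<open>Square-integrable complex functions\<close>

text \<open>
For complex functions the inner product and the squared norm are taken on functions, so that
linearity, limits and completeness can be used before passing to classes.
\<close>

abbreviation L2c :: "'a measure \<Rightarrow> ('a \<Rightarrow> complex) set" where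
  "L2c M \<equiv> L2_fun M complex_hspace"

definition ip :: "'a measure \<Rightarrow> ('a \<Rightarrow> complex) \<Rightarrow> ('a \<Rightarrow> complex) \<Rightarrow> complex" where
  "ip M f g = (\<integral>x. f x * cnj (g x) \<partial>M)"

definition nsq :: "'a measure \<Rightarrow> ('a \<Rightarrow> complex) \<Rightarrow> real" where
  "nsq M f = (\<integral>x. (cmod (f x))\<^sup>2 \<partial>M)"

lemma L2c_iff:
  "f \<in> L2c M \<longleftrightarrow> f \<in> borel_measurable M \<and> integrable M (\<lambda>x. (cmod (f x))\<^sup>2)"
proof -
  have "(\<forall>v. (\<lambda>x. f x * cnj v) \<in> borel_measurable M) \<longleftrightarrow> f \<in> borel_measurable M"
    by (auto dest: spec[of _ 1])
  moreover have "integrable M (\<lambda>x. f x * cnj (f x)) \<longleftrightarrow> integrable M (\<lambda>x. (cmod (f x))\<^sup>2)"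
    by (simp add: complex_norm_square[symmetric] complex_of_real_integrable_eq del: of_real_power)
  ultimately show ?thesis
    by (simp add: L2_fun_def complex_hspace_def)
qed

lemma L2cD:
  assumes "f \<in> L2c M"
  shows "f \<in> borel_measurable M" "integrable M (\<lambda>x. (cmod (f x))\<^sup>2)"
  using assms by (auto simp: L2c_iff)

lemma cmod_mult_le_squares: "cmod (a * b) \<le> (cmod a)\<^sup>2 + (cmod b)\<^sup>2"
proof -
  have "2 * (cmod a * cmod b) \<le> (cmod a)\<^sup>2 + (cmod b)\<^sup>2"
    using sum_squares_bound[of "cmod a" "cmod b"] by simp
  moreover have "0 \<le> cmod a * cmod b"
    by simp
  ultimately show ?thesis
    unfolding norm_mult by linarith
qed

lemma cmod_add_square_le: "(cmod (a + b))\<^sup>2 \<le> 2 * (cmod a)\<^sup>2 + 2 * (cmod b)\<^sup>2"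
proof -
  have "(cmod (a + b))\<^sup>2 \<le> (cmod a + cmod b)\<^sup>2"
    by (intro power_mono norm_triangle_ineq) simp
  also have "\<dots> \<le> 2 * (cmod a)\<^sup>2 + 2 * (cmod b)\<^sup>2"
    using sum_squares_bound[of "cmod a" "cmod b"] by (simp add: power2_sum)
  finally show ?thesis .
qed

lemma L2c_add:
  assumes "f \<in> L2c M" "g \<in> L2c M"
  shows "(\<lambda>x. f x + g x) \<in> L2c M"
proof -
  note [measurable] = L2cD(1)[OF assms(1)] L2cD(1)[OF assms(2)]
  have "integrable M (\<lambda>x. (cmod (f x + g x))\<^sup>2)"
    by (rule Bochner_Integration.integrable_bound
          [of M "\<lambda>x. 2 * (cmod (f x))\<^sup>2 + 2 * (cmod (g x))\<^sup>2"])
       (use assms cmod_add_square_le in \<open>auto simp: L2c_iff\<close>)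
  then show ?thesis
    by (simp add: L2c_iff)
qed

lemma L2c_scale:
  assumes "f \<in> L2c M"
  shows "(\<lambda>x. c * f x) \<in> L2c M"
  using assms by (auto simp: L2c_iff norm_mult power_mult_distrib)

lemma L2c_zero: "(\<lambda>x. 0) \<in> L2c M"
  by (simp add: L2c_iff)

lemma L2c_diff:
  assumes "f \<in> L2c M" "g \<in> L2c M"
  shows "(\<lambda>x. f x - g x) \<in> L2c M"
  using L2c_add[OF assms(1) L2c_scale[OF assms(2), of "-1"]] by simp

lemma borel_measurable_cnj [measurable (raw)]:
  "f \<in> borel_measurable M \<Longrightarrow> (\<lambda>x. cnj (f x)) \<in> borel_measurable M"
  by (rule borel_measurable_continuous_on[of cnj]) (intro continuous_intros)

lemma integrable_ip:
  assumes "f \<in> L2c M" "g \<in> L2c M"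
  shows "integrable M (\<lambda>x. f x * cnj (g x))"
proof -
  note [measurable] = L2cD(1)[OF assms(1)] L2cD(1)[OF assms(2)]
  have "(\<lambda>x. f x * cnj (g x)) \<in> borel_measurable M"
    by measurable
  moreover have "integrable M (\<lambda>x. (cmod (f x))\<^sup>2 + (cmod (g x))\<^sup>2)"
    using assms by (auto simp: L2c_iff)
  moreover have "norm (f x * cnj (g x)) \<le> norm ((cmod (f x))\<^sup>2 + (cmod (g x))\<^sup>2)" for x
    using cmod_mult_le_squares[of "f x" "cnj (g x)"] by simp
  ultimately show ?thesis
    using Bochner_Integration.integrable_bound by blast
qed

lemma ip_lincomb_left:
  assumes "f \<in> L2c M" "f' \<in> L2c M" "g \<in> L2c M"
  shows "ip M (\<lambda>x. c * f x + f' x) g = c * ip M f g + ip M f' g"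
  using integrable_ip[OF assms(1,3)] integrable_ip[OF assms(2,3)]
  by (simp add: ip_def distrib_right mult.assoc)

lemma ip_cnj: "ip M f g = cnj (ip M g f)"
  unfolding ip_def by (subst Bochner_Integration.integral_cnj[symmetric]) (simp add: mult.commute)

lemma ip_lincomb_right:
  assumes "f \<in> L2c M" "g \<in> L2c M" "g' \<in> L2c M"
  shows "ip M f (\<lambda>x. c * g x + g' x) = cnj c * ip M f g + ip M f g'"
  using ip_lincomb_left[OF assms(2,3,1)] ip_cnj[of M f "\<lambda>x. c * g x + g' x"] ip_cnj[of M f g]
    ip_cnj[of M f g'] by simp

lemma ip_zero [simp]: "ip M (\<lambda>x. 0) g = 0" "ip M f (\<lambda>x. 0) = 0"
  by (simp_all add: ip_def)

lemma ip_self: "ip M f f = of_real (nsq M f)"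
  unfolding ip_def nsq_def
  by (subst integral_complex_of_real[symmetric]) (simp only: complex_norm_square)

lemma nsq_nonneg: "0 \<le> nsq M f"
  by (simp add: nsq_def)

lemma nsq_minus_commute: "nsq M (\<lambda>x. f x - g x) = nsq M (\<lambda>x. g x - f x)"
  by (simp add: nsq_def norm_minus_commute)

lemma nsq_add_le:
  assumes "f \<in> L2c M" "g \<in> L2c M"
  shows "nsq M (\<lambda>x. f x + g x) \<le> 2 * nsq M f + 2 * nsq M g"
proof -
  have "nsq M (\<lambda>x. f x + g x) \<le> (\<integral>x. 2 * (cmod (f x))\<^sup>2 + 2 * (cmod (g x))\<^sup>2 \<partial>M)"
    unfolding nsq_def
    by (intro integral_mono) (use assms L2c_add[OF assms] cmod_add_square_le in \<open>auto simp: L2c_iff\<close>)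
  also have "\<dots> = 2 * nsq M f + 2 * nsq M g"
    using assms by (simp add: nsq_def L2c_iff)
  finally show ?thesis .
qed

lemma nsq_diff_triangle:
  assumes "f \<in> L2c M" "g \<in> L2c M" "h \<in> L2c M"
  shows "nsq M (\<lambda>x. f x - h x) \<le> 2 * nsq M (\<lambda>x. f x - g x) + 2 * nsq M (\<lambda>x. g x - h x)"
  using nsq_add_le[OF L2c_diff[OF assms(1,2)] L2c_diff[OF assms(2,3)]] by simp

lemma nsq_eq_0_iff:
  assumes "f \<in> L2c M"
  shows "nsq M f = 0 \<longleftrightarrow> (AE x in M. f x = 0)"
  using assms unfolding nsq_def by (subst integral_nonneg_eq_0_iff_AE) (auto simp: L2c_iff)

lemma ip_Cauchy_Schwarz:
  assumes "f \<in> L2c M" "g \<in> L2c M"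
  shows "(cmod (ip M f g))\<^sup>2 \<le> nsq M f * nsq M g"
proof -
  note [measurable] = L2cD(1)[OF assms(1)] L2cD(1)[OF assms(2)]
  define a where "a = (\<integral>x. cmod (f x) * cmod (g x) \<partial>M)"
  have int: "integrable M (\<lambda>x. cmod (f x) * cmod (g x))"
    using integrable_norm[OF integrable_ip[OF assms]] by (simp add: norm_mult)
  have "ennreal (a\<^sup>2) = (\<integral>\<^sup>+x. ennreal (cmod (f x)) * ennreal (cmod (g x)) \<partial>M)\<^sup>2"
    using nn_integral_eq_integral[OF int] by (simp add: a_def ennreal_mult ennreal_power)
  also have "\<dots> \<le> (\<integral>\<^sup>+x. (ennreal (cmod (f x)))\<^sup>2 \<partial>M) * (\<integral>\<^sup>+x. (ennreal (cmod (g x)))\<^sup>2 \<partial>M)"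
    by (rule Cauchy_Schwarz_nn_integral) auto
  also have "\<dots> = ennreal (nsq M f * nsq M g)"
    using nn_integral_eq_integral[OF L2cD(2)[OF assms(1)]] nn_integral_eq_integral[OF L2cD(2)[OF assms(2)]]
    by (simp add: nsq_def ennreal_mult ennreal_power)
  finally have "a\<^sup>2 \<le> nsq M f * nsq M g"
    by (subst (asm) ennreal_le_iff) (simp_all add: nsq_nonneg)
  moreover have "cmod (ip M f g) \<le> a"
    unfolding ip_def a_def using integral_norm_bound[of M "\<lambda>x. f x * cnj (g x)"] by (simp add: norm_mult)
  then have "(cmod (ip M f g))\<^sup>2 \<le> a\<^sup>2"
    by (rule power_mono) simp
  ultimately show ?thesis
    by linarith
qed

lemma ip_tendsto_left:
  assumes f: "\<And>k. f k \<in> L2c M" "f' \<in> L2c M" "g \<in> L2c M"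
    and lim: "(\<lambda>k. nsq M (\<lambda>x. f k x - f' x)) \<longlonglongrightarrow> 0"
  shows "(\<lambda>k. ip M (f k) g) \<longlonglongrightarrow> ip M f' g"
proof -
  have eq: "ip M (f k) g - ip M f' g = ip M (\<lambda>x. f k x - f' x) g" for k
    using ip_lincomb_left[OF f(2,1,3), of "-1" k] by simp
  have "(\<lambda>k. (cmod (ip M (f k) g - ip M f' g))\<^sup>2) \<longlonglongrightarrow> 0"
  proof (rule tendsto_sandwich[OF _ _ tendsto_const])
    show "(\<lambda>k. nsq M (\<lambda>x. f k x - f' x) * nsq M g) \<longlonglongrightarrow> 0"
      using tendsto_mult_left_zero[OF lim] .
  qed (use ip_Cauchy_Schwarz[OF L2c_diff[OF f(1,2)] f(3)] in \<open>auto simp: eq\<close>)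
  then have "(\<lambda>k. sqrt ((cmod (ip M (f k) g - ip M f' g))\<^sup>2)) \<longlonglongrightarrow> sqrt 0"
    by (rule tendsto_real_sqrt)
  then have "(\<lambda>k. ip M (f k) g - ip M f' g) \<longlonglongrightarrow> 0"
    by (simp add: tendsto_norm_zero_iff)
  then show ?thesis
    by (rule LIM_zero_cancel)
qed

lemma ip_cong_AE_left:
  assumes "f \<in> L2c K" "f' \<in> L2c K" "g \<in> L2c K" "AE x in K. f' x = f x"
  shows "ip K f' g = ip K f g"
proof -
  have [measurable]: "f \<in> borel_measurable K" "f' \<in> borel_measurable K" "g \<in> borel_measurable K"
    using assms by (auto simp: L2c_iff)
  show ?thesis
    unfolding ip_def by (rule integral_cong_AE) (use assms(4) in auto)
qed

text \<open>
Riesz-Fischer, for sequences that converge fast. With increments \<open>d k\<close>, the sum \<open>S\<close> of the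
functions \<open>4 ^ k * |d k|\<^sup>2\<close> is integrable. Wherever it is finite, the telescoping series converges, and
Cauchy-Schwarz against \<open>(1/2) ^ k\<close> bounds the squared tail from \<open>n\<close> on by \<open>2 * (1/4) ^ n * S\<close>;
integrating this bound gives convergence in norm.
\<close>

lemma L2c_complete:
  assumes q: "\<And>k. q k \<in> L2c M"
    and le: "\<And>k. nsq M (\<lambda>x. q (Suc k) x - q k x) \<le> (1/16) ^ k"
  shows "\<exists>g\<in>L2c M. (\<lambda>k. nsq M (\<lambda>x. q k x - g x)) \<longlonglongrightarrow> 0"
proof -
  note [measurable] = L2cD(1)[OF q]
  define d where "d k x = q (Suc k) x - q k x" for k x
  have d: "d k \<in> L2c M" for k
    unfolding d_def by (intro L2c_diff q)
  note [measurable] = L2cD(1)[OF d]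
  define w where "w k x = 4 ^ k * (cmod (d k x))\<^sup>2" for k x
  have w0: "0 \<le> w k x" for k x
    by (simp add: w_def)
  have wm [measurable]: "w k \<in> borel_measurable M" for k
    unfolding w_def by measurable
  have wint: "integrable M (w k)" for k
    unfolding w_def by (intro integrable_mult_right L2cD(2)[OF d])
  have wle: "(\<integral>x. w k x \<partial>M) \<le> (1/4) ^ k" for k
  proof -
    have "(\<integral>x. w k x \<partial>M) \<le> 4 ^ k * (1/16) ^ k"
      using le[of k] by (simp add: w_def nsq_def d_def)
    then show ?thesis
      by (simp add: power_mult_distrib[symmetric])
  qed
  define S where "S x = (\<Sum>k. ennreal (w k x))" for x
  have "(\<integral>\<^sup>+x. S x \<partial>M) = (\<Sum>k. ennreal (\<integral>x. w k x \<partial>M))"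
    unfolding S_def by (simp add: nn_integral_suminf nn_integral_eq_integral[OF wint] w0)
  also have "\<dots> \<le> (\<Sum>k. ennreal ((1/4) ^ k))"
    by (intro suminf_le summableI) (use wle in \<open>auto intro: ennreal_leI\<close>)
  also have "\<dots> = ennreal (\<Sum>k. (1/4) ^ k)"
    by (intro suminf_ennreal2) (auto intro: summable_geometric)
  also have "\<dots> \<le> ennreal 2"
    by (subst suminf_geometric) (auto intro!: ennreal_leI simp del: ennreal_numeral)
  finally have Sint: "(\<integral>\<^sup>+x. S x \<partial>M) \<le> ennreal 2" .
  have [measurable]: "S \<in> borel_measurable M"
    unfolding S_def by measurable
  define s where "s x = enn2real (S x)" for x
  have "AE x in M. S x \<noteq> \<infinity>"
    using Sint by (intro nn_integral_PInf_AE) (auto simp: top_unique)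
  then have s: "AE x in M. ennreal (s x) = S x"
    by (rule eventually_mono) (simp add: s_def less_top)
  have [measurable]: "s \<in> borel_measurable M"
    unfolding s_def by measurable
  have s0: "0 \<le> s x" for x
    by (simp add: s_def)
  have sint: "integrable M s" and sle: "(\<integral>x. s x \<partial>M) \<le> 2"
  proof -
    have eq: "(\<integral>\<^sup>+x. ennreal (s x) \<partial>M) = (\<integral>\<^sup>+x. S x \<partial>M)"
      using s by (intro nn_integral_cong_AE) auto
    have "(\<integral>\<^sup>+x. ennreal (s x) \<partial>M) < \<infinity>"
      unfolding eq using le_less_trans[OF Sint ennreal_less_top] by simp
    then show "integrable M s"
      by (intro integrableI_bounded) (simp_all add: s0)
    from nn_integral_eq_integral[OF this] show "(\<integral>x. s x \<partial>M) \<le> 2"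
      using eq Sint s0 by (simp del: ennreal_numeral)
  qed
  define g where "g x = lim (\<lambda>k. q k x)" for x
  have gm [measurable]: "g \<in> borel_measurable M"
    unfolding g_def by (rule borel_measurable_lim_metric) simp
  have key: "(\<lambda>k. q k x) \<longlonglongrightarrow> g x \<and> (\<forall>n. (cmod (q n x - g x))\<^sup>2 \<le> 2 * (1/4) ^ n * s x)"
    if "ennreal (s x) = S x" for x
  proof -
    have "summable (\<lambda>k. w k x)"
      using that w0 by (intro summable_suminf_not_top) (auto simp: S_def[symmetric])
    then have ws: "(\<lambda>k. w k x) sums s x"
      using that w0 s0 by (simp add: S_def suminf_ennreal2 summable_sums_iff suminf_nonneg)
    have bound: "(\<Sum>k\<in>{n..<m}. cmod (d k x))\<^sup>2 \<le> 2 * (1/4) ^ n * s x" for n m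
    proof -
      have "(\<Sum>k\<in>{n..<m}. cmod (d k x))\<^sup>2 = (\<Sum>k\<in>{n..<m}. (1/2) ^ k * (2 ^ k * cmod (d k x)))\<^sup>2"
        by (simp add: power_one_over)
      also have "\<dots> \<le> (\<Sum>k\<in>{n..<m}. ((1/2) ^ k)\<^sup>2) * (\<Sum>k\<in>{n..<m}. (2 ^ k * cmod (d k x))\<^sup>2)"
        by (rule Cauchy_Schwarz_ineq_sum)
      also have "(\<Sum>k\<in>{n..<m}. (2 ^ k * cmod (d k x))\<^sup>2) = (\<Sum>k\<in>{n..<m}. w k x)"
        by (intro sum.cong) (simp_all add: w_def power_mult_distrib power2_eq_square power_mult_distrib[symmetric])
      also have "(\<Sum>k\<in>{n..<m}. ((1/2) ^ k)\<^sup>2) * (\<Sum>k\<in>{n..<m}. w k x) \<le> 2 * (1/4) ^ n * s x"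
      proof (intro mult_mono)
        show "(\<Sum>k\<in>{n..<m}. w k x) \<le> s x"
          using sum_le_suminf[of "\<lambda>k. w k x" "{n..<m}"] ws w0 by (simp add: sums_iff)
        have "(\<Sum>k\<in>{n..<m}. ((1/2::real) ^ k)\<^sup>2) = (\<Sum>k\<in>{n..<m}. (1/4) ^ k)"
          by (simp add: power2_eq_square power_mult_distrib[symmetric])
        also have "\<dots> \<le> 2 * (1/4) ^ n"
        proof (cases "n \<le> m")
          case True
          have "(\<Sum>k\<in>{n..<n + j}. (1/4::real) ^ k) = 4/3 * ((1/4) ^ n - (1/4) ^ (n + j))" for j
            by (induction j) (simp_all add: algebra_simps)
          from this[of "m - n"] True
          have "(\<Sum>k\<in>{n..<m}. (1/4::real) ^ k) = 4/3 * ((1/4) ^ n - (1/4) ^ m)"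
            by simp
          moreover have gen: "4/3 * (a - b) \<le> 2 * a" if "0 \<le> a" "0 \<le> b" for a b :: real
            using that by (simp add: field_simps)
          have "4/3 * ((1/4) ^ n - (1/4) ^ m) \<le> 2 * (1/4::real) ^ n"
            by (rule gen; rule zero_le_power; simp)
          ultimately show ?thesis
            by (rule ord_eq_le_trans)
        qed simp
        finally show "(\<Sum>k\<in>{n..<m}. ((1/2::real) ^ k)\<^sup>2) \<le> 2 * (1/4) ^ n" .
      qed (auto intro: sum_nonneg w0)
      finally show ?thesis .
    qed
    have diff: "q m x - q n x = (\<Sum>k\<in>{n..<m}. d k x)" if "n \<le> m" for n m
      using sum_Suc_diff'[OF that, of "\<lambda>k. q k x"] by (simp add: d_def)
    have bound': "(cmod (q n x - q m x))\<^sup>2 \<le> 2 * (1/4) ^ n * s x" if "n \<le> m" for n m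
    proof -
      have "cmod (q n x - q m x) \<le> (\<Sum>k\<in>{n..<m}. cmod (d k x))"
        using norm_sum[of "\<lambda>k. d k x" "{n..<m}"] by (simp add: diff[OF that, symmetric] norm_minus_commute)
      then have "(cmod (q n x - q m x))\<^sup>2 \<le> (\<Sum>k\<in>{n..<m}. cmod (d k x))\<^sup>2"
        by (intro power_mono) auto
      then show ?thesis
        using bound[of n m] by linarith
    qed
    have "summable (\<lambda>k. cmod (d k x))"
    proof (rule summable_comparison_test')
      show "summable (\<lambda>k. (1/2) ^ k + w k x)"
        using ws by (intro summable_add summable_geometric) (auto simp: sums_iff)
      fix k :: nat
      have "2 * ((1/2) ^ k * (2 ^ k * cmod (d k x))) \<le> ((1/2) ^ k)\<^sup>2 + (2 ^ k * cmod (d k x))\<^sup>2"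
        using sum_squares_bound[of "(1/2) ^ k" "2 ^ k * cmod (d k x)"] by (simp add: mult.assoc)
      moreover have "((1/2::real) ^ k)\<^sup>2 \<le> (1/2) ^ k"
        by (simp add: power2_eq_square power_le_one mult_le_cancel_left1)
      moreover have "(2 ^ k * cmod (d k x))\<^sup>2 = w k x"
        by (simp add: w_def power_mult_distrib power2_eq_square power_mult_distrib[symmetric])
      moreover have "(1/2) ^ k * (2 ^ k * cmod (d k x)) = cmod (d k x)"
        by (simp add: power_one_over)
      ultimately have "2 * cmod (d k x) \<le> (1/2) ^ k + w k x"
        by simp
      then show "norm (cmod (d k x)) \<le> (1/2) ^ k + w k x"
        using norm_ge_zero[of "d k x"] unfolding real_norm_def abs_norm_cancel by linarith
    qed
    then have "summable (\<lambda>k. d k x)"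
      by (rule summable_norm_cancel)
    then have conv: "convergent (\<lambda>n. \<Sum>k<n. d k x)"
      by (simp add: summable_iff_convergent)
    have "q n x = (\<Sum>k<n. d k x) + q 0 x" for n
      using diff[of 0 n] unfolding atLeast0LessThan by (simp only: diff_eq_eq)
    then have "(\<lambda>n. q n x) = (\<lambda>n. (\<Sum>k<n. d k x) + q 0 x)"
      by (rule ext)
    then have "convergent (\<lambda>n. q n x)"
      using convergent_add[OF conv convergent_const[of "q 0 x"]] by (simp only:)
    then have lim: "(\<lambda>k. q k x) \<longlonglongrightarrow> g x"
      by (simp add: g_def convergent_LIMSEQ_iff)
    moreover have "(cmod (q n x - g x))\<^sup>2 \<le> 2 * (1/4) ^ n * s x" for n
    proof (rule LIMSEQ_le_const2)
      show "(\<lambda>m. (cmod (q n x - q m x))\<^sup>2) \<longlonglongrightarrow> (cmod (q n x - g x))\<^sup>2"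
        by (intro tendsto_intros lim)
    qed (use bound' in blast)
    ultimately show ?thesis
      by blast
  qed
  have ae: "AE x in M. (cmod (q n x - g x))\<^sup>2 \<le> 2 * (1/4) ^ n * s x" for n
    using s by eventually_elim (use key in blast)
  have dint: "integrable M (\<lambda>x. (cmod (q n x - g x))\<^sup>2)" for n
    by (rule Bochner_Integration.integrable_bound[of M "\<lambda>x. 2 * (1/4) ^ n * s x"])
       (use sint ae[of n] s0 in auto)
  then have "(\<lambda>x. q 0 x - g x) \<in> L2c M"
    by (simp add: L2c_iff)
  from L2c_diff[OF q[of 0] this] have g: "g \<in> L2c M"
    by simp
  have nsq_le: "norm (nsq M (\<lambda>x. q n x - g x)) \<le> 4 * (1/4) ^ n" for n
  proof -
    have "nsq M (\<lambda>x. q n x - g x) \<le> (\<integral>x. 2 * (1/4) ^ n * s x \<partial>M)"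
      unfolding nsq_def by (intro integral_mono_AE dint ae) (intro integrable_mult_right sint)
    also have "\<dots> \<le> 2 * (1/4) ^ n * 2"
      using sle by simp
    finally show ?thesis
      by (simp add: nsq_nonneg)
  qed
  have "(\<lambda>n. 4 * (1/4::real) ^ n) \<longlonglongrightarrow> 0"
    using tendsto_mult_right_zero[OF LIMSEQ_power_zero[of "1/4::real"], of 4] by simp
  then have "(\<lambda>k. nsq M (\<lambda>x. q k x - g x)) \<longlonglongrightarrow> 0"
    by (rule Lim_null_comparison[rotated]) (use nsq_le in simp)
  with g show ?thesis
    by blast
qed

section \<open>Families with equal Gram matrices\<close>

text \<open>
The same linear combination formed in two families at once. Coefficients are not mentioned
because they need not be unique; that the first component determines the second almost everywhere is a
consequence of equal Gram matrices.
\<close>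

inductive pair_span :: "'i set \<Rightarrow> ('i \<Rightarrow> 'a \<Rightarrow> complex) \<Rightarrow> ('i \<Rightarrow> 'b \<Rightarrow> complex)
    \<Rightarrow> ('a \<Rightarrow> complex) \<Rightarrow> ('b \<Rightarrow> complex) \<Rightarrow> bool"
  for I e e' where
  zero: "pair_span I e e' (\<lambda>_. 0) (\<lambda>_. 0)"
| step: "i \<in> I \<Longrightarrow> pair_span I e e' p q \<Longrightarrow>
    pair_span I e e' (\<lambda>x. c * e i x + p x) (\<lambda>y. c * e' i y + q y)"

text \<open>The linear span of a single family is the diagonal case.\<close>

definition in_span :: "'i set \<Rightarrow> ('i \<Rightarrow> 'a \<Rightarrow> complex) \<Rightarrow> ('a \<Rightarrow> complex) \<Rightarrow> bool" where
  "in_span I e p \<longleftrightarrow> pair_span I e e p p"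

definition total_family :: "'a measure \<Rightarrow> 'i set \<Rightarrow> ('i \<Rightarrow> 'a \<Rightarrow> complex) \<Rightarrow> bool" where
  "total_family M I e \<longleftrightarrow> (\<forall>i\<in>I. e i \<in> L2c M) \<and>
     (\<forall>f\<in>L2c M. \<forall>\<epsilon>>0. \<exists>p. in_span I e p \<and> nsq M (\<lambda>x. f x - p x) < \<epsilon>)"

lemma pair_span_lincomb:
  assumes "pair_span I e e' p q" "pair_span I e e' p' q'"
  shows "pair_span I e e' (\<lambda>x. c * p x + p' x) (\<lambda>y. c * q y + q' y)"
  using assms(1)
proof induction
  case zero
  then show ?case using assms(2) by simp
next
  case (step i p q b)
  from pair_span.step[OF step(1,3), of "c * b"] show ?case
    by (simp add: algebra_simps)
qed

lemma pair_span_generator: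
  assumes "i \<in> I"
  shows "pair_span I e e' (e i) (e' i)"
  using pair_span.step[OF assms pair_span.zero, of e e' 1] by simp

lemma in_span_zero: "in_span I e (\<lambda>x. 0)"
  unfolding in_span_def by (rule pair_span.zero)

lemma in_span_generator: "i \<in> I \<Longrightarrow> in_span I e (e i)"
  unfolding in_span_def by (rule pair_span_generator)

lemma in_span_lincomb:
  "in_span I e p \<Longrightarrow> in_span I e p' \<Longrightarrow> in_span I e (\<lambda>x. c * p x + p' x)"
  unfolding in_span_def by (rule pair_span_lincomb)

lemma in_span_imp_pair_span:
  assumes "in_span I e p"
  shows "\<exists>q. pair_span I e e' p q"
proof -
  have "\<exists>q. pair_span I e e' p q" if "pair_span I e e p p'" for p'
    using that by induction (auto intro: pair_span.intros)
  then show ?thesis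
    using assms by (simp add: in_span_def)
qed

lemma in_span_trans:
  assumes "in_span I e p" and gen: "\<And>i. i \<in> I \<Longrightarrow> in_span J e' (e i)"
  shows "in_span J e' p"
proof -
  have "in_span J e' p" if "pair_span I e e p p'" for p'
    using that by induction (auto intro: in_span_zero in_span_lincomb gen)
  then show ?thesis
    using assms(1) by (simp add: in_span_def)
qed

text \<open>
Equal Gram matrices mean that \<open>e i \<mapsto> e' i\<close> preserves inner products of linear combinations; totality of
both families makes its extension to the closed spans a unitary map of the whole spaces.
\<close>

locale gram_pair =
  fixes M :: "'a measure" and N :: "'b measure" and I :: "'i set"
    and e :: "'i \<Rightarrow> 'a \<Rightarrow> complex" and e' :: "'i \<Rightarrow> 'b \<Rightarrow> complex"
  assumes total: "total_family M I e" "total_family N I e'"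
    and gram: "i \<in> I \<Longrightarrow> j \<in> I \<Longrightarrow> ip N (e' i) (e' j) = ip M (e i) (e j)"
begin

lemma L2c_gen: "i \<in> I \<Longrightarrow> e i \<in> L2c M" "i \<in> I \<Longrightarrow> e' i \<in> L2c N"
  using total by (auto simp: total_family_def)

text \<open>
A function is determined almost everywhere by its inner products with a total family. Describing the
extension through these numbers makes linearity immediate and treats the two families alike.
\<close>

definition matches :: "('a \<Rightarrow> complex) \<Rightarrow> ('b \<Rightarrow> complex) \<Rightarrow> bool" where
  "matches f g \<longleftrightarrow> f \<in> L2c M \<and> g \<in> L2c N \<and> (\<forall>i\<in>I. ip N g (e' i) = ip M f (e i))"

lemma matches_swap: "gram_pair.matches N M I e' e g f \<longleftrightarrow> matches f g"
proof -
  interpret swap: gram_pair N M I e' e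
    by unfold_locales (use total gram in auto)
  show ?thesis
    by (auto simp: matches_def swap.matches_def)
qed

lemma matches_lincomb:
  assumes "matches f g" "matches f' g'"
  shows "matches (\<lambda>x. c * f x + f' x) (\<lambda>y. c * g y + g' y)"
  using assms L2c_gen by (auto simp: matches_def ip_lincomb_left intro: L2c_add L2c_scale)

lemma matches_zero: "matches (\<lambda>x. 0) (\<lambda>y. 0)"
  by (simp add: matches_def L2c_zero)

lemma pair_span_L2c:
  assumes "pair_span I e e' p q"
  shows "p \<in> L2c M \<and> q \<in> L2c N"
  using assms
proof induction
  case (step i p q c)
  then show ?case
    using L2c_add[OF L2c_scale[OF L2c_gen(1)]] L2c_add[OF L2c_scale[OF L2c_gen(2)]] by blast
qed (auto intro: L2c_zero)

lemma pair_span_ip: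
  assumes "pair_span I e e' p q" "matches f g"
  shows "ip N g q = ip M f p"
  using assms(1)
proof induction
  case (step i p q c)
  then show ?case
    using assms(2) L2c_gen pair_span_L2c[OF step(2)] by (simp add: matches_def ip_lincomb_right)
qed simp

lemma pair_span_matches:
  assumes "pair_span I e e' p q"
  shows "matches p q"
  using assms
proof induction
  case (step i p q c)
  have "matches (e i) (e' i)"
    using step(1) gram L2c_gen by (auto simp: matches_def)
  then show ?case
    using matches_lincomb step(3) by blast
qed (rule matches_zero)

lemma pair_span_nsq:
  assumes "pair_span I e e' p q"
  shows "nsq N q = nsq M p"
  using pair_span_ip[OF assms pair_span_matches[OF assms]] by (simp add: ip_self)

text \<open>
Approximate \<open>f\<close> by combinations of the \<open>e i\<close>; the same combinations of the \<open>e' i\<close> form a Cauchy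
sequence, whose limit matches \<open>f\<close>. Inner products with any matching pair pass to the limit along both
sequences.
\<close>

lemma matches_exists:
  assumes f: "f \<in> L2c M"
  shows "\<exists>g. matches f g \<and> (\<forall>f' g'. matches f' g' \<longrightarrow> ip N g g' = ip M f f')"
proof -
  have "\<exists>p q. pair_span I e e' p q \<and> nsq M (\<lambda>x. f x - p x) < (1/16) ^ (Suc k)" for k
  proof -
    obtain p where "in_span I e p" "nsq M (\<lambda>x. f x - p x) < (1/16) ^ (Suc k)"
      using total(1) f unfolding total_family_def by (metis zero_less_divide_1_iff zero_less_numeral zero_less_power)
    then show ?thesis
      using in_span_imp_pair_span by blast
  qed
  then obtain p q where pq: "\<And>k. pair_span I e e' (p k) (q k)"
    and small: "\<And>k. nsq M (\<lambda>x. f x - p k x) < (1/16) ^ (Suc k)"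
    by metis
  have p: "p k \<in> L2c M" and q: "q k \<in> L2c N" for k
    using pair_span_L2c[OF pq] by auto
  have "nsq N (\<lambda>y. q (Suc k) y - q k y) \<le> (1/16) ^ k" for k
  proof -
    have "pair_span I e e' (\<lambda>x. (-1) * p k x + p (Suc k) x) (\<lambda>x. (-1) * q k x + q (Suc k) x)"
      by (rule pair_span_lincomb[OF pq pq])
    from pair_span_nsq[OF this]
    have "nsq N (\<lambda>y. q (Suc k) y - q k y) = nsq M (\<lambda>x. p (Suc k) x - p k x)"
      by simp
    also have "\<dots> \<le> 2 * nsq M (\<lambda>x. p (Suc k) x - f x) + 2 * nsq M (\<lambda>x. f x - p k x)"
      by (rule nsq_diff_triangle[OF p f p])
    also have "\<dots> \<le> 2 * (1/16) ^ (Suc (Suc k)) + 2 * (1/16) ^ (Suc k)"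
      using small[of "Suc k"] small[of k] by (subst (1) nsq_minus_commute) linarith
    also have "\<dots> \<le> (1/16) ^ k"
      by simp
    finally show ?thesis .
  qed
  from L2c_complete[of q N, OF q this] obtain g where g: "g \<in> L2c N"
    and limq: "(\<lambda>k. nsq N (\<lambda>y. q k y - g y)) \<longlonglongrightarrow> 0"
    by blast
  have limp: "(\<lambda>k. nsq M (\<lambda>x. p k x - f x)) \<longlonglongrightarrow> 0"
  proof (rule Lim_null_comparison)
    show "\<forall>\<^sub>F k in sequentially. norm (nsq M (\<lambda>x. p k x - f x)) \<le> (1/16) ^ (Suc k)"
      using less_imp_le[OF small] by (simp add: nsq_nonneg nsq_minus_commute[of M _ f])
    show "(\<lambda>k. (1/16::real) ^ (Suc k)) \<longlonglongrightarrow> 0"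
      by (rule LIMSEQ_Suc[OF LIMSEQ_power_zero]) simp
  qed
  have *: "ip N g g' = ip M f f'" if fg': "matches f' g'" for f' g'
  proof (rule LIMSEQ_unique)
    have f': "f' \<in> L2c M" and g': "g' \<in> L2c N"
      using fg' by (auto simp: matches_def)
    show "(\<lambda>k. ip N (q k) g') \<longlonglongrightarrow> ip N g g'"
      by (rule ip_tendsto_left[OF q g g' limq])
    have "ip N (q k) g' = ip M (p k) f'" for k
      using pair_span_ip[OF pq fg'] by (subst (1 2) ip_cnj) simp
    then show "(\<lambda>k. ip N (q k) g') \<longlonglongrightarrow> ip M f f'"
      using ip_tendsto_left[OF p f f' limp] by simp
  qed
  have "matches f g"
    using f g *[OF pair_span_matches[OF pair_span_generator]] by (auto simp: matches_def)
  with * show ?thesis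
    by blast
qed

text \<open>
Uniqueness comes from the existence result for the exchanged families: a partner of \<open>h\<close> has with
\<open>0\<close> the inner product that \<open>h\<close> has with itself.
\<close>

lemma matches_zero_imp:
  assumes "matches (\<lambda>x. 0) h"
  shows "AE y in N. h y = 0"
proof -
  interpret swap: gram_pair N M I e' e
    by unfold_locales (use total gram in auto)
  have h: "h \<in> L2c N"
    using assms by (simp add: matches_def)
  obtain f where "\<forall>f' h'. matches f' h' \<longrightarrow> ip M f f' = ip N h h'"
    using swap.matches_exists[OF h] unfolding matches_swap by blast
  then have "ip N h h = 0"
    using assms by force
  then show ?thesis
    using nsq_eq_0_iff[OF h] by (simp add: ip_self)
qed

lemma matches_ip:
  assumes "matches f g" "matches f' g'"
  shows "ip N g g' = ip M f f'"
proof -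
  have f: "f \<in> L2c M"
    using assms(1) by (simp add: matches_def)
  obtain h where h: "matches f h" "\<And>f' g'. matches f' g' \<Longrightarrow> ip N h g' = ip M f f'"
    using matches_exists[OF f] by blast
  have "matches (\<lambda>x. 0) (\<lambda>y. g y - h y)"
    using matches_lincomb[OF h(1) assms(1), of "-1"] by simp
  then have ae: "AE y in N. g y - h y = 0"
    by (rule matches_zero_imp)
  have [measurable]: "g \<in> borel_measurable N" "h \<in> borel_measurable N" "g' \<in> borel_measurable N"
    using assms h(1) by (auto simp: matches_def L2c_iff)
  have "ip N g g' = ip N h g'"
    unfolding ip_def by (rule integral_cong_AE) (use ae in auto)
  then show ?thesis
    using h(2)[OF assms(2)] by simp
qed

lemma matches_AE_iff:
  assumes "matches f g" "matches f' g'"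
  shows "(AE x in M. f x = f' x) \<longleftrightarrow> (AE y in N. g y = g' y)"
proof -
  have m: "matches (\<lambda>x. f x - f' x) (\<lambda>y. g y - g' y)"
    using matches_lincomb[OF assms(2,1), of "-1"] by simp
  then have "nsq N (\<lambda>y. g y - g' y) = nsq M (\<lambda>x. f x - f' x)"
    using matches_ip[OF m m] by (simp add: ip_self)
  then have "(AE x in M. f x - f' x = 0) \<longleftrightarrow> (AE y in N. g y - g' y = 0)"
    using nsq_eq_0_iff[of "\<lambda>x. f x - f' x" M] nsq_eq_0_iff[of "\<lambda>y. g y - g' y" N] m
    by (simp add: matches_def del: right_minus_eq)
  then show ?thesis
    by simp
qed

theorem unitary_relation_matches: "unitary_relation M complex_hspace N complex_hspace matches"
proof
  interpret swap: gram_pair N M I e' e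
    by unfold_locales (use total gram in auto)
  fix g assume "g \<in> L2c N"
  then show "\<exists>f. matches f g"
    using swap.matches_exists matches_swap by blast
next
  fix f assume "f \<in> L2c M"
  then show "\<exists>g. matches f g"
    using matches_exists by blast
next
  fix f g f' g' assume fg: "matches f g" and f': "f' \<in> L2c M" "AE x in M. f' x = f x"
    and g': "g' \<in> L2c N" "AE y in N. g' y = g y"
  then have "f \<in> L2c M" "g \<in> L2c N"
    by (auto simp: matches_def)
  then show "matches f' g'"
    using fg f' g' ip_cong_AE_left[of f M f'] ip_cong_AE_left[of g N g'] L2c_gen by (auto simp: matches_def)
next
  fix f g f' g' assume "matches f g" "matches f' g'"
  then show "matches (\<lambda>x. vadd complex_hspace (f x) (f' x)) (\<lambda>y. vadd complex_hspace (g y) (g' y))"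
    using matches_lincomb[of f g f' g' 1] by (simp add: complex_hspace_def)
next
  fix c f g assume "matches f g"
  then show "matches (\<lambda>x. vscale complex_hspace c (f x)) (\<lambda>y. vscale complex_hspace c (g y))"
    using matches_lincomb[OF _ matches_zero, of f g c] by (simp add: complex_hspace_def)
next
  fix f g f' g' assume "matches f g" "matches f' g'"
  from matches_ip[OF this]
  show "(\<integral>x. vinner complex_hspace (f x) (f' x) \<partial>M) = (\<integral>y. vinner complex_hspace (g y) (g' y) \<partial>N)"
    by (simp add: complex_hspace_def ip_def)
qed (auto simp: matches_AE_iff matches_def)

end

section \<open>Gaussians and their Fourier transforms\<close>

text \<open>
The exponential of \<open>x + iy\<close> with real and imaginary part kept apart, so that identities
between Gaussians reduce to pairs of real identities.
\<close>

definition cexp :: "real \<Rightarrow> real \<Rightarrow> complex" where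
  "cexp x y = exp (Complex x y)"

lemma cexp_add: "cexp x y * cexp x' y' = cexp (x + x') (y + y')"
  by (simp add: cexp_def exp_add[symmetric] Complex_eq algebra_simps)

lemma cexp_add': "cexp x y * (cexp x' y' * z) = cexp (x + x') (y + y') * z"
  by (simp add: cexp_add mult.assoc[symmetric])

lemma cnj_cexp: "cnj (cexp x y) = cexp x (- y)"
  by (simp add: cexp_def exp_cnj complex_cnj[symmetric] del: complex_cnj)

lemma cexp_nonzero [simp]: "cexp x y \<noteq> 0"
  by (simp add: cexp_def)

lemma norm_cexp [simp]: "cmod (cexp x y) = exp x"
  by (simp add: cexp_def norm_exp_eq_Re)

lemma cexp_of_real: "cexp x 0 = of_real (exp x)"
  by (simp add: cexp_def Complex_eq exp_of_real)

lemma cexp_iexp: "cexp 0 y = iexp y"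
  by (simp add: cexp_def Complex_eq)

lemma cexp_sum: "finite A \<Longrightarrow> (\<Prod>e\<in>A. cexp (x e) (y e)) = cexp (sum x A) (sum y A)"
  by (induction rule: finite_induct) (simp_all add: cexp_add, simp add: cexp_of_real)

lemma borel_measurable_cexp [measurable (raw)]:
  "f \<in> borel_measurable M \<Longrightarrow> g \<in> borel_measurable M \<Longrightarrow> (\<lambda>x. cexp (f x) (g x)) \<in> borel_measurable M"
  unfolding cexp_def
  by (rule borel_measurable_continuous_on[of exp])
    (simp_all add: borel_measurable_complex_iff continuous_on_exp)

lemma cexp_cong: "x = x' \<Longrightarrow> y = y' \<Longrightarrow> cexp x y = cexp x' y'"
  by simp

text \<open>
The function \<open>exp(- \<pi>s|u|\<^sup>2 + 2\<pi>(a + ib)\<bullet>u)\<close>. Up to a scalar, \<open>a\<close> translates a centred Gaussian and \<open>b\<close>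
modulates it.
\<close>

definition gauss :: "real \<Rightarrow> 'a::euclidean_space \<Rightarrow> 'a \<Rightarrow> 'a \<Rightarrow> complex" where
  "gauss s a b u = cexp (2 * pi * (a \<bullet> u) - pi * s * (u \<bullet> u)) (2 * pi * (b \<bullet> u))"

text \<open>The closed form of the integral of \<open>gauss s a b\<close>; see \<open>gaussian_integral\<close>.\<close>

definition gauss_int :: "real \<Rightarrow> 'a::euclidean_space \<Rightarrow> 'a \<Rightarrow> complex" where
  "gauss_int s a b = of_real (s powr (- (DIM('a) / 2))) *
     cexp (pi * (a \<bullet> a - b \<bullet> b) / s) (2 * pi * (a \<bullet> b) / s)"

text \<open>
The Fourier transform of \<open>gauss s a b\<close>: multiplying the Gaussian by \<open>exp(2\<pi>i \<xi>\<bullet>u)\<close> replaces \<open>b\<close> by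
\<open>b + \<xi>\<close>.
\<close>

definition gauss_hat :: "real \<Rightarrow> 'a::euclidean_space \<Rightarrow> 'a \<Rightarrow> 'a \<Rightarrow> complex" where
  "gauss_hat s a b \<xi> = gauss_int s a (b + \<xi>)"

text \<open>
The characteristic function of the standard normal distribution, after the substitution that completes the
square in the real part of the exponent.
\<close>

lemma gaussian_integral_real:
  fixes s a b :: real
  assumes s: "s > 0"
  shows "integrable lborel (gauss s a b)" "(\<integral>t. gauss s a b t \<partial>lborel) = gauss_int s a b"
proof -
  define c where "c = sqrt (2 * pi * s)"
  have c: "c > 0" "c\<^sup>2 = 2 * pi * s"
    using s by (auto simp: c_def)
  define \<tau> where "\<tau> = 2 * pi * b / c"
  define K where "K = of_real (sqrt s / c) * cexp (- (pi * a\<^sup>2 / s)) (- (2 * pi * a * b / s))"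
  define f where "f x = std_normal_density x *\<^sub>R iexp (\<tau> * x)" for x
  have fint: "integrable lborel f"
    unfolding f_def
    by (rule Bochner_Integration.integrable_bound[OF integrable_normal_density[of 1 0]])
      (auto simp: normal_density_nonneg)
  have fval: "(\<integral>x. f x \<partial>lborel) = of_real (exp (- \<tau>\<^sup>2 / 2))"
  proof -
    have "char std_normal_distribution \<tau> = (\<integral>x. f x \<partial>lborel)"
      unfolding char_def f_def by (subst integral_density) (auto simp: normal_density_nonneg)
    then show ?thesis
      by (simp add: char_std_normal_distribution)
  qed
  have sub: "f (- (c * a / s) + c * t) = K * gauss s a b t" for t
  proof -
    define x where "x = - (c * a / s) + c * t"
    have x2: "- x\<^sup>2 / 2 = - (pi * a\<^sup>2 / s) + (2 * pi * (a * t) - pi * s * (t * t))"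
    proof -
      have "x = c * (t - a / s)"
        by (simp add: x_def algebra_simps)
      then have "- x\<^sup>2 / 2 = - (pi * s * (t - a / s)\<^sup>2)"
        using c by (simp add: power_mult_distrib)
      also have "\<dots> = - (pi * a\<^sup>2 / s) + (2 * pi * (a * t) - pi * s * (t * t))"
        using s by (simp add: power2_eq_square divide_simps) (simp add: algebra_simps)
      finally show ?thesis .
    qed
    have tx: "\<tau> * x = - (2 * pi * a * b / s) + 2 * pi * (b * t)"
      using c s by (simp add: \<tau>_def x_def field_simps)
    have "f x = of_real (1 / sqrt (2 * pi)) * cexp (- x\<^sup>2 / 2) (\<tau> * x)"
      using cexp_add[of "- x\<^sup>2 / 2" 0 0 "\<tau> * x"]
      by (simp add: f_def std_normal_density_def scaleR_conv_of_real cexp_of_real cexp_iexp)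
    moreover have "1 / sqrt (2 * pi) = sqrt s / c"
      using s by (simp add: c_def real_sqrt_mult)
    ultimately show ?thesis
      unfolding x_def[symmetric] K_def gauss_def inner_real_def x2 tx by (simp add: cexp_add mult.assoc)
  qed
  have K0: "K \<noteq> 0"
    using s c by (simp add: K_def)
  have Kint: "integrable lborel (\<lambda>t. K * gauss s a b t)"
    using lborel_integrable_real_affine[OF fint, of c "- (c * a / s)"] c unfolding sub by simp
  from integrable_mult_right[OF this, of "1 / K"] show "integrable lborel (gauss s a b)"
    using K0 by simp
  have "of_real (exp (- \<tau>\<^sup>2 / 2)) = \<bar>c\<bar> *\<^sub>R (\<integral>t. K * gauss s a b t \<partial>lborel)"
    using lborel_integral_real_affine[of c f "- (c * a / s)"] c unfolding sub fval by simp
  then have eq: "cexp (- \<tau>\<^sup>2 / 2) 0 = of_real c * K * (\<integral>t. gauss s a b t \<partial>lborel)"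
    using c by (simp add: scaleR_conv_of_real cexp_of_real)
  have t2: "\<tau>\<^sup>2 / 2 = pi * b\<^sup>2 / s"
    using c s by (simp add: \<tau>_def power_divide power_mult_distrib field_simps power2_eq_square)
  have cK: "of_real c * K = of_real (sqrt s) * cexp (- (pi * a\<^sup>2 / s)) (- (2 * pi * a * b / s))"
    using c by (simp add: K_def)
  have "of_real (1 / sqrt s) * (cexp (pi * a\<^sup>2 / s) (2 * pi * a * b / s) * cexp (- \<tau>\<^sup>2 / 2) 0)
      = (of_real (1 / sqrt s) * of_real (sqrt s)) * ((cexp (pi * a\<^sup>2 / s) (2 * pi * a * b / s)
         * cexp (- (pi * a\<^sup>2 / s)) (- (2 * pi * a * b / s))) * (\<integral>t. gauss s a b t \<partial>lborel))"
    unfolding eq cK by (simp only: mult_ac)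
  also have "\<dots> = (\<integral>t. gauss s a b t \<partial>lborel)"
    using s by (simp add: cexp_add cexp_of_real flip: of_real_mult)
  finally have "(\<integral>t. gauss s a b t \<partial>lborel)
      = of_real (1 / sqrt s) * cexp (pi * a\<^sup>2 / s - \<tau>\<^sup>2 / 2) (2 * pi * a * b / s)"
    by (simp add: cexp_add)
  also have "\<dots> = of_real (s powr (- (1 / 2))) * cexp (pi * (a * a - b * b) / s) (2 * pi * (a * b) / s)"
    using s unfolding t2
    by (simp add: powr_minus_divide powr_half_sqrt power2_eq_square diff_divide_distrib
        right_diff_distrib mult.assoc)
  finally show "(\<integral>t. gauss s a b t \<partial>lborel) = gauss_int s a b"
    by (simp add: gauss_int_def)
qed

lemma gauss_mult_cnj:
  "gauss s a b u * cnj (gauss s' a' b' u) = gauss (s + s') (a + a') (b - b') u"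
  unfolding gauss_def cnj_cexp cexp_add by (rule cexp_cong) (simp_all add: algebra_simps inner_simps)

lemma borel_measurable_gauss [measurable]: "gauss s a b \<in> borel_measurable borel"
  unfolding gauss_def by measurable

lemma gauss_prod:
  "gauss s a b u = (\<Prod>e\<in>Basis. gauss s (a \<bullet> e) (b \<bullet> e) (u \<bullet> e))"
  unfolding gauss_def inner_real_def cexp_sum[OF finite_Basis]
    euclidean_inner[of a u] euclidean_inner[of b u] euclidean_inner[of u u]
  by (simp add: sum_distrib_left sum_subtractf)

lemma gauss_int_prod:
  fixes a b :: "'a::euclidean_space"
  assumes "s > 0"
  shows "gauss_int s a b = (\<Prod>e\<in>Basis. gauss_int s (a \<bullet> e) (b \<bullet> e))"
proof -
  have "(\<Prod>e\<in>(Basis::'a set). gauss_int s (a \<bullet> e) (b \<bullet> e)) = of_real ((s powr (- (1 / 2))) ^ DIM('a)) *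
    (\<Prod>e\<in>(Basis::'a set). cexp (pi * ((a \<bullet> e) * (a \<bullet> e) - (b \<bullet> e) * (b \<bullet> e)) / s)
      (2 * pi * ((a \<bullet> e) * (b \<bullet> e)) / s))"
    by (simp add: gauss_int_def prod.distrib)
  also have "(s powr (- (1 / 2))) ^ DIM('a) = s powr (- (DIM('a) / 2))"
    using assms by (simp add: powr_realpow[symmetric] powr_powr)
  also have "(\<Prod>e\<in>(Basis::'a set). cexp (pi * ((a \<bullet> e) * (a \<bullet> e) - (b \<bullet> e) * (b \<bullet> e)) / s)
      (2 * pi * ((a \<bullet> e) * (b \<bullet> e)) / s))
    = cexp (pi * (a \<bullet> a - b \<bullet> b) / s) (2 * pi * (a \<bullet> b) / s)"
    unfolding cexp_sum[OF finite_Basis] euclidean_inner[of a a] euclidean_inner[of b b] euclidean_inner[of a b]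
    by (simp add: sum_distrib_left sum_subtractf sum_divide_distrib right_diff_distrib diff_divide_distrib)
  finally show ?thesis
    by (simp add: gauss_int_def)
qed

text \<open>Lebesgue measure is a product measure and the Gaussian is a product over the coordinates.\<close>

lemma gaussian_integral:
  fixes a b :: "'a::euclidean_space"
  assumes s: "s > 0"
  shows "integrable lborel (gauss s a b)" "(\<integral>u. gauss s a b u \<partial>lborel) = gauss_int s a b"
proof -
  interpret product_sigma_finite "\<lambda>_::'a. lborel :: real measure" ..
  define \<iota> where "\<iota> f = (\<Sum>e\<in>Basis. f e *\<^sub>R e)" for f :: "'a \<Rightarrow> real"
  have lb: "lborel = distr (\<Pi>\<^sub>M e\<in>(Basis::'a set). lborel) borel \<iota>"
    unfolding \<iota>_def by (rule lborel_eq)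
  have [measurable]: "\<iota> \<in> (\<Pi>\<^sub>M e\<in>Basis. lborel) \<rightarrow>\<^sub>M borel"
    unfolding \<iota>_def by measurable
  have eq: "gauss s a b (\<iota> f) = (\<Prod>e\<in>Basis. gauss s (a \<bullet> e) (b \<bullet> e) (f e))" for f
    by (subst gauss_prod) (simp add: \<iota>_def inner_sum_left inner_Basis if_distrib sum.delta cong: if_cong)
  have "integrable (\<Pi>\<^sub>M e\<in>Basis. lborel) (\<lambda>f. gauss s a b (\<iota> f))"
    unfolding eq by (rule product_integrable_prod) (simp_all add: gaussian_integral_real[OF s])
  then show "integrable lborel (gauss s a b)"
    by (subst lb) (simp add: integrable_distr_eq)
  have "(\<integral>u. gauss s a b u \<partial>lborel) = (\<integral>f. gauss s a b (\<iota> f) \<partial>(\<Pi>\<^sub>M e\<in>Basis. lborel))"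
    by (subst lb) (simp add: integral_distr)
  also have "\<dots> = (\<Prod>e\<in>Basis. \<integral>t. gauss s (a \<bullet> e) (b \<bullet> e) t \<partial>lborel)"
    unfolding eq by (rule product_integral_prod) (simp_all add: gaussian_integral_real[OF s])
  also have "\<dots> = gauss_int s a b"
    using s by (simp add: gauss_int_prod[OF s, of a b] gaussian_integral_real[OF s])
  finally show "(\<integral>u. gauss s a b u \<partial>lborel) = gauss_int s a b" .
qed

lemma gaussian_integral_lebesgue:
  fixes a b :: "'a::euclidean_space"
  assumes s: "s > 0"
  shows "integrable lebesgue (gauss s a b)" "(\<integral>u. gauss s a b u \<partial>lebesgue) = gauss_int s a b"
  using gaussian_integral[OF s, of a b] by (auto simp: integrable_completion integral_completion)

lemma gauss_L2c: "s > 0 \<Longrightarrow> gauss s a b \<in> L2c lebesgue"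
proof -
  assume s: "s > 0"
  have "integrable lebesgue (\<lambda>u. gauss s a b u * cnj (gauss s a b u))"
    unfolding gauss_mult_cnj using s by (intro gaussian_integral_lebesgue) simp
  then have "integrable lebesgue (\<lambda>u. (cmod (gauss s a b u))\<^sup>2)"
    by (simp add: complex_norm_square[symmetric] complex_of_real_integrable_eq del: of_real_power)
  then show ?thesis
    by (simp add: L2c_iff measurable_completion)
qed

lemma ip_gauss:
  assumes "s > 0" "s' > 0"
  shows "ip lebesgue (gauss s a b) (gauss s' a' b') = gauss_int (s + s') (a + a') (b - b')"
  unfolding ip_def gauss_mult_cnj using assms by (intro gaussian_integral_lebesgue) simp

text \<open>
The transform of a Gaussian is again a Gaussian up to a scalar, with \<open>s\<close> inverted and the roles of
\<open>a\<close> and \<open>b\<close> exchanged.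
\<close>

lemma gauss_hat_eq:
  assumes "s > 0"
  shows "gauss_hat s a b \<xi> = gauss_int s a b * gauss (1 / s) (- (b /\<^sub>R s)) (a /\<^sub>R s) \<xi>"
proof -
  have re: "pi * (a \<bullet> a - (b + \<xi>) \<bullet> (b + \<xi>)) / s = pi * (a \<bullet> a - b \<bullet> b) / s
      + (2 * pi * (- (b /\<^sub>R s) \<bullet> \<xi>) - pi * (1 / s) * (\<xi> \<bullet> \<xi>))"
    using assms by (simp add: inner_simps inner_commute[of \<xi> b] divide_simps) (simp add: algebra_simps)
  have im: "2 * pi * (a \<bullet> (b + \<xi>)) / s = 2 * pi * (a \<bullet> b) / s + 2 * pi * ((a /\<^sub>R s) \<bullet> \<xi>)"
    using assms by (simp add: inner_simps divide_simps) (simp add: algebra_simps)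
  show ?thesis
    unfolding gauss_hat_def gauss_int_def gauss_def re im by (simp only: cexp_add mult.assoc)
qed

lemma gauss_hat_fun_eq:
  "s > 0 \<Longrightarrow> gauss_hat s a b = (\<lambda>\<xi>. gauss_int s a b * gauss (1 / s) (- (b /\<^sub>R s)) (a /\<^sub>R s) \<xi>)"
  by (rule ext) (rule gauss_hat_eq)

lemma gauss_hat_L2c: "s > 0 \<Longrightarrow> gauss_hat s a b \<in> L2c lebesgue"
  using L2c_scale[OF gauss_L2c, of "1/s"] by (simp add: gauss_hat_fun_eq)

text \<open>
Parseval for Gaussians: by \<open>ip_gauss\<close> the right-hand side is also the inner product of the
untransformed functions.
\<close>

lemma ip_gauss_hat:
  fixes a b a' b' :: "'a::euclidean_space"
  assumes s: "s > 0" "s' > 0"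
  shows "ip lebesgue (gauss_hat s a b) (gauss_hat s' a' b') = gauss_int (s + s') (a + a') (b - b')"
proof -
  define \<sigma> where "\<sigma> = 1 / s + 1 / s'"
  define k where "k = - (DIM('a) / 2)"
  have \<sigma>: "\<sigma> > 0" "\<sigma> = (s + s') / (s * s')"
    using s by (auto simp: \<sigma>_def field_simps)
  have "ip lebesgue (gauss_hat s a b) (gauss_hat s' a' b') =
    gauss_int s a b * (cnj (gauss_int s' a' b') *
      ip lebesgue (gauss (1 / s) (- (b /\<^sub>R s)) (a /\<^sub>R s)) (gauss (1 / s') (- (b' /\<^sub>R s')) (a' /\<^sub>R s')))"
    using s by (simp add: ip_def gauss_hat_fun_eq mult.assoc mult.left_commute)
  also have "\<dots> = gauss_int s a b * (cnj (gauss_int s' a' b') *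
      gauss_int \<sigma> (- (b /\<^sub>R s) + - (b' /\<^sub>R s')) (a /\<^sub>R s - a' /\<^sub>R s'))"
    using s by (simp add: ip_gauss \<sigma>_def)
  also have "\<dots> = of_real (s powr k * s' powr k * \<sigma> powr k) *
      (cexp (pi * (a \<bullet> a - b \<bullet> b) / s) (2 * pi * (a \<bullet> b) / s) *
       (cexp (pi * (a' \<bullet> a' - b' \<bullet> b') / s') (- (2 * pi * (a' \<bullet> b') / s')) *
        cexp (pi * ((- (b /\<^sub>R s) + - (b' /\<^sub>R s')) \<bullet> (- (b /\<^sub>R s) + - (b' /\<^sub>R s'))
              - (a /\<^sub>R s - a' /\<^sub>R s') \<bullet> (a /\<^sub>R s - a' /\<^sub>R s')) / \<sigma>)
            (2 * pi * ((- (b /\<^sub>R s) + - (b' /\<^sub>R s')) \<bullet> (a /\<^sub>R s - a' /\<^sub>R s')) / \<sigma>)))"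
    by (simp add: gauss_int_def k_def cnj_cexp mult_ac)
  also have "s powr k * s' powr k * \<sigma> powr k = (s + s') powr k"
    using s \<sigma> by (simp add: powr_mult[symmetric])
  also have "cexp (pi * (a \<bullet> a - b \<bullet> b) / s) (2 * pi * (a \<bullet> b) / s) *
       (cexp (pi * (a' \<bullet> a' - b' \<bullet> b') / s') (- (2 * pi * (a' \<bullet> b') / s')) *
        cexp (pi * ((- (b /\<^sub>R s) + - (b' /\<^sub>R s')) \<bullet> (- (b /\<^sub>R s) + - (b' /\<^sub>R s'))
              - (a /\<^sub>R s - a' /\<^sub>R s') \<bullet> (a /\<^sub>R s - a' /\<^sub>R s')) / \<sigma>)
            (2 * pi * ((- (b /\<^sub>R s) + - (b' /\<^sub>R s')) \<bullet> (a /\<^sub>R s - a' /\<^sub>R s')) / \<sigma>))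
     = cexp (pi * ((a + a') \<bullet> (a + a') - (b - b') \<bullet> (b - b')) / (s + s'))
            (2 * pi * ((a + a') \<bullet> (b - b')) / (s + s'))"
    unfolding cexp_add
  proof (rule cexp_cong)
    have "(a \<bullet> a - b \<bullet> b) / s + ((a' \<bullet> a' - b' \<bullet> b') / s' +
       ((- (b /\<^sub>R s) + - (b' /\<^sub>R s')) \<bullet> (- (b /\<^sub>R s) + - (b' /\<^sub>R s'))
              - (a /\<^sub>R s - a' /\<^sub>R s') \<bullet> (a /\<^sub>R s - a' /\<^sub>R s')) / \<sigma>)
       = ((a + a') \<bullet> (a + a') - (b - b') \<bullet> (b - b')) / (s + s')"
      using s unfolding \<sigma>(2)
      by (simp add: inner_simps inner_commute[of a' a] inner_commute[of b' b] divide_simps)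
         (simp add: algebra_simps)
    from arg_cong[OF this, of "\<lambda>x. pi * x"]
    show "pi * (a \<bullet> a - b \<bullet> b) / s + (pi * (a' \<bullet> a' - b' \<bullet> b') / s' +
        pi * ((- (b /\<^sub>R s) + - (b' /\<^sub>R s')) \<bullet> (- (b /\<^sub>R s) + - (b' /\<^sub>R s'))
              - (a /\<^sub>R s - a' /\<^sub>R s') \<bullet> (a /\<^sub>R s - a' /\<^sub>R s')) / \<sigma>)
       = pi * ((a + a') \<bullet> (a + a') - (b - b') \<bullet> (b - b')) / (s + s')"
      by (simp only: distrib_left times_divide_eq_right)
    have "(a \<bullet> b) / s + (- (a' \<bullet> b' / s') +
       ((- (b /\<^sub>R s) + - (b' /\<^sub>R s')) \<bullet> (a /\<^sub>R s - a' /\<^sub>R s')) / \<sigma>)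
       = ((a + a') \<bullet> (b - b')) / (s + s')"
      using s unfolding \<sigma>(2)
      by (simp add: inner_simps inner_commute[of b a] inner_commute[of b' a] inner_commute[of b a']
          inner_commute[of b' a'] divide_simps) (simp add: algebra_simps)
    from arg_cong[OF this, of "\<lambda>x. 2 * pi * x"]
    show "2 * pi * (a \<bullet> b) / s + (- (2 * pi * (a' \<bullet> b') / s') +
        2 * pi * ((- (b /\<^sub>R s) + - (b' /\<^sub>R s')) \<bullet> (a /\<^sub>R s - a' /\<^sub>R s')) / \<sigma>)
       = 2 * pi * ((a + a') \<bullet> (b - b')) / (s + s')"
      by (simp only: distrib_left times_divide_eq_right mult_minus_right)
  qed
  finally show ?thesis
    by (simp add: gauss_int_def k_def)
qed

section \<open>Density of the Gaussians and the Plancherel theorem\<close>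

text \<open>Membership in the closed span of a family.\<close>

definition approximable :: "'a measure \<Rightarrow> 'i set \<Rightarrow> ('i \<Rightarrow> 'a \<Rightarrow> complex) \<Rightarrow> ('a \<Rightarrow> complex) \<Rightarrow> bool" where
  "approximable M I e f \<longleftrightarrow> f \<in> L2c M \<and> (\<forall>\<epsilon>>0. \<exists>p. in_span I e p \<and> p \<in> L2c M \<and> nsq M (\<lambda>x. f x - p x) < \<epsilon>)"

lemma approximable_limit:
  assumes f: "\<And>k. approximable M I e (f k)" and g: "g \<in> L2c M"
    and lim: "(\<lambda>k. nsq M (\<lambda>x. f k x - g x)) \<longlonglongrightarrow> 0"
  shows "approximable M I e g"
  unfolding approximable_def
proof (intro conjI allI impI)
  fix \<epsilon> :: real assume "\<epsilon> > 0"
  then have "\<forall>\<^sub>F k in sequentially. nsq M (\<lambda>x. f k x - g x) < \<epsilon> / 4"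
    using order_tendstoD(2)[OF lim, of "\<epsilon> / 4"] by simp
  then obtain k where k: "nsq M (\<lambda>x. f k x - g x) < \<epsilon> / 4"
    by (auto simp: eventually_sequentially)
  obtain p where p: "in_span I e p" "p \<in> L2c M" "nsq M (\<lambda>x. f k x - p x) < \<epsilon> / 4"
    using f[of k] \<open>\<epsilon> > 0\<close> unfolding approximable_def by (meson zero_less_divide_iff zero_less_numeral)
  have "f k \<in> L2c M"
    using f[of k] by (simp add: approximable_def)
  from nsq_diff_triangle[OF g this p(2)]
  have "nsq M (\<lambda>x. g x - p x) < \<epsilon>"
    using k p(3) by (simp add: nsq_minus_commute[of M g])
  then show "\<exists>p. in_span I e p \<and> p \<in> L2c M \<and> nsq M (\<lambda>x. g x - p x) < \<epsilon>"
    using p by blast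
qed (rule g)

lemma approximable_add_imaginary:
  assumes "approximable M I e f" "approximable M I e g"
  shows "approximable M I e (\<lambda>x. f x + \<i> * g x)"
  unfolding approximable_def
proof (intro conjI allI impI)
  have fg: "f \<in> L2c M" "g \<in> L2c M"
    using assms by (auto simp: approximable_def)
  show "(\<lambda>x. f x + \<i> * g x) \<in> L2c M"
    by (intro L2c_add L2c_scale fg)
  fix \<epsilon> :: real assume "\<epsilon> > 0"
  then have "\<epsilon> / 4 > 0" by simp
  then obtain p q where p: "in_span I e p" "p \<in> L2c M" "nsq M (\<lambda>x. f x - p x) < \<epsilon> / 4"
    and q: "in_span I e q" "q \<in> L2c M" "nsq M (\<lambda>x. g x - q x) < \<epsilon> / 4"
    using assms unfolding approximable_def by meson
  have "nsq M (\<lambda>x. f x + \<i> * g x - (\<i> * q x + p x)) = nsq M (\<lambda>x. (f x - p x) + \<i> * (g x - q x))"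
    by (simp add: algebra_simps)
  also have "\<dots> \<le> 2 * nsq M (\<lambda>x. f x - p x) + 2 * nsq M (\<lambda>x. \<i> * (g x - q x))"
    by (intro nsq_add_le L2c_diff L2c_scale fg p q)
  also have "nsq M (\<lambda>x. \<i> * (g x - q x)) = nsq M (\<lambda>x. g x - q x)"
    by (simp add: nsq_def norm_mult)
  finally have "nsq M (\<lambda>x. f x + \<i> * g x - (\<i> * q x + p x)) < \<epsilon>"
    using p(3) q(3) by linarith
  moreover have "(\<lambda>x. \<i> * q x + p x) \<in> L2c M"
    by (intro L2c_add L2c_scale p q)
  ultimately show "\<exists>p. in_span I e p \<and> p \<in> L2c M \<and> nsq M (\<lambda>x. f x + \<i> * g x - p x) < \<epsilon>"
    using in_span_lincomb[OF q(1) p(1), of \<i>] by blast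
qed

lemma nsq_tendsto_dominated:
  assumes [measurable]: "\<And>k. f k \<in> borel_measurable M" "g \<in> borel_measurable M"
    and lim: "AE x in M. (\<lambda>k. f k x) \<longlonglongrightarrow> g x"
    and w: "integrable M w" "\<And>k. AE x in M. (cmod (f k x - g x))\<^sup>2 \<le> w x"
  shows "(\<lambda>k. nsq M (\<lambda>x. f k x - g x)) \<longlonglongrightarrow> 0"
proof -
  have "(\<lambda>k. \<integral>x. (cmod (f k x - g x))\<^sup>2 \<partial>M) \<longlonglongrightarrow> (\<integral>x. 0 \<partial>M)"
  proof (rule integral_dominated_convergence)
    show "AE x in M. (\<lambda>k. (cmod (f k x - g x))\<^sup>2) \<longlonglongrightarrow> 0"
      using lim
    proof eventually_elim
      case (elim x)
      then have "(\<lambda>k. (cmod (f k x - g x))\<^sup>2) \<longlonglongrightarrow> (cmod (g x - g x))\<^sup>2"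
        by (intro tendsto_intros)
      then show ?case by simp
    qed
  qed (use w in auto)
  then show ?thesis
    by (simp add: nsq_def)
qed

definition gauss_family :: "real \<times> 'a::euclidean_space \<times> 'a \<Rightarrow> 'a \<Rightarrow> complex" where
  "gauss_family = (\<lambda>(s, a, b). gauss s a b)"

definition gauss_hat_family :: "real \<times> 'a::euclidean_space \<times> 'a \<Rightarrow> 'a \<Rightarrow> complex" where
  "gauss_hat_family = (\<lambda>(s, a, b). gauss_hat s a b)"

abbreviation gauss_index :: "(real \<times> 'a::euclidean_space \<times> 'a) set" where
  "gauss_index \<equiv> {0<..} \<times> UNIV"

lemma in_span_gauss: "s > 0 \<Longrightarrow> in_span gauss_index gauss_family (gauss s a b)"
  using in_span_generator[of "(s, a, b)" gauss_index gauss_family] by (simp add: gauss_family_def)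

lemma in_span_scale: "in_span I e p \<Longrightarrow> in_span I e (\<lambda>x. c * p x)"
  using in_span_lincomb[OF _ in_span_zero] by fastforce

lemma in_span_add: "in_span I e p \<Longrightarrow> in_span I e q \<Longrightarrow> in_span I e (\<lambda>x. p x + q x)"
  using in_span_lincomb[of I e p q 1] by simp

lemma in_span_L2c:
  assumes "in_span I e p" "\<And>i. i \<in> I \<Longrightarrow> e i \<in> L2c M"
  shows "p \<in> L2c M"
proof -
  have "p \<in> L2c M" if "pair_span I e e p p'" for p'
    using that
  proof induction
    case (step i p q c)
    then show ?case
      using L2c_add[OF L2c_scale[OF assms(2)]] by blast
  qed (rule L2c_zero)
  then show ?thesis
    using assms(1) by (simp add: in_span_def)
qed

text \<open>
Multiplication by \<open>h\<close> preserves the span of the Gaussians. Such functions form an algebra,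
and a product of two Gaussians is a Gaussian, so all polynomials in the real Gaussians below belong to it.
\<close>

definition multiplier :: "('a::euclidean_space \<Rightarrow> real) \<Rightarrow> bool" where
  "multiplier h \<longleftrightarrow> (\<forall>p. in_span gauss_index gauss_family p \<longrightarrow> in_span gauss_index gauss_family (\<lambda>u. of_real (h u) * p u))"

lemma multiplierI:
  assumes "\<And>s a b. s > 0 \<Longrightarrow> in_span gauss_index gauss_family (\<lambda>u. of_real (h u) * gauss s a b u)"
  shows "multiplier h"
  unfolding multiplier_def
proof (intro allI impI)
  fix p assume "in_span gauss_index gauss_family (p :: 'a \<Rightarrow> complex)"
  have "in_span gauss_index gauss_family (\<lambda>u. of_real (h u) * p u)"
    if "pair_span gauss_index gauss_family gauss_family p p'" for p p' :: "'a \<Rightarrow> complex"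
    using that
  proof induction
    case zero
    then show ?case by (simp add: in_span_zero)
  next
    case (step i p q c)
    have "in_span gauss_index gauss_family (\<lambda>u. of_real (h u) * gauss_family i u)"
      using assms step(1) by (cases i) (auto simp: gauss_family_def)
    from in_span_lincomb[OF this step(3), of c] show ?case
      by (simp add: algebra_simps)
  qed
  then show "in_span gauss_index gauss_family (\<lambda>u. of_real (h u) * p u)"
    using \<open>in_span gauss_index gauss_family p\<close> by (simp add: in_span_def)
qed

lemma multiplier_const: "multiplier (\<lambda>u. c)"
  by (simp add: multiplier_def in_span_scale)

lemma multiplier_add: "multiplier h \<Longrightarrow> multiplier h' \<Longrightarrow> multiplier (\<lambda>u. h u + h' u)"
  by (simp add: multiplier_def distrib_right in_span_add)

lemma multiplier_mult: "multiplier h \<Longrightarrow> multiplier h' \<Longrightarrow> multiplier (\<lambda>u. h u * h' u)"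
  unfolding multiplier_def by (simp add: mult.assoc)

lemma multiplier_sum:
  "finite A \<Longrightarrow> (\<And>x. x \<in> A \<Longrightarrow> multiplier (h x)) \<Longrightarrow> multiplier (\<lambda>u. \<Sum>x\<in>A. h x u)"
  by (induction rule: finite_induct) (simp_all add: multiplier_add multiplier_const)

definition gauss_weight :: "'a::euclidean_space \<Rightarrow> 'a \<Rightarrow> real" where
  "gauss_weight a u = exp (2 * pi * (a \<bullet> u) - pi * (u \<bullet> u))"

lemma gauss_real: "gauss 1 a 0 u = of_real (gauss_weight a u)"
  by (simp add: gauss_def gauss_weight_def cexp_of_real)

lemma multiplier_gauss_weight: "multiplier (gauss_weight a)"
proof (rule multiplierI)
  fix s :: real and c b :: 'a assume "s > 0"
  have "of_real (gauss_weight a u) * gauss s c b u = gauss (1 + s) (a + c) b u" for u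
    unfolding gauss_real[symmetric] gauss_def cexp_add
    by (rule cexp_cong) (simp_all add: inner_simps algebra_simps)
  then show "in_span gauss_index gauss_family (\<lambda>u. of_real (gauss_weight a u) * gauss s c b u)"
    using in_span_gauss[of "1 + s"] \<open>s > 0\<close> by simp
qed

text \<open>
The coordinates of \<open>u\<close> can be recovered as logarithms of quotients of the coordinates of
\<open>gauss_embedding u\<close>, and the image is bounded. Hence continuous functions of compact support become
continuous functions on a ball, where polynomials in the coordinates are uniformly dense.
\<close>

definition gauss_embedding :: "'a::euclidean_space \<Rightarrow> real \<times> 'a" where
  "gauss_embedding u = (gauss_weight 0 u, \<Sum>e\<in>Basis. gauss_weight e u *\<^sub>R e)"

lemma gauss_embedding_inner: "e \<in> Basis \<Longrightarrow> snd (gauss_embedding u) \<bullet> e = gauss_weight e u"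
  by (simp add: gauss_embedding_def inner_sum_left inner_Basis if_distrib sum.delta cong: if_cong)

lemma multiplier_polynomial:
  assumes "real_polynomial_function q"
  shows "multiplier (\<lambda>u. q (gauss_embedding u))"
  using assms
proof induction
  case (linear f)
  interpret bounded_linear f by fact
  have "f (gauss_embedding u) = f (1, 0) * gauss_weight 0 u + (\<Sum>e\<in>Basis. f (0, e) * gauss_weight e u)" for u
  proof -
    have "gauss_embedding u = gauss_weight 0 u *\<^sub>R (1, 0) + (\<Sum>e\<in>Basis. gauss_weight e u *\<^sub>R (0, e))"
      by (simp add: gauss_embedding_def prod_eq_iff fst_sum snd_sum)
    then show ?thesis
      by (simp only: add sum scaleR real_scaleR_def mult.commute)
  qed
  then show ?case
    by (auto intro!: multiplier_add multiplier_mult multiplier_sum multiplier_const multiplier_gauss_weight)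
qed (auto intro: multiplier_add multiplier_mult multiplier_const)

lemma gauss_embedding_bounded:
  fixes u :: "'a::euclidean_space"
  shows "norm (gauss_embedding u) \<le> 1 + DIM('a) * exp pi"
proof -
  have le: "gauss_weight e u \<le> exp pi" if "norm e \<le> 1" for e :: 'a
  proof -
    have "e \<bullet> u \<le> norm u"
      using norm_cauchy_schwarz[of e u] mult_right_mono[OF that norm_ge_zero[of u]] by simp
    moreover have "2 * norm u - u \<bullet> u \<le> 1"
      using zero_le_power2[of "norm u - 1"] by (simp add: power2_diff power2_norm_eq_inner)
    ultimately have "2 * (e \<bullet> u) - u \<bullet> u \<le> 1"
      by linarith
    then have "pi * (2 * (e \<bullet> u) - u \<bullet> u) \<le> pi * 1"
      by (intro mult_left_mono) auto
    then show ?thesis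
      by (simp add: gauss_weight_def algebra_simps)
  qed
  have "norm (gauss_embedding u) \<le> norm (gauss_weight 0 u) + norm (\<Sum>e\<in>(Basis::'a set). gauss_weight e u *\<^sub>R e)"
    unfolding gauss_embedding_def by (rule norm_Pair_le)
  also have "\<dots> \<le> 1 + (\<Sum>e\<in>(Basis::'a set). exp pi)"
  proof (rule add_mono)
    show "norm (gauss_weight (0::'a) u) \<le> 1"
      by (simp add: gauss_weight_def)
    show "norm (\<Sum>e\<in>(Basis::'a set). gauss_weight e u *\<^sub>R e) \<le> (\<Sum>e\<in>(Basis::'a set). exp pi)"
      by (rule sum_norm_le) (use le in \<open>auto simp: gauss_weight_def\<close>)
  qed
  finally show ?thesis by simp
qed

text \<open>
The logarithms are only continuous away from \<open>0\<close>, the limit of the embedding at infinity. They are truncated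
below at a lower bound \<open>\<delta>\<close> of all coordinates for \<open>|u| \<le> r + 1\<close>, and the cut-off \<open>\<theta>\<close> of the first
coordinate removes the values at larger \<open>|u|\<close>.
\<close>

lemma continuous_factors_through_gauss_embedding:
  fixes \<psi> :: "'a::euclidean_space \<Rightarrow> real"
  assumes \<psi>: "continuous_on UNIV \<psi>" and r: "r > 0" and supp: "\<And>u. norm u > r \<Longrightarrow> \<psi> u = 0"
  shows "\<exists>F. continuous_on UNIV F \<and> (\<forall>u. F (gauss_embedding u) = \<psi> u)"
proof -
  define \<delta> where "\<delta> = exp (- 2 * pi * (r + 1) - pi * (r + 1)\<^sup>2)"
  define t0 t1 where "t0 = exp (- pi * r\<^sup>2)" and "t1 = exp (- pi * (r + 1)\<^sup>2)"
  define \<theta> where "\<theta> t = max 0 (min 1 ((t - t1) / (t0 - t1)))" for t :: real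
  define lam where
    "lam y = (\<Sum>e\<in>Basis. ((ln (max \<delta> (snd y \<bullet> e)) - ln (max \<delta> (fst y))) / (2 * pi)) *\<^sub>R e)"
    for y :: "real \<times> 'a"
  have t01: "t1 < t0"
    using r by (simp add: t0_def t1_def power_strict_mono)
  have "\<delta> > 0"
    by (simp add: \<delta>_def)
  have "continuous_on UNIV lam"
    unfolding lam_def by (intro continuous_intros) (use \<open>\<delta> > 0\<close> in \<open>auto simp: max_def\<close>)
  then have "continuous_on UNIV (\<lambda>y. \<theta> (fst y) * \<psi> (lam y))"
    unfolding \<theta>_def using t01
    by (intro continuous_intros continuous_on_compose2[OF \<psi>]) auto
  moreover have "\<theta> (fst (gauss_embedding u)) * \<psi> (lam (gauss_embedding u)) = \<psi> u" for u
  proof (cases "norm u \<le> r + 1")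
    case True
    have uu: "u \<bullet> u \<le> (r + 1)\<^sup>2"
      using True by (simp add: dot_square_norm power_mono)
    have ge: "\<delta> \<le> gauss_weight e u" if "norm e \<le> 1" for e
    proof -
      have "- (e \<bullet> u) \<le> norm e * norm u"
        using norm_cauchy_schwarz[of "- e" u] by simp
      also have "\<dots> \<le> r + 1"
        using mult_mono[OF that True] by simp
      finally have "- (2 * pi * (r + 1)) \<le> 2 * pi * (e \<bullet> u)"
        by (simp add: minus_le_iff[of "e \<bullet> u"] flip: mult_minus_right)
      moreover have "pi * (u \<bullet> u) \<le> pi * (r + 1)\<^sup>2"
        using uu by simp
      ultimately show ?thesis
        unfolding \<delta>_def gauss_weight_def exp_le_cancel_iff by linarith
    qed
    have "lam (gauss_embedding u) = (\<Sum>e\<in>Basis. (u \<bullet> e) *\<^sub>R e)"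
      unfolding lam_def
    proof (rule sum.cong)
      fix e :: 'a assume e: "e \<in> Basis"
      have "ln (max \<delta> (snd (gauss_embedding u) \<bullet> e)) = 2 * pi * (e \<bullet> u) - pi * (u \<bullet> u)"
        using ge[of e] e by (simp add: gauss_embedding_inner max_absorb2) (simp add: gauss_weight_def)
      moreover have "ln (max \<delta> (fst (gauss_embedding u))) = - pi * (u \<bullet> u)"
        using ge[of 0] by (simp add: gauss_embedding_def max_absorb2) (simp add: gauss_weight_def)
      ultimately show "((ln (max \<delta> (snd (gauss_embedding u) \<bullet> e)) - ln (max \<delta> (fst (gauss_embedding u)))) / (2 * pi)) *\<^sub>R e
          = (u \<bullet> e) *\<^sub>R e"
        by (simp add: inner_commute)
    qed simp
    then have lam: "lam (gauss_embedding u) = u"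
      by (simp add: euclidean_representation)
    show ?thesis
    proof (cases "norm u \<le> r")
      case True
      then have "t0 \<le> fst (gauss_embedding u)"
        by (simp add: t0_def gauss_embedding_def gauss_weight_def dot_square_norm power_mono)
      then have "\<theta> (fst (gauss_embedding u)) = 1"
        using t01 by (simp add: \<theta>_def)
      then show ?thesis
        by (simp add: lam)
    next
      case False
      then show ?thesis
        by (simp add: lam supp)
    qed
  next
    case False
    then have "(r + 1)\<^sup>2 \<le> (norm u)\<^sup>2"
      using r by (intro power_mono) auto
    then have "fst (gauss_embedding u) \<le> t1"
      by (simp add: t1_def gauss_embedding_def gauss_weight_def dot_square_norm)
    then have "\<theta> (fst (gauss_embedding u)) = 0"
      using t01 by (simp add: \<theta>_def divide_nonpos_pos)
    moreover have "\<psi> u = 0"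
      using False by (intro supp) simp
    ultimately show ?thesis
      by simp
  qed
  ultimately show ?thesis
    by blast
qed

text \<open>
Uniform approximation on an unbounded space does not control the norm. Therefore \<open>\<phi>\<close> divided by a Gaussian
is approximated uniformly, and multiplying back turns the uniform error into a square-integrable one.
\<close>

lemma approximable_compact_support:
  fixes \<phi> :: "'a::euclidean_space \<Rightarrow> real"
  assumes \<phi>: "continuous_on UNIV \<phi>" and r: "r > 0" and supp: "\<And>u. norm u > r \<Longrightarrow> \<phi> u = 0"
  shows "approximable lebesgue gauss_index gauss_family (\<lambda>u. of_real (\<phi> u))"
  unfolding approximable_def
proof (intro conjI allI impI)
  define w where "w u = gauss_weight (0::'a) u" for u
  have w: "0 < w u" "w u \<le> 1" "gauss 1 0 0 u = of_real (w u)" for u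
    by (auto simp: w_def gauss_weight_def gauss_real)
  have w_cont: "continuous_on UNIV w"
    unfolding w_def gauss_weight_def by (intro continuous_intros)
  have [measurable]: "\<phi> \<in> borel_measurable borel"
    using \<phi> by (rule borel_measurable_continuous_onI)
  have G: "gauss 1 (0::'a) 0 \<in> L2c lebesgue"
    by (simp add: gauss_L2c)
  define C where "C = nsq lebesgue (gauss 1 (0::'a) 0)"
  define \<psi> where "\<psi> u = \<phi> u / w u" for u
  have "continuous_on UNIV \<psi>"
    unfolding \<psi>_def using w by (intro continuous_intros \<phi> w_cont) (auto simp: less_le)
  moreover have "\<psi> u = 0" if "norm u > r" for u
    using supp[OF that] by (simp add: \<psi>_def)
  ultimately obtain F where F: "continuous_on UNIV F" "\<And>u. F (gauss_embedding u) = \<psi> u"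
    using continuous_factors_through_gauss_embedding[of \<psi> r] r by blast
  define K where "K = cball (0 :: real \<times> 'a) (1 + DIM('a) * exp pi)"
  have K: "gauss_embedding u \<in> K" for u
    using gauss_embedding_bounded[of u] by (simp add: K_def)
  have approx: "\<exists>p. in_span gauss_index gauss_family p \<and> p \<in> L2c lebesgue \<and> (\<forall>u. (cmod (of_real (\<phi> u) - p u))\<^sup>2
      \<le> \<eta>\<^sup>2 * (cmod (gauss 1 0 0 u))\<^sup>2)" if "\<eta> > 0" for \<eta>
  proof -
    have "continuous_on K F"
      using F(1) continuous_on_subset by blast
    then obtain q where q: "real_polynomial_function q" "\<And>y. y \<in> K \<Longrightarrow> \<bar>F y - q y\<bar> < \<eta>"
      using Stone_Weierstrass_real_polynomial_function[of K F \<eta>] \<open>\<eta> > 0\<close> by (auto simp: K_def)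
    define p where "p u = of_real (q (gauss_embedding u)) * gauss 1 0 0 u" for u
    have "in_span gauss_index gauss_family p"
      unfolding p_def
      by (rule multiplier_polynomial[OF q(1), unfolded multiplier_def, rule_format, OF in_span_gauss]) simp
    moreover from this have "p \<in> L2c lebesgue"
      by (rule in_span_L2c) (auto simp: gauss_family_def gauss_L2c)
    moreover have "(cmod (of_real (\<phi> u) - p u))\<^sup>2 \<le> \<eta>\<^sup>2 * (cmod (gauss 1 0 0 u))\<^sup>2" for u
    proof -
      have "of_real (\<phi> u) - p u = of_real ((\<psi> u - q (gauss_embedding u)) * w u)"
        using w(1)[of u] by (simp add: p_def w(3) \<psi>_def left_diff_distrib)
      then have "cmod (of_real (\<phi> u) - p u) = \<bar>\<psi> u - q (gauss_embedding u)\<bar> * w u"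
        using w(1)[of u] by (simp add: abs_mult del: of_real_mult)
      also have "\<dots> \<le> \<eta> * w u"
        using q(2)[OF K[of u]] w(1)[of u] F(2)[of u] by (intro mult_right_mono) auto
      finally have "(cmod (of_real (\<phi> u) - p u))\<^sup>2 \<le> (\<eta> * w u)\<^sup>2"
        by (intro power_mono) auto
      then show ?thesis
        using w(1)[of u] by (simp add: w(3) power_mult_distrib)
    qed
    ultimately show ?thesis
      by blast
  qed
  show L2: "(\<lambda>u. complex_of_real (\<phi> u)) \<in> L2c lebesgue"
  proof -
    obtain p where p: "p \<in> L2c lebesgue" "\<And>u. (cmod (of_real (\<phi> u) - p u))\<^sup>2 \<le> 1\<^sup>2 * (cmod (gauss 1 0 0 u))\<^sup>2"
      using approx[of 1] by auto
    have m: "(\<lambda>u. complex_of_real (\<phi> u)) \<in> borel_measurable lebesgue"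
      by (intro measurable_completion) simp
    note [measurable] = m L2cD(1)[OF p(1)]
    have "integrable lebesgue (\<lambda>u. (cmod (of_real (\<phi> u) - p u))\<^sup>2)"
      by (rule Bochner_Integration.integrable_bound[OF L2cD(2)[OF G]]) (use p(2) in auto)
    then have "(\<lambda>u. of_real (\<phi> u) - p u) \<in> L2c lebesgue"
      by (simp add: L2c_iff)
    from L2c_add[OF this p(1)] show ?thesis
      by simp
  qed
  fix \<epsilon> :: real assume "\<epsilon> > 0"
  define \<eta> where "\<eta> = sqrt (\<epsilon> / (C + 1))"
  have "C \<ge> 0"
    by (simp add: C_def nsq_nonneg)
  then have \<eta>: "\<eta> > 0" "\<eta>\<^sup>2 * C < \<epsilon>"
    using \<open>\<epsilon> > 0\<close> by (auto simp: \<eta>_def field_simps)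
  obtain p where p: "in_span gauss_index gauss_family p" "p \<in> L2c lebesgue"
    "\<And>u. (cmod (of_real (\<phi> u) - p u))\<^sup>2 \<le> \<eta>\<^sup>2 * (cmod (gauss 1 0 0 u))\<^sup>2"
    using approx[OF \<eta>(1)] by auto
  have "nsq lebesgue (\<lambda>u. of_real (\<phi> u) - p u) \<le> (\<integral>u. \<eta>\<^sup>2 * (cmod (gauss 1 (0::'a) 0 u))\<^sup>2 \<partial>lebesgue)"
    unfolding nsq_def
    by (rule integral_mono[OF L2cD(2)[OF L2c_diff[OF L2 p(2)]] integrable_mult_right[OF L2cD(2)[OF G]] p(3)])
  also have "\<dots> = \<eta>\<^sup>2 * C"
    by (simp add: C_def nsq_def)
  finally show "\<exists>p. in_span gauss_index gauss_family p \<and> p \<in> L2c lebesgue \<and> nsq lebesgue (\<lambda>u. of_real (\<phi> u) - p u) < \<epsilon>"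
    using p \<eta>(2) by (intro exI[of _ p]) auto
qed

text \<open>
A Lebesgue measurable function is an almost everywhere limit of continuous functions. Clipping their
values at \<open>r\<close> and cutting off their support leaves the limit unchanged and makes the
convergence dominated.
\<close>

lemma approximable_bounded:
  fixes f :: "'a::euclidean_space \<Rightarrow> complex"
  assumes [measurable]: "f \<in> borel_measurable lebesgue" and r: "r > 0"
    and le: "\<And>u. cmod (f u) \<le> r" and supp: "\<And>u. norm u > r \<Longrightarrow> f u = 0"
  shows "approximable lebesgue gauss_index gauss_family f"
proof -
  define clip where "clip z = z / of_real (max 1 (cmod z / r))" for z
  have clip_le: "cmod (clip z) \<le> r" for z
    using r by (auto simp: clip_def norm_divide max_def field_simps)
  have clip_id: "clip z = z" if "cmod z \<le> r" for z
    using that r by (simp add: clip_def max_def)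
  have clip_cont: "continuous_on UNIV clip"
    unfolding clip_def by (intro continuous_intros) (use r in auto)
  define \<theta> where "\<theta> u = max 0 (min 1 (r + 1 - norm u))" for u :: 'a
  have \<theta>: "0 \<le> \<theta> u" "\<theta> u \<le> 1" "norm u \<le> r \<Longrightarrow> \<theta> u = 1" "norm u > r + 1 \<Longrightarrow> \<theta> u = 0" for u
    by (auto simp: \<theta>_def)
  have \<theta>_cont: "continuous_on UNIV \<theta>"
    unfolding \<theta>_def by (intro continuous_intros)
  have "f measurable_on UNIV"
    by (rule lebesgue_measurable_imp_measurable_on) simp_all
  then obtain Z g where Z: "negligible Z" and g: "\<And>n. continuous_on UNIV (g n)"
    and lim: "\<And>x. x \<notin> Z \<Longrightarrow> (\<lambda>n. g n x) \<longlonglongrightarrow> f x"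
    unfolding measurable_on_def by auto
  define h where "h n u = of_real (\<theta> u) * clip (g n u)" for n :: nat and u
  have h_cont: "continuous_on UNIV (h n)" for n
    unfolding h_def by (intro continuous_intros \<theta>_cont continuous_on_compose2[OF clip_cont g]) auto
  have h_le: "cmod (h n u) \<le> r" for n u
    using mult_mono[OF \<theta>(2)[of u] clip_le[of "g n u"]] \<theta>(1)[of u] by (simp add: h_def norm_mult)
  have h_supp: "h n u = 0" if "norm u > r + 1" for n u
    using \<theta>(4)[OF that] by (simp add: h_def)
  have h_approx: "approximable lebesgue gauss_index gauss_family (h n)" for n
  proof -
    have "approximable lebesgue gauss_index gauss_family (\<lambda>u. of_real (Re (h n u)))"
      by (rule approximable_compact_support[of _ "r + 1"])
        (use r h_supp h_cont in \<open>auto intro!: continuous_intros\<close>)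
    moreover have "approximable lebesgue gauss_index gauss_family (\<lambda>u. of_real (Im (h n u)))"
      by (rule approximable_compact_support[of _ "r + 1"])
        (use r h_supp h_cont in \<open>auto intro!: continuous_intros\<close>)
    ultimately have "approximable lebesgue gauss_index gauss_family (\<lambda>u. of_real (Re (h n u)) + \<i> * of_real (Im (h n u)))"
      by (rule approximable_add_imaginary)
    then show ?thesis
      by (simp flip: complex_eq)
  qed
  define B where "B = cball (0::'a) (r + 1)"
  have Bint: "integrable lebesgue (\<lambda>u. (2 * r)\<^sup>2 * indicator B u)"
    by (intro integrable_mult_right integrable_real_indicator)
      (use emeasure_lborel_cball_finite[of "0::'a" "r + 1"] in \<open>simp_all add: B_def\<close>)
  have f_B: "cmod (f u) \<le> r * indicator B u" for u
    using le[of u] supp[of u] r by (auto simp: B_def indicator_def)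
  have f_L2: "f \<in> L2c lebesgue"
  proof -
    have "integrable lebesgue (\<lambda>u. (cmod (f u))\<^sup>2)"
    proof (rule Bochner_Integration.integrable_bound[OF Bint])
      have "(cmod (f u))\<^sup>2 \<le> (2 * r)\<^sup>2 * indicator B u" for u
      proof (cases "u \<in> B")
        case True
        then show ?thesis
          using power_mono[of "cmod (f u)" "2 * r" 2] le[of u] r by simp
      next
        case False
        then show ?thesis
          using f_B[of u] by simp
      qed
      then show "AE u in lebesgue. norm ((cmod (f u))\<^sup>2) \<le> norm ((2 * r)\<^sup>2 * indicator B u)"
        by (intro always_eventually) auto
    qed simp
    then show ?thesis
      by (simp add: L2c_iff)
  qed
  have "(\<lambda>n. nsq lebesgue (\<lambda>u. h n u - f u)) \<longlonglongrightarrow> 0"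
  proof (rule nsq_tendsto_dominated)
    show "h n \<in> borel_measurable lebesgue" for n
      using h_approx[of n] by (simp add: approximable_def L2c_iff)
    show "AE u in lebesgue. (\<lambda>n. h n u) \<longlonglongrightarrow> f u"
    proof (rule AE_I')
      show "Z \<in> null_sets lebesgue"
        using Z by (simp add: negligible_iff_null_sets)
      show "{u \<in> space lebesgue. \<not> (\<lambda>n. h n u) \<longlonglongrightarrow> f u} \<subseteq> Z"
      proof (clarsimp, rule ccontr)
        fix u assume "u \<notin> Z" and no: "\<not> (\<lambda>n. h n u) \<longlonglongrightarrow> f u"
        have "(\<lambda>n. clip (g n u)) \<longlonglongrightarrow> clip (f u)"
          using clip_cont lim[OF \<open>u \<notin> Z\<close>]
          by (auto intro: isCont_tendsto_compose simp: continuous_on_eq_continuous_at)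
        then have "(\<lambda>n. h n u) \<longlonglongrightarrow> of_real (\<theta> u) * clip (f u)"
          unfolding h_def by (intro tendsto_mult tendsto_const)
        moreover have "of_real (\<theta> u) * clip (f u) = f u"
          using \<theta>(3)[of u] supp[of u] clip_id[OF le[of u]] by (cases "norm u \<le> r") auto
        ultimately show False
          using no by simp
      qed
    qed
    show "AE u in lebesgue. (cmod (h n u - f u))\<^sup>2 \<le> (2 * r)\<^sup>2 * indicator B u" for n
    proof (intro always_eventually allI)
      fix u
      show "(cmod (h n u - f u))\<^sup>2 \<le> (2 * r)\<^sup>2 * indicator B u"
      proof (cases "u \<in> B")
        case True
        have "cmod (h n u - f u) \<le> 2 * r"
          using norm_triangle_ineq4[of "h n u" "f u"] h_le[of n u] le[of u] by simp
        then show ?thesis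
          using True power_mono[of "cmod (h n u - f u)" "2 * r" 2] by simp
      next
        case False
        then show ?thesis
          using f_B[of u] h_supp[of u n] by (simp add: B_def)
      qed
    qed
  qed (use Bint in auto)
  then show ?thesis
    by (rule approximable_limit[OF h_approx f_L2])
qed

text \<open>
Cutting off both large arguments and large values reduces the claim to bounded functions of bounded
support.
\<close>

theorem total_gauss_family: "total_family lebesgue gauss_index (gauss_family :: _ \<Rightarrow> 'a::euclidean_space \<Rightarrow> complex)"
proof -
  have "approximable lebesgue gauss_index gauss_family f" if f: "f \<in> L2c lebesgue" for f :: "'a \<Rightarrow> complex"
  proof -
    have [measurable]: "f \<in> borel_measurable lebesgue"
      using f by (simp add: L2c_iff)
    define h where "h n u = (if norm u \<le> real (Suc n) \<and> cmod (f u) \<le> real (Suc n) then f u else 0)" for n u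
    have [measurable]: "norm \<in> borel_measurable (lebesgue :: 'a measure)"
      by (intro measurable_completion) simp
    have hm [measurable]: "h n \<in> borel_measurable lebesgue" for n
      unfolding h_def by measurable
    have "approximable lebesgue gauss_index gauss_family (h n)" for n
      by (rule approximable_bounded[of _ "real (Suc n)"]) (auto simp: h_def)
    moreover have "(\<lambda>n. nsq lebesgue (\<lambda>u. h n u - f u)) \<longlonglongrightarrow> 0"
    proof (rule nsq_tendsto_dominated)
      show "AE u in lebesgue. (\<lambda>n. h n u) \<longlonglongrightarrow> f u"
      proof (intro always_eventually allI)
        fix u
        obtain n0 where n0: "max (norm u) (cmod (f u)) \<le> real n0"
          using real_arch_simple by blast
        have "\<forall>\<^sub>F n in sequentially. h n u = f u"
          using eventually_ge_at_top[of n0] by eventually_elim (use n0 in \<open>auto simp: h_def\<close>)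
        then show "(\<lambda>n. h n u) \<longlonglongrightarrow> f u"
          by (rule tendsto_eventually)
      qed
      show "integrable lebesgue (\<lambda>u. (cmod (f u))\<^sup>2)"
        using f by (simp add: L2c_iff)
    qed (auto simp: h_def)
    ultimately show ?thesis
      using approximable_limit f by blast
  qed
  moreover have "gauss_family i \<in> L2c lebesgue" if "i \<in> gauss_index" for i :: "real \<times> 'a \<times> 'a"
    using that by (auto simp: gauss_family_def gauss_L2c)
  ultimately show ?thesis
    unfolding total_family_def approximable_def by blast
qed

text \<open>
By \<open>gauss_hat_eq\<close>, every Gaussian is a nonzero multiple of the transform of another one, so the
transforms have the same span as the Gaussians.
\<close>

lemma total_gauss_hat_family: "total_family lebesgue gauss_index (gauss_hat_family :: _ \<Rightarrow> 'a::euclidean_space \<Rightarrow> complex)"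
  unfolding total_family_def
proof (intro conjI ballI allI impI)
  fix i :: "real \<times> 'a \<times> 'a" assume "i \<in> gauss_index"
  then show "gauss_hat_family i \<in> L2c lebesgue"
    by (auto simp: gauss_hat_family_def gauss_hat_L2c)
next
  fix f :: "'a \<Rightarrow> complex" and \<epsilon> :: real assume "f \<in> L2c lebesgue" "\<epsilon> > 0"
  then obtain p where p: "in_span gauss_index gauss_family p" "nsq lebesgue (\<lambda>x. f x - p x) < \<epsilon>"
    using total_gauss_family unfolding total_family_def by blast
  have "in_span gauss_index gauss_hat_family p"
    using p(1)
  proof (rule in_span_trans)
    fix i :: "real \<times> 'a \<times> 'a" assume "i \<in> gauss_index"
    then obtain s a b where i: "i = (s, a, b)" "s > 0"
      by (cases i) auto
    define k where "k = gauss_int (1 / s) (b /\<^sub>R s) (- (a /\<^sub>R s))"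
    have "k \<noteq> 0"
      using i(2) by (simp add: k_def gauss_int_def)
    have "gauss_hat_family (1 / s, b /\<^sub>R s, - (a /\<^sub>R s)) u = k * gauss_family i u" for u
      using i by (simp add: gauss_hat_family_def gauss_family_def k_def gauss_hat_eq)
    then have "gauss_family i = (\<lambda>u. inverse k * gauss_hat_family (1 / s, b /\<^sub>R s, - (a /\<^sub>R s)) u)"
      using \<open>k \<noteq> 0\<close> by (simp add: fun_eq_iff)
    moreover have "in_span gauss_index gauss_hat_family (gauss_hat_family (1 / s, b /\<^sub>R s, - (a /\<^sub>R s)))"
      using i(2) by (intro in_span_generator) auto
    ultimately show "in_span gauss_index gauss_hat_family (gauss_family i)"
      using in_span_scale by simp
  qed
  then show "\<exists>p. in_span gauss_index gauss_hat_family p \<and> nsq lebesgue (\<lambda>x. f x - p x) < \<epsilon>"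
    using p(2) by blast
qed

text \<open>
That \<open>g\<close> is the Fourier transform of \<open>f\<close>, expressed by Parseval's identity against all Gaussians. This applies to
every square-integrable function, whether or not the defining integral converges.
\<close>

definition fourier_pair :: "('a::euclidean_space \<Rightarrow> complex) \<Rightarrow> ('a \<Rightarrow> complex) \<Rightarrow> bool" where
  "fourier_pair f g \<longleftrightarrow> f \<in> L2c lebesgue \<and> g \<in> L2c lebesgue \<and>
     (\<forall>s a b. s > 0 \<longrightarrow> ip lebesgue g (gauss_hat s a b) = ip lebesgue f (gauss s a b))"

theorem plancherel:
  "unitary_relation lebesgue complex_hspace lebesgue complex_hspace
     (fourier_pair :: ('a::euclidean_space \<Rightarrow> complex) \<Rightarrow> ('a \<Rightarrow> complex) \<Rightarrow> bool)"
proof -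
  interpret gram_pair lebesgue lebesgue gauss_index "gauss_family :: _ \<Rightarrow> 'a \<Rightarrow> complex" gauss_hat_family
  proof
    fix i j :: "real \<times> 'a \<times> 'a" assume "i \<in> gauss_index" "j \<in> gauss_index"
    then show "ip lebesgue (gauss_hat_family i) (gauss_hat_family j) = ip lebesgue (gauss_family i) (gauss_family j)"
      by (auto simp: gauss_family_def gauss_hat_family_def ip_gauss ip_gauss_hat)
  qed (rule total_gauss_family total_gauss_hat_family)+
  have "matches = fourier_pair"
    unfolding fun_eq_iff matches_def fourier_pair_def by (auto simp: gauss_family_def gauss_hat_family_def)
  then show ?thesis
    using unitary_relation_matches by simp
qed

section \<open>Euclidean isometries\<close>

text \<open>
The image \<open>\<mu>\<close> of Lebesgue measure is translation invariant because \<open>T\<close> is linear and onto. Evaluating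
\<open>\<integral>\<integral> 1\<^sub>B(y) 1\<^sub>A(x + y)\<close> in both orders shows that \<open>\<mu>\<close> is a multiple of
Lebesgue measure. The multiple is \<open>1\<close> since \<open>T\<close> preserves the unit ball \<open>B\<close>.
\<close>

lemma lborel_distr_linear_isometry:
  fixes T :: "'a::euclidean_space \<Rightarrow> 'a"
  assumes T: "linear T" "\<And>x. norm (T x) = norm x"
  shows "distr lborel borel T = lborel"
proof -
  define \<mu> where "\<mu> = distr lborel borel T"
  have "inj T"
    using T by (metis linear_injective_0 norm_eq_zero)
  then have "surj T"
    using T(1) linear_injective_imp_surjective by blast
  have Tm [measurable]: "T \<in> borel_measurable borel"
    using T(1) by (simp add: linear_continuous_on linear_linear borel_measurable_continuous_onI)
  have sets_\<mu> [measurable_cong]: "sets \<mu> = sets borel" and [simp]: "space \<mu> = UNIV"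
    by (simp_all add: \<mu>_def)
  have emu: "emeasure \<mu> A = emeasure lborel (T -` A)" if "A \<in> sets borel" for A
    using that by (simp add: \<mu>_def emeasure_distr)
  have ball: "T -` ball 0 r = ball 0 r" for r
    by (auto simp: T(2))
  interpret \<mu>: sigma_finite_measure \<mu>
  proof
    show "\<exists>A. countable A \<and> A \<subseteq> sets \<mu> \<and> \<Union> A = space \<mu> \<and> (\<forall>a\<in>A. emeasure \<mu> a \<noteq> \<infinity>)"
    proof (intro exI conjI ballI)
      show "\<Union> (range (\<lambda>n. ball 0 (real n))) = space \<mu>"
        by (auto intro: reals_Archimedean2)
    qed (use emeasure_lborel_ball_finite[of 0] in \<open>auto simp: emu ball sets_\<mu> top.not_eq_extremum\<close>)
  qed
  interpret pair_sigma_finite \<mu> lborel ..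
  have shift: "distr \<mu> borel (\<lambda>x. x + y) = \<mu>" for y
  proof -
    obtain z where z: "T z = y"
      using \<open>surj T\<close> by (metis surjD)
    have "distr \<mu> borel (\<lambda>x. x + y) = distr lborel borel (\<lambda>x. T (x + z))"
      by (simp add: \<mu>_def distr_distr comp_def linear_add[OF T(1)] z)
    also have "\<dots> = distr (distr lborel borel ((+) z)) borel T"
      by (simp add: distr_distr comp_def add.commute)
    finally show ?thesis
      by (simp add: lborel_distr_plus \<mu>_def)
  qed
  have shift_nn: "(\<integral>\<^sup>+x. f (x + y) \<partial>\<mu>) = (\<integral>\<^sup>+x. f x \<partial>\<mu>)" if [measurable]: "f \<in> borel_measurable borel" for f y
    by (subst (2) shift[of y, symmetric]) (simp add: nn_integral_distr)
  have shift_nn': "(\<integral>\<^sup>+y. f (x + y) \<partial>lborel) = (\<integral>\<^sup>+y. f y \<partial>lborel)"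
    if [measurable]: "f \<in> borel_measurable borel" for f and x :: 'a
    by (subst (2) lborel_distr_plus[of x, symmetric]) (simp add: nn_integral_distr)
  define B where "B = ball (0::'a) 1"
  have [measurable]: "B \<in> sets borel"
    by (simp add: B_def)
  have \<mu>B: "emeasure \<mu> B = emeasure lborel B"
    by (simp add: emu B_def ball)
  have "emeasure \<mu> A = emeasure lborel A" if A [measurable]: "A \<in> sets borel" for A
  proof -
    have "emeasure lborel B * emeasure \<mu> A
        = (\<integral>\<^sup>+y. (\<integral>\<^sup>+x. indicator B y * indicator A x \<partial>\<mu>) \<partial>lborel)"
      by (simp add: nn_integral_cmult nn_integral_multc)
    also have "\<dots> = (\<integral>\<^sup>+y. (\<integral>\<^sup>+x. indicator B y * indicator A (x + y) \<partial>\<mu>) \<partial>lborel)"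
      by (subst shift_nn) auto
    also have "\<dots> = (\<integral>\<^sup>+x. (\<integral>\<^sup>+y. indicator B y * indicator A (x + y) \<partial>lborel) \<partial>\<mu>)"
      by (intro Fubini') simp
    also have "\<dots> = (\<integral>\<^sup>+x. (\<integral>\<^sup>+y. indicator B (y - x) * indicator A y \<partial>lborel) \<partial>\<mu>)"
    proof (rule nn_integral_cong)
      fix x
      show "(\<integral>\<^sup>+y. indicator B y * indicator A (x + y) \<partial>lborel)
          = (\<integral>\<^sup>+y. indicator B (y - x) * indicator A y \<partial>lborel)"
        using shift_nn'[of "\<lambda>y. indicator B (y - x) * indicator A y" x] by simp
    qed
    also have "\<dots> = (\<integral>\<^sup>+y. (\<integral>\<^sup>+x. indicator B (y - x) * indicator A y \<partial>\<mu>) \<partial>lborel)"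
      by (intro Fubini'[symmetric]) simp
    also have "\<dots> = (\<integral>\<^sup>+y. emeasure \<mu> B * indicator A y \<partial>lborel)"
    proof (rule nn_integral_cong)
      fix y
      have "(\<integral>\<^sup>+x. indicator B (y - x) * indicator A y \<partial>\<mu>)
          = (\<integral>\<^sup>+x. indicator B (x + - y) \<partial>\<mu>) * indicator A y"
        by (subst nn_integral_multc)
           (auto intro!: arg_cong2[where f = "(*)"] nn_integral_cong
              simp: B_def indicator_def norm_minus_commute)
      then show "(\<integral>\<^sup>+x. indicator B (y - x) * indicator A y \<partial>\<mu>) = emeasure \<mu> B * indicator A y"
        using shift_nn[of "indicator B" "- y"] by simp
    qed
    also have "\<dots> = emeasure lborel B * emeasure lborel A"
      by (simp add: nn_integral_cmult \<mu>B)
    finally have "emeasure lborel B * emeasure \<mu> A = emeasure lborel B * emeasure lborel A" .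
    moreover have "emeasure lborel B \<noteq> \<infinity>" "emeasure lborel B \<noteq> 0"
      using emeasure_lborel_ball_finite[of "0::'a" 1] content_ball_pos[of 1 "0::'a"]
      by (auto simp: B_def measure_def)
    ultimately show ?thesis
      by (simp add: ennreal_mult_cancel_left)
  qed
  then show ?thesis
    unfolding \<mu>_def[symmetric] by (intro measure_eqI) (auto simp: sets_\<mu>)
qed

text \<open>A measure-preserving Borel map also respects null sets, so it extends to the completion.\<close>

lemma lebesgue_distr_of_lborel_distr:
  fixes T :: "'a::euclidean_space \<Rightarrow> 'a"
  assumes [measurable]: "T \<in> borel_measurable borel" and T: "distr lborel borel T = lborel"
  shows "T \<in> lebesgue \<rightarrow>\<^sub>M lebesgue" "distr lebesgue lebesgue T = lebesgue"
proof -
  have eq: "distr lebesgue lborel T = lborel"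
    using T by (simp add: distr_completion cong: distr_cong)
  show "T \<in> lebesgue \<rightarrow>\<^sub>M lebesgue"
    by (intro completion.measurable_completion2) (simp_all add: eq measurable_completion)
  have "lebesgue = completion (distr lebesgue lborel T)"
    by (simp add: eq)
  also have "\<dots> = distr lebesgue lebesgue T"
    by (subst completion.completion_distr_eq) (auto simp: eq measurable_completion)
  finally show "distr lebesgue lebesgue T = lebesgue" ..
qed

lemma lebesgue_distr_isometry:
  fixes T :: "'a::euclidean_space \<Rightarrow> 'a"
  assumes T: "orthogonal_transformation T"
  shows "(\<lambda>v. T v + y) \<in> lebesgue \<rightarrow>\<^sub>M lebesgue" "distr lebesgue lebesgue (\<lambda>v. T v + y) = lebesgue"
proof -
  have [measurable]: "T \<in> borel_measurable borel"
    using T by (simp add: orthogonal_transformation_linear linear_continuous_on linear_linear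
        borel_measurable_continuous_onI)
  have "distr lborel borel (\<lambda>v. T v + y) = distr (distr lborel borel T) borel ((+) y)"
    by (simp add: distr_distr comp_def add.commute)
  also have "distr lborel borel T = lborel"
    using T by (intro lborel_distr_linear_isometry)
      (auto simp: orthogonal_transformation_linear orthogonal_transformation_norm)
  finally have eq: "distr lborel borel (\<lambda>v. T v + y) = lborel"
    by (simp add: lborel_distr_plus)
  show "(\<lambda>v. T v + y) \<in> lebesgue \<rightarrow>\<^sub>M lebesgue" "distr lebesgue lebesgue (\<lambda>v. T v + y) = lebesgue"
    by (rule lebesgue_distr_of_lborel_distr[OF _ eq]; simp)+
qed

lemma L2c_compose:
  assumes "T \<in> M \<rightarrow>\<^sub>M M" "distr M M T = M" "f \<in> L2c M"
  shows "(\<lambda>x. f (T x)) \<in> L2c M"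
proof -
  note [measurable] = assms(1) L2cD(1)[OF assms(3)]
  have "integrable (distr M M T) (\<lambda>x. (cmod (f x))\<^sup>2)"
    using assms by (simp add: L2c_iff)
  then have "integrable M (\<lambda>x. (cmod (f (T x)))\<^sup>2)"
    by (subst (asm) integrable_distr_eq) auto
  then show ?thesis
    by (simp add: L2c_iff)
qed

lemma ip_compose:
  assumes "T \<in> M \<rightarrow>\<^sub>M M" "distr M M T = M" "f \<in> L2c M" "g \<in> L2c M"
  shows "ip M (\<lambda>x. f (T x)) (\<lambda>x. g (T x)) = ip M f g"
proof -
  note [measurable] = assms(1) L2cD(1)[OF assms(3)] L2cD(1)[OF assms(4)]
  have "ip M f g = (\<integral>x. f x * cnj (g x) \<partial>distr M M T)"
    by (simp add: ip_def assms(2))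
  also have "\<dots> = ip M (\<lambda>x. f (T x)) (\<lambda>x. g (T x))"
    unfolding ip_def by (rule integral_distr) auto
  finally show ?thesis ..
qed

text \<open>
An orthogonal map with its inverse, which is also its adjoint. Here \<open>T\<close> is the linear part of the isometry
\<open>v \<mapsto> T(v + x)\<close>, and \<open>u \<mapsto> S u - x\<close> is the inverse isometry.
\<close>

locale orthogonal_pair =
  fixes T S :: "'a::euclidean_space \<Rightarrow> 'a"
  assumes T: "orthogonal_transformation T" and TS: "T (S u) = u" and ST: "S (T u) = u"
begin

lemma S: "orthogonal_transformation S"
proof -
  have "inj T"
    using ST by (metis injI)
  have "linear S"
  proof (rule linearI)
    fix u v c
    have "T (S (u + v)) = T (S u + S v)" "T (S (c *\<^sub>R u)) = T (c *\<^sub>R S u)"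
      using orthogonal_transformation_linear[OF T] by (simp_all add: TS linear_add linear_cmul)
    then show "S (u + v) = S u + S v" "S (c *\<^sub>R u) = c *\<^sub>R S u"
      using \<open>inj T\<close> by (simp_all add: inj_eq)
  qed
  moreover have "norm (S u) = norm u" for u
    using orthogonal_transformation_norm[OF T, of "S u"] by (simp add: TS)
  ultimately show ?thesis
    by (simp add: orthogonal_transformation)
qed

lemma T_add: "T (u + v) = T u + T v" and S_add: "S (u + v) = S u + S v"
  using T S by (simp_all add: orthogonal_transformation_linear linear_add)

lemma T_inner: "T u \<bullet> T v = u \<bullet> v"
  using T by (simp add: orthogonal_transformation_def)

lemma S_adjoint: "S u \<bullet> v = u \<bullet> T v"
  using T_inner[of "S u" v] by (simp add: TS)

lemma S_inner: "S u \<bullet> S v = u \<bullet> v"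
  using S by (simp add: orthogonal_transformation_def)

text \<open>
Composing a Gaussian with an isometry gives a multiple of a Gaussian. Its parameters and the factor are the
same on the Fourier side, up to the character that comes from the translation.
\<close>

definition moved_centre :: "real \<Rightarrow> 'a \<Rightarrow> 'a \<Rightarrow> 'a" where
  "moved_centre s x a = S a - s *\<^sub>R x"

definition moved_factor :: "real \<Rightarrow> 'a \<Rightarrow> 'a \<Rightarrow> 'a \<Rightarrow> complex" where
  "moved_factor s x a b = cexp (2 * pi * (a \<bullet> T x) - pi * s * (x \<bullet> x)) (2 * pi * (b \<bullet> T x))"

lemma gauss_isometry: "gauss s a b (T v + T x) = moved_factor s x a b * gauss s (moved_centre s x a) (S b) v"
proof -
  have "(T v + T x) \<bullet> (T v + T x) = v \<bullet> v + 2 * (x \<bullet> v) + x \<bullet> x"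
    using T_inner[of "v + x" "v + x"] by (simp add: T_add inner_simps inner_commute[of x v])
  then show ?thesis
    unfolding gauss_def moved_factor_def cexp_add moved_centre_def
    by (intro cexp_cong) (simp_all add: inner_simps S_adjoint algebra_simps)
qed

lemma gauss_hat_isometry:
  assumes s: "s > 0"
  shows "cexp 0 (- (2 * pi * (v \<bullet> x))) * gauss_hat s a b (T v)
    = moved_factor s x a b * gauss_hat s (moved_centre s x a) (S b) v"
proof -
  have b: "(b + T v) \<bullet> (b + T v) = (S b + v) \<bullet> (S b + v)"
    using S_inner[of "b + T v" "b + T v"] by (simp add: S_add ST)
  have a: "moved_centre s x a \<bullet> moved_centre s x a = a \<bullet> a - 2 * s * (a \<bullet> T x) + s * s * (x \<bullet> x)"
    by (simp add: moved_centre_def inner_simps S_inner S_adjoint TS inner_commute[of x "S a"] algebra_simps)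
  have ab: "moved_centre s x a \<bullet> (S b + v) = a \<bullet> (b + T v) - s * (b \<bullet> T x) - s * (v \<bullet> x)"
    by (simp add: moved_centre_def inner_simps S_inner S_adjoint TS inner_commute[of x "S b"] inner_commute[of x v]
        algebra_simps)
  have "cexp 0 (- (2 * pi * (v \<bullet> x))) * cexp (pi * (a \<bullet> a - (b + T v) \<bullet> (b + T v)) / s) (2 * pi * (a \<bullet> (b + T v)) / s)
      = moved_factor s x a b * cexp (pi * (moved_centre s x a \<bullet> moved_centre s x a - (S b + v) \<bullet> (S b + v)) / s)
          (2 * pi * (moved_centre s x a \<bullet> (S b + v)) / s)"
    unfolding moved_factor_def cexp_add a ab b
    using s by (intro cexp_cong) (simp_all add: field_simps)
  then show ?thesis
    by (simp add: gauss_hat_def gauss_int_def mult.left_commute)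
qed

text \<open>
Move the isometry from \<open>f\<close> to the Gaussian, where \<open>gauss_isometry\<close> and \<open>gauss_hat_isometry\<close> apply with equal
factors.
\<close>

theorem fourier_pair_isometry:
  assumes "fourier_pair f g"
  shows "fourier_pair (\<lambda>u. f (S u - x)) (\<lambda>\<xi>. cexp 0 (2 * pi * (\<xi> \<bullet> T x)) * g (S \<xi>))"
proof -
  have f: "f \<in> L2c lebesgue" and g: "g \<in> L2c lebesgue"
    using assms by (auto simp: fourier_pair_def)
  have mg: "ip lebesgue g (gauss_hat s a b) = ip lebesgue f (gauss s a b)" if "s > 0" for s a b
    using assms that by (simp add: fourier_pair_def)
  note TA = lebesgue_distr_isometry[OF T] and SA = lebesgue_distr_isometry[OF S]
  have S0: "S \<in> lebesgue \<rightarrow>\<^sub>M lebesgue" "distr lebesgue lebesgue S = lebesgue"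
    using SA[of 0] by simp_all
  have T0: "T \<in> lebesgue \<rightarrow>\<^sub>M lebesgue" "distr lebesgue lebesgue T = lebesgue"
    using TA[of 0] by simp_all
  have f': "(\<lambda>u. f (S u - x)) \<in> L2c lebesgue"
    using L2c_compose[OF SA[of "- x"] f] by simp
  have gS: "(\<lambda>\<xi>. g (S \<xi>)) \<in> L2c lebesgue"
    by (rule L2c_compose[OF S0 g])
  have chm: "(\<lambda>\<xi>. cexp 0 (2 * pi * (\<xi> \<bullet> T x))) \<in> borel_measurable lebesgue"
    by (intro measurable_completion) measurable
  have g': "(\<lambda>\<xi>. cexp 0 (2 * pi * (\<xi> \<bullet> T x)) * g (S \<xi>)) \<in> L2c lebesgue"
    using gS borel_measurable_times[OF chm L2cD(1)[OF gS]] by (simp add: L2c_iff norm_mult)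
  have "ip lebesgue (\<lambda>\<xi>. cexp 0 (2 * pi * (\<xi> \<bullet> T x)) * g (S \<xi>)) (gauss_hat s a b)
      = ip lebesgue (\<lambda>u. f (S u - x)) (gauss s a b)" if s: "s > 0" for s a b
  proof -
    have "ip lebesgue (\<lambda>u. f (S u - x)) (gauss s a b)
        = ip lebesgue (\<lambda>v. f (S (T v + T x) - x)) (\<lambda>v. gauss s a b (T v + T x))"
      by (rule ip_compose[OF TA f' gauss_L2c[OF s], symmetric])
    also have "\<dots> = ip lebesgue f (\<lambda>v. moved_factor s x a b * gauss s (moved_centre s x a) (S b) v)"
      by (simp add: S_add ST gauss_isometry)
    also have "\<dots> = cnj (moved_factor s x a b) * ip lebesgue f (gauss s (moved_centre s x a) (S b))"
      using ip_lincomb_right[OF f gauss_L2c[OF s] L2c_zero] by simp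
    also have "\<dots> = cnj (moved_factor s x a b) * ip lebesgue g (gauss_hat s (moved_centre s x a) (S b))"
      using mg[OF s] by simp
    also have "\<dots> = ip lebesgue g (\<lambda>v. moved_factor s x a b * gauss_hat s (moved_centre s x a) (S b) v)"
      using ip_lincomb_right[OF g gauss_hat_L2c[OF s] L2c_zero] by simp
    also have "\<dots> = ip lebesgue (\<lambda>v. cexp 0 (2 * pi * (T v \<bullet> T x)) * g (S (T v))) (\<lambda>v. gauss_hat s a b (T v))"
      unfolding gauss_hat_isometry[OF s, symmetric] ip_def by (simp add: T_inner ST cnj_cexp mult_ac)
    also have "\<dots> = ip lebesgue (\<lambda>\<xi>. cexp 0 (2 * pi * (\<xi> \<bullet> T x)) * g (S \<xi>)) (gauss_hat s a b)"
      by (rule ip_compose[OF T0 g' gauss_hat_L2c[OF s]])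
    finally show ?thesis ..
  qed
  then show ?thesis
    using f' g' by (auto simp: fourier_pair_def)
qed

end

section \<open>Unfolding functions along a tiling\<close>

text \<open>
Counting measure identifies \<open>l\<^sup>2\<close> with an \<open>L\<^sup>2\<close> space of functions, and sums with integrals, so that Fubini's
theorem can be used for fibre-valued functions.
\<close>

lemma vecs_ell2:
  "\<zeta> \<in> vecs (ell2 I) \<longleftrightarrow> (\<forall>i. i \<notin> I \<longrightarrow> \<zeta> i = 0) \<and> \<zeta> \<in> L2c (count_space I)"
proof -
  have "(\<lambda>i. (cmod (\<zeta> i))\<^sup>2) summable_on I \<longleftrightarrow> Infinite_Set_Sum.abs_summable_on (\<lambda>i. (cmod (\<zeta> i))\<^sup>2) I"
    by (simp flip: abs_summable_equivalent)
  then show ?thesis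
    by (simp add: ell2_def L2c_iff abs_summable_on_def)
qed

lemma vinner_ell2:
  assumes "\<zeta> \<in> vecs (ell2 I)" "\<eta> \<in> vecs (ell2 I)"
  shows "vinner (ell2 I) \<zeta> \<eta> = ip (count_space I) \<zeta> \<eta>"
proof -
  have "Infinite_Set_Sum.abs_summable_on (\<lambda>i. \<zeta> i * cnj (\<eta> i)) I"
    using assms integrable_ip by (auto simp: vecs_ell2 abs_summable_on_def)
  from infsetsum_infsum[OF this] show ?thesis
    by (simp add: ell2_def ip_def infsetsum_def)
qed

lemma measurable_countable_coordinates:
  assumes "countable I" "\<And>i. i \<in> I \<Longrightarrow> (\<lambda>x. h x i) \<in> M \<rightarrow>\<^sub>M N"
  shows "(\<lambda>(x, i). h x i) \<in> M \<Otimes>\<^sub>M count_space I \<rightarrow>\<^sub>M N"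
proof (rule measurable_pair_swap_iff[THEN iffD2])
  show "(\<lambda>(y, x). case (x, y) of (x, i) \<Rightarrow> h x i) \<in> count_space I \<Otimes>\<^sub>M M \<rightarrow>\<^sub>M N"
    by (rule measurable_pair_measure_countable1) (use assms in simp_all)
qed

lemma borel_measurable_integral_count_space:
  fixes h :: "'a \<Rightarrow> 'i \<Rightarrow> 'b::{banach, second_countable_topology}"
  assumes "countable I" "\<And>i. i \<in> I \<Longrightarrow> (\<lambda>x. h x i) \<in> borel_measurable M"
  shows "(\<lambda>x. \<integral>i. h x i \<partial>count_space I) \<in> borel_measurable M"
  using sigma_finite_measure.borel_measurable_lebesgue_integral
    [OF sigma_finite_measure_count_space_countable[OF assms(1)] measurable_countable_coordinates[OF assms]]
  by simp

lemma borel_measurable_ip_count_space: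
  assumes "countable I" "\<And>i. i \<in> I \<Longrightarrow> (\<lambda>x. h x i) \<in> borel_measurable M"
    "\<And>i. i \<in> I \<Longrightarrow> (\<lambda>x. k x i) \<in> borel_measurable M"
  shows "(\<lambda>x. ip (count_space I) (h x) (k x)) \<in> borel_measurable M"
  unfolding ip_def
  by (intro borel_measurable_integral_count_space borel_measurable_times borel_measurable_cnj assms)

lemma borel_measurable_cmod_square:
  assumes "f \<in> borel_measurable M"
  shows "(\<lambda>x. (cmod (f x))\<^sup>2) \<in> borel_measurable M"
  using assms by measurable

lemma borel_measurable_nsq_count_space:
  assumes "countable I" "\<And>i. i \<in> I \<Longrightarrow> (\<lambda>x. h x i) \<in> borel_measurable M"
  shows "(\<lambda>x. nsq (count_space I) (h x)) \<in> borel_measurable M"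
  unfolding nsq_def
  by (intro borel_measurable_integral_count_space borel_measurable_cmod_square assms)

text \<open>
Over a countable index set, weak measurability is measurability of every coordinate: coordinates are inner
products with unit vectors, and conversely an inner product is an integral over the countable index set.
\<close>

lemma L2_fun_ell2_iff:
  assumes I: "countable I"
  shows "h \<in> L2_fun M (ell2 I) \<longleftrightarrow> (\<forall>x\<in>space M. h x \<in> vecs (ell2 I)) \<and>
    (\<forall>i\<in>I. (\<lambda>x. h x i) \<in> borel_measurable M) \<and> integrable M (\<lambda>x. nsq (count_space I) (h x))"
proof (cases "\<forall>x\<in>space M. h x \<in> vecs (ell2 I)")
  case True
  have eq: "vinner (ell2 I) (h x) v = ip (count_space I) (h x) v" if "x \<in> space M" "v \<in> vecs (ell2 I)" for x v
    using True that vinner_ell2 by blast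
  have "integrable M (\<lambda>x. vinner (ell2 I) (h x) (h x)) \<longleftrightarrow> integrable M (\<lambda>x. complex_of_real (nsq (count_space I) (h x)))"
    using True by (intro Bochner_Integration.integrable_cong refl) (simp add: vinner_ell2 ip_self)
  moreover have "(\<forall>v\<in>vecs (ell2 I). (\<lambda>x. vinner (ell2 I) (h x) v) \<in> borel_measurable M) \<longleftrightarrow>
     (\<forall>i\<in>I. (\<lambda>x. h x i) \<in> borel_measurable M)"
  proof (intro iffI ballI)
    fix i assume i: "i \<in> I" and w: "\<forall>v\<in>vecs (ell2 I). (\<lambda>x. vinner (ell2 I) (h x) v) \<in> borel_measurable M"
    define v where "v j = (of_bool (j = i) :: complex)" for j
    have fin: "finite {j \<in> I. v j \<noteq> 0}" "{j \<in> I. v j \<noteq> 0} = {i}"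
      using i by (auto simp: v_def)
    have v: "v \<in> vecs (ell2 I)"
    proof -
      have "(\<lambda>j. (cmod (v j))\<^sup>2) summable_on I"
        by (rule finite_nonzero_values_imp_summable_on) (use fin in simp)
      then show ?thesis
        using i by (auto simp: ell2_def v_def)
    qed
    have "ip (count_space I) (h x) v = h x i" for x
    proof -
      have *: "{j \<in> I. h x j * cnj (v j) \<noteq> 0} \<subseteq> {i}"
        by (auto simp: v_def)
      then have "finite {j \<in> I. h x j * cnj (v j) \<noteq> 0}"
        using finite_subset by blast
      then have "ip (count_space I) (h x) v = (\<Sum>j | j \<in> I \<and> h x j * cnj (v j) \<noteq> 0. h x j * cnj (v j))"
        unfolding ip_def by (rule lebesgue_integral_count_space_finite_support)
      also have "\<dots> = (\<Sum>j\<in>{i}. h x j * cnj (v j))"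
        by (rule sum.mono_neutral_left) (use * i in auto)
      finally show ?thesis
        by (simp add: v_def)
    qed
    then show "(\<lambda>x. h x i) \<in> borel_measurable M"
      using w[rule_format, OF v] eq[OF _ v] by (simp cong: measurable_cong)
  next
    fix v assume v: "v \<in> vecs (ell2 I)" and m: "\<forall>i\<in>I. (\<lambda>x. h x i) \<in> borel_measurable M"
    have "(\<lambda>x. ip (count_space I) (h x) v) \<in> borel_measurable M"
      by (rule borel_measurable_ip_count_space[OF I]) (use m in auto)
    then show "(\<lambda>x. vinner (ell2 I) (h x) v) \<in> borel_measurable M"
      using eq[OF _ v] by (simp cong: measurable_cong)
  qed
  ultimately show ?thesis
    using True unfolding L2_fun_def by (auto simp: complex_of_real_integrable_eq)
qed (auto simp: L2_fun_def)

lemma sigma_finite_lebesgue: "sigma_finite_measure (lebesgue :: 'a::euclidean_space measure)"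
proof
  let ?B = "range (\<lambda>n. cball (0::'a) (real n))"
  have "\<exists>n. norm x \<le> real n" for x :: 'a
    by (rule real_arch_simple)
  then have "\<Union> ?B = space lebesgue"
    by auto
  moreover have "emeasure lebesgue (cball (0::'a) (real n)) \<noteq> \<infinity>" for n
    using emeasure_lborel_cball_finite[of "0::'a" "real n"] by (simp add: less_top)
  ultimately show "\<exists>A. countable A \<and> A \<subseteq> sets lebesgue \<and> \<Union> A = space (lebesgue :: 'a measure)
      \<and> (\<forall>a\<in>A. emeasure lebesgue a \<noteq> \<infinity>)"
    by (intro exI[of _ ?B]) auto
qed

text \<open>
Countably many disjoint images of \<open>R\<close> under measure-preserving bijections, covering almost everything.
The unimodular functions \<open>c i\<close> leave room for a phase on each tile.
\<close>

locale tiling =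
  fixes I :: "'i set" and act act' :: "'i \<Rightarrow> 'a::euclidean_space \<Rightarrow> 'a" and R :: "'a set"
    and c :: "'i \<Rightarrow> 'a \<Rightarrow> complex"
  assumes I: "countable I"
    and R: "open R"
    and act_measurable: "i \<in> I \<Longrightarrow> act i \<in> lebesgue \<rightarrow>\<^sub>M lebesgue"
    and act'_measurable: "i \<in> I \<Longrightarrow> act' i \<in> lebesgue \<rightarrow>\<^sub>M lebesgue"
    and act_preserving: "i \<in> I \<Longrightarrow> distr lebesgue lebesgue (act i) = lebesgue"
    and act'_act: "i \<in> I \<Longrightarrow> act' i (act i r) = r"
    and act_act': "i \<in> I \<Longrightarrow> act i (act' i v) = v"
    and disjoint: "i \<in> I \<Longrightarrow> j \<in> I \<Longrightarrow> i \<noteq> j \<Longrightarrow> act i ` R \<inter> act j ` R = {}"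
    and cover: "AE v in lebesgue. \<exists>i\<in>I. v \<in> act i ` R"
    and c_measurable: "i \<in> I \<Longrightarrow> c i \<in> borel_measurable lebesgue"
    and c_norm: "i \<in> I \<Longrightarrow> cmod (c i r) = 1"
begin

lemma mem_tile_iff: "i \<in> I \<Longrightarrow> v \<in> act i ` R \<longleftrightarrow> act' i v \<in> R"
  using act'_act act_act' by (metis image_eqI imageE)

lemma tile_sets: "i \<in> I \<Longrightarrow> act i ` R \<in> sets lebesgue"
proof -
  assume i: "i \<in> I"
  have "act i ` R = act' i -` R \<inter> space lebesgue"
    using mem_tile_iff[OF i] by auto
  then show ?thesis
    using measurable_sets[OF act'_measurable[OF i], of R] R by simp
qed

lemma R_sets [measurable]: "R \<in> sets lebesgue"
  using R by simp

lemma AE_tiling: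
  assumes Q: "{v. Q v} \<in> sets lebesgue"
  shows "(AE v in lebesgue. Q v) \<longleftrightarrow> (AE r in lebesgue_on R. \<forall>i\<in>I. Q (act i r))"
proof -
  have "(AE v in lebesgue. Q v) \<longleftrightarrow> (AE v in lebesgue. \<forall>i\<in>I. v \<in> act i ` R \<longrightarrow> Q v)"
    using cover by (intro iffI) (auto elim: eventually_elim2 eventually_mono)
  also have "\<dots> \<longleftrightarrow> (\<forall>i\<in>I. AE v in lebesgue. v \<in> act i ` R \<longrightarrow> Q v)"
    by (rule AE_ball_countable[OF I])
  also have "\<dots> \<longleftrightarrow> (\<forall>i\<in>I. AE r in lebesgue_on R. Q (act i r))"
  proof (intro ball_cong refl)
    fix i assume i: "i \<in> I"
    have "{v \<in> space lebesgue. v \<in> act i ` R \<longrightarrow> Q v} = - (act i ` R) \<union> {v. Q v}"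
      by auto
    also have "\<dots> \<in> sets lebesgue"
      using sets.compl_sets[OF tile_sets[OF i]] Q by (intro sets.Un) (simp_all add: Compl_eq_Diff_UNIV)
    finally have m: "{v \<in> space lebesgue. v \<in> act i ` R \<longrightarrow> Q v} \<in> sets lebesgue" .
    have "(AE v in lebesgue. v \<in> act i ` R \<longrightarrow> Q v)
        \<longleftrightarrow> (AE v in distr lebesgue lebesgue (act i). v \<in> act i ` R \<longrightarrow> Q v)"
      by (simp only: act_preserving[OF i])
    also have "\<dots> \<longleftrightarrow> (AE r in lebesgue. act i r \<in> act i ` R \<longrightarrow> Q (act i r))"
      by (rule AE_distr_iff[OF act_measurable[OF i] m])
    also have "\<dots> \<longleftrightarrow> (AE r in lebesgue_on R. Q (act i r))"
      using mem_tile_iff[OF i] act'_act[OF i] R by (simp add: AE_restrict_space_iff)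
    finally show "(AE v in lebesgue. v \<in> act i ` R \<longrightarrow> Q v) \<longleftrightarrow> (AE r in lebesgue_on R. Q (act i r))" .
  qed
  also have "\<dots> \<longleftrightarrow> (AE r in lebesgue_on R. \<forall>i\<in>I. Q (act i r))"
    by (rule AE_ball_countable[OF I, symmetric])
  finally show ?thesis .
qed

abbreviation P :: "('i \<times> 'a) measure" where
  "P \<equiv> count_space I \<Otimes>\<^sub>M lebesgue_on R"

lemma pair_sigma: "pair_sigma_finite (count_space I) (lebesgue_on R)"
  by (intro pair_sigma_finite.intro sigma_finite_measure_count_space_countable I
      sigma_finite_measure_restrict_space R_sets sigma_finite_lebesgue)

lemma act_restrict_measurable: "i \<in> I \<Longrightarrow> act i \<in> lebesgue_on R \<rightarrow>\<^sub>M lebesgue"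
  by (intro measurable_restrict_space1 act_measurable)

lemma act_pair_measurable: "(\<lambda>(i, r). act i r) \<in> P \<rightarrow>\<^sub>M lebesgue"
  by (rule measurable_pair_measure_countable1[OF I]) (simp add: act_restrict_measurable)

text \<open>
The product of the index set with \<open>R\<close> is a disjoint copy of all tiles, each with its own measure. In
this form, integrals over the whole space become iterated integrals over \<open>R\<close> and the index set.
\<close>

lemma distr_tiling: "distr P lebesgue (\<lambda>(i, r). act i r) = lebesgue"
proof (rule measure_eqI)
  interpret pair_sigma_finite "count_space I" "lebesgue_on R" by (rule pair_sigma)
  fix A assume "A \<in> sets (distr P lebesgue (\<lambda>(i, r). act i r))"
  then have A [measurable]: "A \<in> sets lebesgue" by simp
  have m: "(\<lambda>p. indicator A (case p of (i, r) \<Rightarrow> act i r) :: ennreal) \<in> borel_measurable P"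
    using measurable_compose[OF act_pair_measurable, of "indicator A" borel] by simp
  have "emeasure (distr P lebesgue (\<lambda>(i, r). act i r)) A
      = (\<integral>\<^sup>+v. indicator A v \<partial>distr P lebesgue (\<lambda>(i, r). act i r))"
    by simp
  also have "\<dots> = (\<integral>\<^sup>+p. indicator A (case p of (i, r) \<Rightarrow> act i r) \<partial>P)"
    by (rule nn_integral_distr[OF act_pair_measurable]) simp
  also have "\<dots> = (\<integral>\<^sup>+i. \<integral>\<^sup>+r. indicator A (act i r) \<partial>lebesgue_on R \<partial>count_space I)"
    by (subst M2.nn_integral_fst[symmetric, OF m]) simp
  also have "\<dots> = (\<integral>\<^sup>+i. emeasure lebesgue (A \<inter> act i ` R) \<partial>count_space I)"
  proof (rule nn_integral_cong)
    fix i assume "i \<in> space (count_space I)"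
    then have i: "i \<in> I" by simp
    note [measurable] = tile_sets[OF i]
    have "(\<integral>\<^sup>+r. indicator A (act i r) \<partial>lebesgue_on R) = (\<integral>\<^sup>+r. indicator A (act i r) * indicator R r \<partial>lebesgue)"
      by (simp add: nn_integral_restrict_space)
    also have "\<dots> = (\<integral>\<^sup>+r. indicator (A \<inter> act i ` R) (act i r) \<partial>lebesgue)"
      using mem_tile_iff[OF i] act'_act[OF i] by (intro nn_integral_cong) (auto simp: indicator_def)
    also have "\<dots> = (\<integral>\<^sup>+v. indicator (A \<inter> act i ` R) v \<partial>distr lebesgue lebesgue (act i))"
      using act_measurable[OF i] by (subst nn_integral_distr) simp_all
    also have "\<dots> = emeasure lebesgue (A \<inter> act i ` R)"
      by (simp add: act_preserving[OF i])
    finally show "(\<integral>\<^sup>+r. indicator A (act i r) \<partial>lebesgue_on R) = emeasure lebesgue (A \<inter> act i ` R)" .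
  qed
  also have "\<dots> = emeasure lebesgue (\<Union>i\<in>I. A \<inter> act i ` R)"
  proof (rule emeasure_UN_countable[symmetric])
    show "disjoint_family_on (\<lambda>i. A \<inter> act i ` R) I"
      using disjoint unfolding disjoint_family_on_def by blast
  qed (use tile_sets I in auto)
  also have "\<dots> = emeasure lebesgue A"
  proof (rule emeasure_eq_AE)
    show "AE v in lebesgue. v \<in> (\<Union>i\<in>I. A \<inter> act i ` R) \<longleftrightarrow> v \<in> A"
      using cover by eventually_elim auto
    show "(\<Union>i\<in>I. A \<inter> act i ` R) \<in> sets lebesgue"
      using I tile_sets by (intro sets.countable_UN') auto
  qed simp
  finally show "emeasure (distr P lebesgue (\<lambda>(i, r). act i r)) A = emeasure lebesgue A" .
qed simp

definition unfolds :: "('a \<Rightarrow> complex) \<Rightarrow> ('a \<Rightarrow> 'i \<Rightarrow> complex) \<Rightarrow> bool" where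
  "unfolds g h \<longleftrightarrow> g \<in> L2c lebesgue \<and> h \<in> L2_fun (lebesgue_on R) (ell2 I) \<and>
     (AE r in lebesgue_on R. \<forall>i\<in>I. h r i = c i r * g (act i r))"

lemma L2_funD:
  assumes "h \<in> L2_fun (lebesgue_on R) (ell2 I)"
  shows "r \<in> R \<Longrightarrow> h r \<in> vecs (ell2 I)" "r \<in> R \<Longrightarrow> h r \<in> L2c (count_space I)"
    "i \<in> I \<Longrightarrow> (\<lambda>r. h r i) \<in> borel_measurable (lebesgue_on R)"
  using assms by (auto simp: L2_fun_ell2_iff[OF I] vecs_ell2)

text \<open>The factors \<open>c i\<close> have modulus \<open>1\<close> and cancel in the inner product of two fibres.\<close>

lemma unfolds_inner:
  assumes "unfolds g h" "unfolds g' h'"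
  shows "ip lebesgue g g' = (\<integral>r. vinner (ell2 I) (h r) (h' r) \<partial>lebesgue_on R)"
proof -
  interpret pair_sigma_finite "count_space I" "lebesgue_on R" by (rule pair_sigma)
  have g: "g \<in> L2c lebesgue" "g' \<in> L2c lebesgue"
    and h: "h \<in> L2_fun (lebesgue_on R) (ell2 I)" "h' \<in> L2_fun (lebesgue_on R) (ell2 I)"
    using assms by (auto simp: unfolds_def)
  note [measurable] = L2cD(1)[OF g(1)] L2cD(1)[OF g(2)] act_pair_measurable
  define \<phi> where "\<phi> v = g v * cnj (g' v)" for v
  have [measurable]: "\<phi> \<in> borel_measurable lebesgue"
    unfolding \<phi>_def by measurable
  have "integrable lebesgue \<phi>"
    unfolding \<phi>_def by (rule integrable_ip[OF g])
  then have int: "integrable P (\<lambda>(i, r). \<phi> (act i r))"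
    by (subst (asm) distr_tiling[symmetric], subst (asm) integrable_distr_eq) (auto simp: case_prod_unfold)
  have "ip lebesgue g g' = (\<integral>v. \<phi> v \<partial>distr P lebesgue (\<lambda>(i, r). act i r))"
    by (simp add: ip_def \<phi>_def distr_tiling)
  also have "\<dots> = (\<integral>p. \<phi> (case p of (i, r) \<Rightarrow> act i r) \<partial>P)"
    by (rule integral_distr) auto
  also have "\<dots> = (\<integral>p. (case p of (i, r) \<Rightarrow> \<phi> (act i r)) \<partial>P)"
    by (simp add: case_prod_unfold)
  also have "\<dots> = (\<integral>r. (\<integral>i. \<phi> (act i r) \<partial>count_space I) \<partial>lebesgue_on R)"
    by (rule integral_snd[OF int, symmetric])
  also have "\<dots> = (\<integral>r. ip (count_space I) (h r) (h' r) \<partial>lebesgue_on R)"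
  proof (rule integral_cong_AE)
    show "(\<lambda>r. ip (count_space I) (h r) (h' r)) \<in> borel_measurable (lebesgue_on R)"
      by (rule borel_measurable_ip_count_space[OF I]) (use L2_funD(3) h in auto)
    show "(\<lambda>r. \<integral>i. \<phi> (act i r) \<partial>count_space I) \<in> borel_measurable (lebesgue_on R)"
      by (rule borel_measurable_integral_count_space[OF I])
        (use measurable_compose[OF act_restrict_measurable, of _ \<phi>] in auto)
    have "AE r in lebesgue_on R. \<forall>i\<in>I. h r i = c i r * g (act i r)"
      "AE r in lebesgue_on R. \<forall>i\<in>I. h' r i = c i r * g' (act i r)"
      using assms by (auto simp: unfolds_def)
    then show "AE r in lebesgue_on R. (\<integral>i. \<phi> (act i r) \<partial>count_space I) = ip (count_space I) (h r) (h' r)"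
    proof eventually_elim
      case (elim r)
      have "\<phi> (act i r) = h r i * cnj (h' r i)" if "i \<in> I" for i
      proof -
        have "c i r * cnj (c i r) = 1"
          using c_norm[OF that, of r] by (simp flip: complex_norm_square)
        then have "h r i * cnj (h' r i) = 1 * (g (act i r) * cnj (g' (act i r)))"
          using elim that by (simp only: complex_cnj_mult) (simp add: mult_ac)
        then show ?thesis
          by (simp add: \<phi>_def)
      qed
      then show ?case
        unfolding ip_def by (intro Bochner_Integration.integral_cong) auto
    qed
  qed
  also have "\<dots> = (\<integral>r. vinner (ell2 I) (h r) (h' r) \<partial>lebesgue_on R)"
    using L2_funD(1) h by (intro Bochner_Integration.integral_cong) (auto simp: vinner_ell2)
  finally show ?thesis .
qed

lemma unfolds_left_total:
  assumes g: "g \<in> L2c lebesgue"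
  shows "\<exists>h. unfolds g h"
proof -
  interpret pair_sigma_finite "count_space I" "lebesgue_on R" by (rule pair_sigma)
  note [measurable] = L2cD(1)[OF g] act_pair_measurable
  define \<phi> where "\<phi> r i = (if i \<in> I then c i r * g (act i r) else 0)" for r i
  have \<phi>m: "(\<lambda>r. \<phi> r i) \<in> borel_measurable (lebesgue_on R)" if "i \<in> I" for i
    using that measurable_compose[OF act_restrict_measurable L2cD(1)[OF g]]
      measurable_restrict_space1[OF c_measurable] by (simp add: \<phi>_def)
  have norm_\<phi>: "(cmod (\<phi> r i))\<^sup>2 = (cmod (g (act i r)))\<^sup>2" if "i \<in> I" for r i
    using that c_norm by (simp add: \<phi>_def norm_mult)
  define regular where "regular r \<longleftrightarrow> integrable (count_space I) (\<lambda>i. (cmod (\<phi> r i))\<^sup>2)" for r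
  have regular_m: "Measurable.pred (lebesgue_on R) regular"
    unfolding regular_def
    by (intro M1.borel_measurable_lebesgue_integrable measurable_countable_coordinates[OF I]
        borel_measurable_cmod_square \<phi>m)
  have int: "integrable P (\<lambda>(i, r). (cmod (g (act i r)))\<^sup>2)"
  proof -
    have "integrable (distr P lebesgue (\<lambda>(i, r). act i r)) (\<lambda>v. (cmod (g v))\<^sup>2)"
      using L2cD(2)[OF g] by (simp add: distr_tiling)
    then show ?thesis
      by (subst (asm) integrable_distr_eq) (auto simp: case_prod_unfold)
  qed
  have regular_AE: "AE r in lebesgue_on R. regular r"
    using AE_integrable_snd[OF int]
  proof eventually_elim
    case (elim r)
    then show ?case
      unfolding regular_def by (subst Bochner_Integration.integrable_cong[OF refl norm_\<phi>]) auto
  qed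
  \<comment> \<open>A representative must lie in \<open>l\<^sup>2\<close> at every point, but the sum over the tiles is finite only almost
    everywhere; elsewhere the fibre is set to \<open>0\<close>.\<close>
  define h where "h r i = (if regular r then \<phi> r i else 0)" for r i
  have hm: "(\<lambda>r. h r i) \<in> borel_measurable (lebesgue_on R)" if "i \<in> I" for i
  proof -
    note [measurable] = regular_m \<phi>m[OF that]
    show ?thesis
      unfolding h_def by measurable
  qed
  have h_vecs: "h r \<in> vecs (ell2 I)" for r
    by (cases "regular r") (auto simp: vecs_ell2 L2c_iff h_def[abs_def] regular_def \<phi>_def)
  have "integrable (lebesgue_on R) (\<lambda>r. nsq (count_space I) (h r))"
  proof (rule integrable_cong_AE_imp[OF integrable_snd[OF int]])
    show "(\<lambda>r. nsq (count_space I) (h r)) \<in> borel_measurable (lebesgue_on R)"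
      by (intro borel_measurable_nsq_count_space[OF I] hm)
    show "AE r in lebesgue_on R. (\<integral>i. (cmod (g (act i r)))\<^sup>2 \<partial>count_space I) = nsq (count_space I) (h r)"
      using regular_AE
    proof eventually_elim
      case (elim r)
      then show ?case
        unfolding nsq_def h_def using norm_\<phi> by (intro Bochner_Integration.integral_cong) auto
    qed
  qed
  then have "h \<in> L2_fun (lebesgue_on R) (ell2 I)"
    using h_vecs hm by (simp add: L2_fun_ell2_iff[OF I])
  moreover have "AE r in lebesgue_on R. \<forall>i\<in>I. h r i = c i r * g (act i r)"
    using regular_AE by eventually_elim (simp add: h_def \<phi>_def)
  ultimately show ?thesis
    using g by (auto simp: unfolds_def)
qed

lemma unfolds_right_total:
  assumes h: "h \<in> L2_fun (lebesgue_on R) (ell2 I)"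
  shows "\<exists>g. unfolds g h"
proof -
  interpret pair_sigma_finite "count_space I" "lebesgue_on R" by (rule pair_sigma)
  define h0 where "h0 i r = indicat_real R r *\<^sub>R h r i" for i r
  have h0m: "h0 i \<in> borel_measurable lebesgue" if "i \<in> I" for i
    using L2_funD(3)[OF h that] R_sets unfolding h0_def
    by (subst (asm) borel_measurable_restrict_space_iff) auto
  \<comment> \<open>At most one summand is nonzero, since \<open>h0\<close> vanishes off \<open>R\<close> and the tiles are disjoint.\<close>
  define \<phi> where "\<phi> v i = cnj (c i (act' i v)) * h0 i (act' i v)" for v i
  define g where "g v = (\<integral>i. \<phi> v i \<partial>count_space I)" for v
  have gm: "g \<in> borel_measurable lebesgue"
    unfolding g_def \<phi>_def
    by (intro borel_measurable_integral_count_space[OF I] borel_measurable_times borel_measurable_cnj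
        measurable_compose[OF act'_measurable c_measurable] measurable_compose[OF act'_measurable h0m])
  have g_act: "g (act i r) = cnj (c i r) * h r i" if i: "i \<in> I" and r: "r \<in> R" for i r
  proof -
    have zero: "\<phi> (act i r) j = 0" if "j \<in> I" "j \<noteq> i" for j
    proof -
      have "act i r \<notin> act j ` R"
        using disjoint[OF i that(1)] that(2) r by blast
      then show ?thesis
        using mem_tile_iff[OF that(1)] by (simp add: \<phi>_def h0_def)
    qed
    have sub: "{j \<in> I. \<phi> (act i r) j \<noteq> 0} \<subseteq> {i}"
      using zero by blast
    then have "finite {j \<in> I. \<phi> (act i r) j \<noteq> 0}"
      using finite_subset by blast
    then have "g (act i r) = (\<Sum>j | j \<in> I \<and> \<phi> (act i r) j \<noteq> 0. \<phi> (act i r) j)"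
      unfolding g_def by (rule lebesgue_integral_count_space_finite_support)
    also have "\<dots> = (\<Sum>j\<in>{i}. \<phi> (act i r) j)"
      by (rule sum.mono_neutral_left) (use sub i in auto)
    also have "\<dots> = cnj (c i r) * h r i"
      using r by (simp add: \<phi>_def h0_def act'_act[OF i])
    finally show ?thesis .
  qed
  note [measurable] = gm act_pair_measurable
  have gg: "(\<integral>\<^sup>+i. ennreal ((cmod (g (act i r)))\<^sup>2) \<partial>count_space I) = ennreal (nsq (count_space I) (h r))"
    if r: "r \<in> R" for r
  proof -
    have "(\<integral>\<^sup>+i. ennreal ((cmod (g (act i r)))\<^sup>2) \<partial>count_space I) = (\<integral>\<^sup>+i. ennreal ((cmod (h r i))\<^sup>2) \<partial>count_space I)"
      using g_act[OF _ r] c_norm by (intro nn_integral_cong) (simp add: norm_mult)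
    also have "\<dots> = ennreal (nsq (count_space I) (h r))"
      unfolding nsq_def by (rule nn_integral_eq_integral) (use L2cD(2)[OF L2_funD(2)[OF h r]] in auto)
    finally show ?thesis .
  qed
  have "(\<integral>\<^sup>+v. ennreal ((cmod (g v))\<^sup>2) \<partial>lebesgue)
      = (\<integral>\<^sup>+v. ennreal ((cmod (g v))\<^sup>2) \<partial>distr P lebesgue (\<lambda>(i, r). act i r))"
    by (simp only: distr_tiling)
  also have "\<dots> = (\<integral>\<^sup>+p. ennreal ((cmod (g (case p of (i, r) \<Rightarrow> act i r)))\<^sup>2) \<partial>P)"
    by (rule nn_integral_distr) measurable
  also have "\<dots> = (\<integral>\<^sup>+r. (\<integral>\<^sup>+i. ennreal ((cmod (g (act i r)))\<^sup>2) \<partial>count_space I) \<partial>lebesgue_on R)"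
    by (subst nn_integral_snd[symmetric]) (auto simp: case_prod_unfold)
  also have "\<dots> = (\<integral>\<^sup>+r. ennreal (nsq (count_space I) (h r)) \<partial>lebesgue_on R)"
    by (rule nn_integral_cong) (simp add: gg)
  also have "\<dots> < \<infinity>"
  proof -
    have "integrable (lebesgue_on R) (\<lambda>r. nsq (count_space I) (h r))"
      using h by (simp add: L2_fun_ell2_iff[OF I])
    then show ?thesis
      by (simp add: nn_integral_eq_integral nsq_nonneg)
  qed
  finally have "integrable lebesgue (\<lambda>v. (cmod (g v))\<^sup>2)"
    by (intro integrableI_bounded) auto
  then have "g \<in> L2c lebesgue"
    using gm by (simp add: L2c_iff)
  moreover have "AE r in lebesgue_on R. \<forall>i\<in>I. h r i = c i r * g (act i r)"
  proof (rule AE_I2, intro ballI)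
    fix r i assume "r \<in> space (lebesgue_on R)" "i \<in> I"
    moreover from this have "c i r * cnj (c i r) = 1"
      using c_norm[of i r] by (simp flip: complex_norm_square)
    ultimately show "h r i = c i r * g (act i r)"
      using g_act[of i r] by (simp add: mult.assoc[symmetric])
  qed
  ultimately show ?thesis
    using h by (auto simp: unfolds_def)
qed

lemma unfolds_AE_iff:
  assumes "unfolds g h" "unfolds g' h'"
  shows "(AE v in lebesgue. g v = g' v) \<longleftrightarrow> (AE r in lebesgue_on R. h r = h' r)"
proof -
  have [measurable]: "g \<in> borel_measurable lebesgue" "g' \<in> borel_measurable lebesgue"
    using assms by (auto simp: unfolds_def L2c_iff)
  have "{v \<in> space lebesgue. g v = g' v} \<in> sets lebesgue"
    by measurable
  then have "(AE v in lebesgue. g v = g' v)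
      \<longleftrightarrow> (AE r in lebesgue_on R. \<forall>i\<in>I. g (act i r) = g' (act i r))"
    by (intro AE_tiling) simp
  also have "\<dots> \<longleftrightarrow> (AE r in lebesgue_on R. h r = h' r)"
  proof -
    have "AE r in lebesgue_on R. (\<forall>i\<in>I. g (act i r) = g' (act i r)) \<longleftrightarrow> h r = h' r"
    proof -
      have "AE r in lebesgue_on R. r \<in> R"
        by (rule AE_I2) simp
      moreover have "AE r in lebesgue_on R. \<forall>i\<in>I. h r i = c i r * g (act i r)"
        "AE r in lebesgue_on R. \<forall>i\<in>I. h' r i = c i r * g' (act i r)"
        using assms by (auto simp: unfolds_def)
      ultimately show ?thesis
      proof eventually_elim
        case (elim r)
        have off: "h r i = 0" "h' r i = 0" if "i \<notin> I" for i
          using that assms L2_funD(1)[of h r] L2_funD(1)[of h' r] elim(1) by (auto simp: unfolds_def vecs_ell2)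
        have c0: "c i r \<noteq> 0" if "i \<in> I" for i
          using c_norm[OF that, of r] by auto
        have "h r = h' r \<longleftrightarrow> (\<forall>i\<in>I. h r i = h' r i)"
          using off by (metis ext)
        also have "\<dots> \<longleftrightarrow> (\<forall>i\<in>I. g (act i r) = g' (act i r))"
          using elim c0 by simp
        finally show ?case ..
      qed
    qed
    then show ?thesis
      by (rule eventually_subst)
  qed
  finally show ?thesis .
qed

lemma L2_fun_ell2_add:
  assumes "h \<in> L2_fun (lebesgue_on R) (ell2 I)" "h' \<in> L2_fun (lebesgue_on R) (ell2 I)"
  shows "(\<lambda>r i. b * h r i + h' r i) \<in> L2_fun (lebesgue_on R) (ell2 I)"
proof -
  note mem = L2_funD(2)[OF assms(1)] L2_funD(2)[OF assms(2)]
  have v: "(\<lambda>i. b * h r i + h' r i) \<in> vecs (ell2 I)" if "r \<in> R" for r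
    using L2_funD(1)[OF assms(1) that] L2_funD(1)[OF assms(2) that]
    by (auto simp: vecs_ell2 intro!: L2c_add L2c_scale)
  have m: "(\<lambda>r. b * h r i + h' r i) \<in> borel_measurable (lebesgue_on R)" if "i \<in> I" for i
    using L2_funD(3)[OF assms(1) that] L2_funD(3)[OF assms(2) that]
    by (intro borel_measurable_add borel_measurable_times) auto
  have "integrable (lebesgue_on R) (\<lambda>r. nsq (count_space I) (\<lambda>i. b * h r i + h' r i))"
  proof (rule Bochner_Integration.integrable_bound)
    show "integrable (lebesgue_on R)
       (\<lambda>r. 2 * ((cmod b)\<^sup>2 * nsq (count_space I) (h r)) + 2 * nsq (count_space I) (h' r))"
      using assms by (simp add: L2_fun_ell2_iff[OF I])
    show "(\<lambda>r. nsq (count_space I) (\<lambda>i. b * h r i + h' r i)) \<in> borel_measurable (lebesgue_on R)"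
      by (intro borel_measurable_nsq_count_space[OF I] m)
    show "AE r in lebesgue_on R. norm (nsq (count_space I) (\<lambda>i. b * h r i + h' r i))
       \<le> norm (2 * ((cmod b)\<^sup>2 * nsq (count_space I) (h r)) + 2 * nsq (count_space I) (h' r))"
    proof (rule AE_I2)
      fix r assume "r \<in> space (lebesgue_on R)"
      then have r: "r \<in> R" by simp
      have "nsq (count_space I) (\<lambda>i. b * h r i) = (cmod b)\<^sup>2 * nsq (count_space I) (h r)"
        by (simp add: nsq_def norm_mult power_mult_distrib)
      then show "norm (nsq (count_space I) (\<lambda>i. b * h r i + h' r i))
         \<le> norm (2 * ((cmod b)\<^sup>2 * nsq (count_space I) (h r)) + 2 * nsq (count_space I) (h' r))"
        using nsq_add_le[OF L2c_scale[OF mem(1)[OF r], of b] mem(2)[OF r]]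
          nsq_nonneg[of "count_space I" "\<lambda>i. b * h r i + h' r i"]
        unfolding real_norm_def by linarith
    qed
  qed
  then show ?thesis
    using v m by (simp add: L2_fun_ell2_iff[OF I])
qed

lemma unfolds_lincomb:
  assumes "unfolds g h" "unfolds g' h'"
  shows "unfolds (\<lambda>v. b * g v + g' v) (\<lambda>r i. b * h r i + h' r i)"
proof -
  have "AE r in lebesgue_on R. \<forall>i\<in>I. h r i = c i r * g (act i r)"
    "AE r in lebesgue_on R. \<forall>i\<in>I. h' r i = c i r * g' (act i r)"
    using assms by (auto simp: unfolds_def)
  then have "AE r in lebesgue_on R. \<forall>i\<in>I. b * h r i + h' r i = c i r * (b * g (act i r) + g' (act i r))"
    by eventually_elim (simp add: algebra_simps)
  then show ?thesis
    using assms by (auto simp: unfolds_def intro!: L2c_add L2c_scale L2_fun_ell2_add)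
qed

lemma unfolds_zero: "unfolds (\<lambda>v. 0) (\<lambda>r i. 0)"
  by (simp add: unfolds_def L2c_zero L2_fun_ell2_iff[OF I] vecs_ell2 nsq_def)

theorem unitary_relation_unfolds:
  "unitary_relation lebesgue complex_hspace (lebesgue_on R) (ell2 I) unfolds"
proof
  fix g :: "'a \<Rightarrow> complex" assume "g \<in> L2c lebesgue"
  then show "\<exists>h. unfolds g h"
    by (rule unfolds_left_total)
next
  fix h assume "h \<in> L2_fun (lebesgue_on R) (ell2 I)"
  then show "\<exists>g. unfolds g h"
    by (rule unfolds_right_total)
next
  fix g h g' h' assume gh: "unfolds g h" and g': "g' \<in> L2c lebesgue" "AE v in lebesgue. g' v = g v"
    and h': "h' \<in> L2_fun (lebesgue_on R) (ell2 I)" "AE r in lebesgue_on R. h' r = h r"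
  have [measurable]: "g \<in> borel_measurable lebesgue" "g' \<in> borel_measurable lebesgue"
    using gh g' by (auto simp: unfolds_def L2c_iff)
  have "{v \<in> space lebesgue. g' v = g v} \<in> sets lebesgue"
    by measurable
  then have "AE r in lebesgue_on R. \<forall>i\<in>I. g' (act i r) = g (act i r)"
    using AE_tiling[of "\<lambda>v. g' v = g v"] g'(2) by simp
  moreover have "AE r in lebesgue_on R. \<forall>i\<in>I. h r i = c i r * g (act i r)"
    using gh by (simp add: unfolds_def)
  ultimately have "AE r in lebesgue_on R. \<forall>i\<in>I. h' r i = c i r * g' (act i r)"
    using h'(2) by eventually_elim simp
  then show "unfolds g' h'"
    using g'(1) h'(1) by (simp add: unfolds_def)
next
  fix g h g' h' assume u: "unfolds g h" "unfolds g' h'"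
  show "(AE v in lebesgue. g v = g' v) \<longleftrightarrow> (AE r in lebesgue_on R. h r = h' r)"
    by (rule unfolds_AE_iff[OF u])
  show "unfolds (\<lambda>v. vadd complex_hspace (g v) (g' v)) (\<lambda>r. vadd (ell2 I) (h r) (h' r))"
    using unfolds_lincomb[OF u, of 1] by (simp add: complex_hspace_def ell2_def)
  show "(\<integral>v. vinner complex_hspace (g v) (g' v) \<partial>lebesgue) = (\<integral>r. vinner (ell2 I) (h r) (h' r) \<partial>lebesgue_on R)"
    using unfolds_inner[OF u] by (simp add: complex_hspace_def ip_def)
next
  fix b g h assume "unfolds g h"
  from unfolds_lincomb[OF this unfolds_zero, of b]
  show "unfolds (\<lambda>v. vscale complex_hspace b (g v)) (\<lambda>r. vscale (ell2 I) b (h r))"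
    by (simp add: complex_hspace_def ell2_def)
qed (auto simp: unfolds_def)

end

section \<open>The shift representation of a crystallographic group\<close>

lemma orthogonal_pair_matrix:
  fixes L :: "real ^ 'n::finite ^ 'n"
  assumes "orthogonal_matrix L"
  shows "orthogonal_pair ((*v) L) ((*v) (matrix_inv L))"
proof
  show "orthogonal_transformation ((*v) L)"
    using assms by (simp add: orthogonal_transformation_matrix matrix_vector_mul_linear)
  have "L ** matrix_inv L = mat 1" "matrix_inv L ** L = mat 1"
    using assms by (simp_all add: orthogonal_inv orthogonal_matrix_def)
  then show "L *v (matrix_inv L *v u) = u" "matrix_inv L *v (L *v u) = u" for u
    by (simp_all add: matrix_vector_mul_assoc)
qed

lemma char_fun_cexp: "char_fun y u = cexp 0 (2 * pi * (y \<bullet> u))"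
  by (simp add: char_fun_def cexp_def Complex_eq mult_ac)

text \<open>Used for the integers \<open>z \<bullet> \<eta>\<close> with \<open>z\<close> in the dual lattice and \<open>\<eta>\<close> in the lattice.\<close>

lemma cexp_add_integer:
  assumes "n \<in> \<int>"
  shows "cexp 0 (2 * pi * (t + n)) = cexp 0 (2 * pi * t)"
proof -
  obtain k where "n = of_int k"
    using assms by (rule Ints_cases)
  then have "cexp 0 (2 * pi * (t + n)) = exp (Complex 0 (2 * pi * t) + of_int (2 * k) * (of_real pi * \<i>))"
    by (simp add: cexp_def Complex_eq algebra_simps)
  also have "\<dots> = cexp 0 (2 * pi * t)"
    unfolding cexp_def by (subst exp_plus_2pin[symmetric, of _ k]) (simp add: algebra_simps)
  finally show ?thesis .
qed

locale crystal =
  fixes \<Gamma> :: "((real ^ 'n::finite) \<times> (real ^ 'n ^ 'n)) set"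
    and \<xi> :: "real ^ 'n ^ 'n \<Rightarrow> real ^ 'n"
    and R :: "(real ^ 'n) set"
  assumes subgroup: "subgroup \<Gamma> isom_group"
    and cross: "cross_section \<Gamma> \<xi>"
    and domain: "fundamental_domain (dual_group \<Gamma>) R"
begin

lemma orthogonal:
  assumes "(x, L) \<in> \<Gamma>"
  shows "orthogonal_matrix L"
  using subgroup.subset[OF subgroup] assms by (auto simp: isom_group_def)

lemma point_group_orthogonal: "M \<in> point_group \<Gamma> \<Longrightarrow> orthogonal_matrix M"
  by (auto simp: point_group_def orthogonal)

lemma mult_closed:
  assumes "(x, L) \<in> \<Gamma>" "(y, M) \<in> \<Gamma>"
  shows "(matrix_inv M *v x + y, L ** M) \<in> \<Gamma>"
  using subgroup.m_closed[OF subgroup assms] by (simp add: isom_group_def)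

lemma inv_closed:
  assumes "(x, L) \<in> \<Gamma>"
  shows "(- (L *v x), matrix_inv L) \<in> \<Gamma>"
  using subgroup.m_inv_closed[OF subgroup assms] orthogonal[OF assms]
  by (subst (asm) inv_isom_group) (auto simp: isom_group_def)

lemma point_group_translate:
  assumes "(x, L) \<in> \<Gamma>" "M \<in> point_group \<Gamma>"
  shows "matrix_inv L ** M \<in> point_group \<Gamma>" "L ** M \<in> point_group \<Gamma>"
  using mult_closed[OF inv_closed[OF assms(1)]] mult_closed[OF assms(1)] assms(2)
  unfolding point_group_def by blast+

text \<open>
Let \<open>N\<close> be the product of the inverse of \<open>L\<close> with \<open>M\<close>. The product of the inverse of \<open>\<gamma>(M)\<close>, of \<open>[x,L]\<close> and of \<open>\<gamma>(N)\<close>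
has trivial linear part, and this vector is its translation part.
\<close>

lemma lattice_cocycle:
  assumes g: "(x, L) \<in> \<Gamma>" and M: "M \<in> point_group \<Gamma>"
  shows "\<xi> (matrix_inv L ** M) - \<xi> M + matrix_inv M *v (L *v x) \<in> translation_lattice \<Gamma>"
proof -
  define N where "N = matrix_inv L ** M"
  have N: "N \<in> point_group \<Gamma>"
    unfolding N_def by (rule point_group_translate[OF g M])
  have oL: "orthogonal_matrix L" and oM: "orthogonal_matrix M"
    using orthogonal[OF g] point_group_orthogonal[OF M] .
  have inv: "L ** matrix_inv L = mat 1" "M ** matrix_inv M = mat 1" "matrix_inv M ** M = mat 1"
    using oL oM by (simp_all add: orthogonal_inv orthogonal_matrix_def)
  have LN: "L ** N = M"
    by (simp add: N_def matrix_mul_assoc inv)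
  have "matrix_inv N = matrix_inv M ** L"
    using oL oM point_group_orthogonal[OF N]
    by (simp add: orthogonal_inv) (simp add: N_def orthogonal_inv matrix_transpose_mul)
  then have "matrix_inv N *v x = matrix_inv M *v (L *v x)"
    by (simp add: matrix_vector_mul_assoc)
  moreover have "(\<xi> N, N) \<in> \<Gamma>" "(\<xi> M, M) \<in> \<Gamma>"
    using cross N M by (auto simp: cross_section_def)
  ultimately have "(matrix_inv M *v (L *v x) + \<xi> N, M) \<in> \<Gamma>"
    using mult_closed[OF g, of "\<xi> N" N] by (simp add: LN)
  from mult_closed[OF inv_closed[OF \<open>(\<xi> M, M) \<in> \<Gamma>\<close>] this]
  have "(- \<xi> M + (matrix_inv M *v (L *v x) + \<xi> N), mat 1) \<in> \<Gamma>"
    by (simp add: inv matrix_vector_neg matrix_vector_mul_assoc)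
  then show ?thesis
    by (simp add: translation_lattice_def N_def algebra_simps)
qed

definition index :: "((real ^ 'n ^ 'n) \<times> (real ^ 'n)) set" where
  "index = point_group \<Gamma> \<times> dual_lattice \<Gamma>"

lemma mem_index: "(M, z) \<in> index \<longleftrightarrow> M \<in> point_group \<Gamma> \<and> z \<in> dual_lattice \<Gamma>"
  by (simp add: index_def)

lemma index_cases:
  assumes "i \<in> index"
  obtains M z where "i = (M, z)" "M \<in> point_group \<Gamma>" "z \<in> dual_lattice \<Gamma>" "orthogonal_matrix M"
  using assms by (auto simp: index_def point_group_orthogonal)

text \<open>
The pair \<open>(M, z)\<close> acts as the element \<open>[z, M]\<close> of the dual group; the components are in the order of the
tensor product.
\<close>

definition move :: "(real ^ 'n ^ 'n) \<times> (real ^ 'n) \<Rightarrow> real ^ 'n \<Rightarrow> real ^ 'n" where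
  "move = (\<lambda>(M, z) r. M *v (r + z))"

definition unmove :: "(real ^ 'n ^ 'n) \<times> (real ^ 'n) \<Rightarrow> real ^ 'n \<Rightarrow> real ^ 'n" where
  "unmove = (\<lambda>(M, z) v. matrix_inv M *v v - z)"

text \<open>
The value of the character \<open>\<chi>\<^bsub>r+z\<^esub>\<close> at \<open>- x\<^sub>M\<close>, chosen so that the factor produced by an isometry on the Fourier side
turns into the one in \<open>U\<^sup>r\<close>.
\<close>

definition phase :: "(real ^ 'n ^ 'n) \<times> (real ^ 'n) \<Rightarrow> real ^ 'n \<Rightarrow> complex" where
  "phase = (\<lambda>(M, z) r. cexp 0 (2 * pi * - ((r + z) \<bullet> \<xi> M)))"

lemma R_domain:
  shows "open R" "convex R" "R \<noteq> {}"
    "i \<in> index \<Longrightarrow> j \<in> index \<Longrightarrow> i \<noteq> j \<Longrightarrow> move i ` R \<inter> move j ` R = {}"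
    "(\<Union>i\<in>index. move i ` closure R) = UNIV"
proof -
  have aff: "aff_act (z, M) = move (M, z)" for z M
    by (auto simp: move_def)
  show "open R" "convex R"
    using domain by (auto simp: fundamental_domain_def)
  have U: "(\<Union>g\<in>dual_group \<Gamma>. aff_act g ` closure R) = UNIV"
    using domain by (simp add: fundamental_domain_def)
  show "R \<noteq> {}"
  proof
    assume "R = {}"
    with U show False by simp
  qed
  show "(\<Union>i\<in>index. move i ` closure R) = UNIV"
  proof -
    have "(\<Union>g\<in>dual_group \<Gamma>. aff_act g ` closure R) \<subseteq> (\<Union>i\<in>index. move i ` closure R)"
      by (force simp: dual_group_def mem_index aff simp del: aff_act.simps)
    then show ?thesis
      using U by auto
  qed
  assume "i \<in> index" "j \<in> index" "i \<noteq> j"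
  then have "(snd i, fst i) \<in> dual_group \<Gamma>" "(snd j, fst j) \<in> dual_group \<Gamma>" "(snd i, fst i) \<noteq> (snd j, fst j)"
    by (auto simp: dual_group_def index_def prod_eq_iff)
  then have "aff_act (snd i, fst i) ` R \<inter> aff_act (snd j, fst j) ` R = {}"
    using domain unfolding fundamental_domain_def by blast
  then show "move i ` R \<inter> move j ` R = {}"
    by (simp add: aff del: aff_act.simps)
qed

lemma unmove_move: "i \<in> index \<Longrightarrow> unmove i (move i r) = r"
  and move_unmove: "i \<in> index \<Longrightarrow> move i (unmove i v) = v"
proof -
  assume "i \<in> index"
  then obtain M z where Mz: "i = (M, z)" "orthogonal_matrix M"
    by (rule index_cases)
  interpret orthogonal_pair "(*v) M" "(*v) (matrix_inv M)"
    by (rule orthogonal_pair_matrix[OF Mz(2)])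
  show "unmove i (move i r) = r" "move i (unmove i v) = v"
    by (simp_all add: Mz(1) unmove_def move_def ST TS)
qed

lemma move_lebesgue:
  assumes "i \<in> index"
  shows "move i \<in> lebesgue \<rightarrow>\<^sub>M lebesgue" "distr lebesgue lebesgue (move i) = lebesgue"
    "unmove i \<in> lebesgue \<rightarrow>\<^sub>M lebesgue"
proof -
  obtain M z where Mz: "i = (M, z)" "orthogonal_matrix M"
    using assms by (rule index_cases)
  interpret orthogonal_pair "(*v) M" "(*v) (matrix_inv M)"
    by (rule orthogonal_pair_matrix[OF Mz(2)])
  have "move i = (\<lambda>v. M *v v + M *v z)" "unmove i = (\<lambda>v. matrix_inv M *v v + - z)"
    by (auto simp: Mz(1) move_def unmove_def T_add)
  then show "move i \<in> lebesgue \<rightarrow>\<^sub>M lebesgue" "distr lebesgue lebesgue (move i) = lebesgue"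
    "unmove i \<in> lebesgue \<rightarrow>\<^sub>M lebesgue"
    using lebesgue_distr_isometry[OF T, of "M *v z"] lebesgue_distr_isometry(1)[OF S, of "- z"]
    by simp_all
qed

lemma move_image:
  assumes "i \<in> index"
  shows "move i ` A = unmove i -` A"
proof (intro equalityI subsetI)
  fix v assume "v \<in> unmove i -` A"
  then show "v \<in> move i ` A"
    using move_unmove[OF assms, of v] by (intro image_eqI[of _ _ "unmove i v"]) auto
qed (auto simp: unmove_move[OF assms])

lemma open_tile:
  assumes "i \<in> index"
  shows "open (move i ` R)"
proof -
  obtain M z where Mz: "i = (M, z)" "orthogonal_matrix M"
    using assms by (rule index_cases)
  have "continuous_on UNIV (unmove i)"
    unfolding Mz(1) unmove_def by (auto intro!: continuous_intros)
  then show ?thesis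
    using R_domain(1) by (simp add: move_image[OF assms] open_vimage)
qed

text \<open>The tiles are disjoint nonempty open sets in a separable space.\<close>

lemma countable_index: "countable index"
proof -
  have "countable ((\<lambda>i. move i ` R) ` index)"
  proof (rule countable_disjoint_open_subsets)
    show "open T" if "T \<in> (\<lambda>i. move i ` R) ` index" for T
      using that open_tile by blast
    show "pairwise disjnt ((\<lambda>i. move i ` R) ` index)"
    proof (rule pairwiseI)
      fix S T assume "S \<in> (\<lambda>i. move i ` R) ` index" "T \<in> (\<lambda>i. move i ` R) ` index" "S \<noteq> T"
      then obtain i j where ij: "S = move i ` R" "T = move j ` R" "i \<in> index" "j \<in> index"
        by blast
      then have "i \<noteq> j"
        using \<open>S \<noteq> T\<close> by blast
      then show "disjnt S T"
        using R_domain(4) ij by (simp add: disjnt_def)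
    qed
  qed
  moreover have "inj_on (\<lambda>i. move i ` R) index"
  proof (rule inj_onI, rule ccontr)
    fix i j assume "i \<in> index" "j \<in> index" "move i ` R = move j ` R" "i \<noteq> j"
    then have "move i ` R = {}"
      using R_domain(4)[of i j] by blast
    then show False
      using R_domain(3) by blast
  qed
  ultimately show ?thesis
    by (rule countable_image_inj_on)
qed

text \<open>
The closures of the tiles cover the space, and what the tiles miss lies in countably many images of the
frontier of \<open>R\<close>, which is null because \<open>R\<close> is convex.
\<close>

lemma AE_in_tile: "AE v in lebesgue. \<exists>i\<in>index. v \<in> move i ` R"
proof (rule AE_I')
  have null: "move i ` frontier R \<in> null_sets lebesgue" if i: "i \<in> index" for i
  proof -
    have "frontier R \<in> null_sets lebesgue"
      using negligible_convex_frontier[OF R_domain(2)] by (simp add: negligible_iff_null_sets)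
    moreover note eq = move_image[OF i, of "frontier R"]
    moreover have m: "move i ` frontier R \<in> sets lebesgue"
      using measurable_sets[OF move_lebesgue(3)[OF i], of "frontier R"] by (simp add: eq)
    moreover have "emeasure lebesgue (move i ` frontier R) = emeasure lebesgue (frontier R)"
    proof -
      have "emeasure lebesgue (move i ` frontier R) = emeasure (distr lebesgue lebesgue (move i)) (move i ` frontier R)"
        by (simp add: move_lebesgue(2)[OF i])
      also have "\<dots> = emeasure lebesgue (move i -` (move i ` frontier R) \<inter> space lebesgue)"
        by (rule emeasure_distr[OF move_lebesgue(1)[OF i] m])
      also have "move i -` (move i ` frontier R) \<inter> space lebesgue = frontier R"
        using unmove_move[OF i] by (auto simp: eq)
      finally show ?thesis .
    qed
    ultimately show ?thesis
      by (auto simp: null_sets_def)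
  qed
  show "(\<Union>i\<in>index. move i ` frontier R) \<in> null_sets lebesgue"
    using null countable_index by (intro null_sets_UN') auto
  show "{v \<in> space lebesgue. \<not> (\<exists>i\<in>index. v \<in> move i ` R)} \<subseteq> (\<Union>i\<in>index. move i ` frontier R)"
  proof clarify
    fix v assume v: "\<not> (\<exists>i\<in>index. v \<in> move i ` R)"
    have "v \<in> (\<Union>i\<in>index. move i ` closure R)"
      unfolding R_domain(5) by simp
    then obtain i u where iu: "i \<in> index" "u \<in> closure R" "v = move i u"
      by blast
    then have "u \<notin> R"
      using v by blast
    then have "u \<in> frontier R"
      using iu(2) R_domain(1) by (simp add: frontier_def interior_open)
    then show "v \<in> (\<Union>i\<in>index. move i ` frontier R)"
      using iu by blast
  qed
qed

sublocale tiling index move unmove R phase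
proof
  fix i assume "i \<in> index"
  show "phase i \<in> borel_measurable lebesgue"
    unfolding phase_def case_prod_unfold by (intro measurable_completion) measurable
qed (simp_all add: countable_index R_domain(1,4) move_lebesgue unmove_move move_unmove AE_in_tile
    phase_def case_prod_unfold)

text \<open>The operator \<open>\<tau>\<close> on functions, before passing to classes.\<close>

definition tau_fun ::
  "(real ^ 'n) \<times> (real ^ 'n ^ 'n) \<Rightarrow> (real ^ 'n \<Rightarrow> (real ^ 'n ^ 'n) \<times> (real ^ 'n) \<Rightarrow> complex) \<Rightarrow>
   real ^ 'n \<Rightarrow> (real ^ 'n ^ 'n) \<times> (real ^ 'n) \<Rightarrow> complex" where
  "tau_fun g h r = op_tensor (U_rep \<Gamma> \<xi> r g) id (h r)"

lemma tau_fun_eq: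
  "tau_fun (x, L) h r (M, z) = (if M \<in> point_group \<Gamma>
     then char_fun r (\<xi> (matrix_inv L ** M) - \<xi> M + matrix_inv M *v (L *v x)) * h r (matrix_inv L ** M, z) else 0)"
  by (simp add: tau_fun_def op_tensor_def)

lemma bij_index:
  assumes g: "(x, L) \<in> \<Gamma>"
  shows "bij_betw (\<lambda>(M, z). (matrix_inv L ** M, z)) index index"
proof (rule bij_betw_byWitness[where f' = "\<lambda>(M, z). (L ** M, z)"])
  have inv: "L ** matrix_inv L = mat 1" "matrix_inv L ** L = mat 1"
    using orthogonal[OF g] by (simp_all add: orthogonal_inv orthogonal_matrix_def)
  show "\<forall>i\<in>index. (case case i of (M, z) \<Rightarrow> (matrix_inv L ** M, z) of (M, z) \<Rightarrow> (L ** M, z)) = i"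
    "\<forall>i\<in>index. (case case i of (M, z) \<Rightarrow> (L ** M, z) of (M, z) \<Rightarrow> (matrix_inv L ** M, z)) = i"
    by (auto simp: matrix_mul_assoc inv)
qed (use point_group_translate[OF g] in \<open>auto simp: mem_index\<close>)

text \<open>In each fibre, \<open>\<tau>\<close> permutes the coordinates and multiplies them by unimodular numbers.\<close>

lemma tau_fun_L2:
  assumes g: "(x, L) \<in> \<Gamma>" and h: "h \<in> L2_fun (lebesgue_on R) (ell2 index)"
  shows "tau_fun (x, L) h \<in> L2_fun (lebesgue_on R) (ell2 index)"
proof -
  let ?\<beta> = "\<lambda>(M, z). (matrix_inv L ** M, z)"
  have norm: "(cmod (tau_fun (x, L) h r i))\<^sup>2 = (cmod (h r (?\<beta> i)))\<^sup>2" if "i \<in> index" for r i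
    using that by (auto simp: index_def tau_fun_eq norm_mult char_fun_cexp)
  have nsq: "nsq (count_space index) (tau_fun (x, L) h r) = nsq (count_space index) (h r)" for r
  proof -
    have "nsq (count_space index) (tau_fun (x, L) h r) = (\<integral>i. (cmod (h r (?\<beta> i)))\<^sup>2 \<partial>count_space index)"
      unfolding nsq_def by (intro Bochner_Integration.integral_cong) (simp_all only: norm space_count_space)
    also have "\<dots> = nsq (count_space index) (h r)"
      unfolding nsq_def by (rule integral_bij_count_space[OF bij_index[OF g]])
    finally show ?thesis .
  qed
  have vecs: "tau_fun (x, L) h r \<in> vecs (ell2 index)" if "r \<in> R" for r
  proof -
    have h_r: "h r \<in> vecs (ell2 index)"
      by (rule L2_funD(1)[OF h that])
    have "integrable (count_space index) (\<lambda>i. (cmod (h r (?\<beta> i)))\<^sup>2)"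
      using h_r unfolding vecs_ell2 L2c_iff by (subst integrable_bij_count_space[OF bij_index[OF g]]) auto
    then have "integrable (count_space index) (\<lambda>i. (cmod (tau_fun (x, L) h r i))\<^sup>2)"
      by (subst Bochner_Integration.integrable_cong[OF refl norm]) simp_all
    moreover have "tau_fun (x, L) h r i = 0" if i: "i \<notin> index" for i
    proof -
      obtain M z where "i = (M, z)"
        by fastforce
      then show ?thesis
        using i h_r point_group_translate(2)[OF g, of "matrix_inv L ** M"]
        by (auto simp: tau_fun_eq vecs_ell2 mem_index)
    qed
    ultimately show ?thesis
      by (simp add: vecs_ell2 L2c_iff)
  qed
  have meas: "(\<lambda>r. tau_fun (x, L) h r i) \<in> borel_measurable (lebesgue_on R)" if i: "i \<in> index" for i
  proof -
    obtain M z where Mz: "i = (M, z)" "M \<in> point_group \<Gamma>" "z \<in> dual_lattice \<Gamma>"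
      using i by (rule index_cases)
    have "(matrix_inv L ** M, z) \<in> index"
      using point_group_translate[OF g Mz(2)] Mz(3) by (simp add: mem_index)
    note hm = L2_funD(3)[OF h this]
    have "(\<lambda>r. char_fun r y) \<in> borel_measurable (lebesgue_on R)" for y
      unfolding char_fun_cexp by (intro measurable_restrict_space1 measurable_completion) measurable
    then show ?thesis
      using hm Mz by (simp add: tau_fun_eq borel_measurable_times)
  qed
  show ?thesis
    using vecs meas h by (simp add: L2_fun_ell2_iff[OF countable_index] nsq)
qed

text \<open>
The phases at \<open>(M, z)\<close> and \<open>(N, z)\<close>, together with the character from the translation, combine to
\<open>\<chi>\<^bsub>r+z\<^esub>(\<eta>)\<close> for the lattice vector \<open>\<eta>\<close> of \<open>lattice_cocycle\<close>, and \<open>\<chi>\<^sub>z(\<eta>) = 1\<close>.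
\<close>

lemma unfolds_tau:
  assumes g: "(x, L) \<in> \<Gamma>" and fh: "unfolds f h"
    and f': "(\<lambda>v. cexp 0 (2 * pi * (v \<bullet> (L *v x))) * f (matrix_inv L *v v)) \<in> L2c lebesgue"
  shows "unfolds (\<lambda>v. cexp 0 (2 * pi * (v \<bullet> (L *v x))) * f (matrix_inv L *v v)) (tau_fun (x, L) h)"
proof -
  have "AE r in lebesgue_on R. \<forall>i\<in>index. h r i = phase i r * f (move i r)"
    using fh by (simp add: unfolds_def)
  then have "AE r in lebesgue_on R. \<forall>i\<in>index. tau_fun (x, L) h r i
      = phase i r * (cexp 0 (2 * pi * (move i r \<bullet> (L *v x))) * f (matrix_inv L *v move i r))"
  proof eventually_elim
    case (elim r)
    show ?case
    proof
      fix i assume "i \<in> index"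
      then obtain M z where i: "i = (M, z)" and M: "M \<in> point_group \<Gamma>" and z: "z \<in> dual_lattice \<Gamma>"
        by (rule index_cases)
      define N where "N = matrix_inv L ** M"
      define \<eta> where "\<eta> = \<xi> N - \<xi> M + matrix_inv M *v (L *v x)"
      interpret M: orthogonal_pair "(*v) M" "(*v) (matrix_inv M)"
        by (rule orthogonal_pair_matrix[OF point_group_orthogonal[OF M]])
      have "\<eta> \<in> translation_lattice \<Gamma>"
        unfolding \<eta>_def N_def by (rule lattice_cocycle[OF g M])
      then have "z \<bullet> \<eta> \<in> \<int>"
        using z by (simp add: dual_lattice_def inner_commute)
      \<comment> \<open>The integer \<open>z \<bullet> \<eta>\<close> is the whole difference between the two phases.\<close>
      have ph: "- ((r + z) \<bullet> \<xi> M) + move i r \<bullet> (L *v x) = (r \<bullet> \<eta> - (r + z) \<bullet> \<xi> N) + z \<bullet> \<eta>"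
        using M.S_adjoint[of "L *v x" "r + z"]
        by (simp add: i move_def \<eta>_def inner_simps inner_commute[of "matrix_inv M *v (L *v x)"]
            inner_commute[of "L *v x"])
      have hN: "h r (N, z) = phase (N, z) r * f (move (N, z) r)"
        using elim point_group_translate(1)[OF g M] z by (simp add: N_def mem_index)
      have mv: "matrix_inv L *v move i r = move (N, z) r"
        by (simp add: i move_def N_def matrix_vector_mul_assoc)
      have "phase i r * (cexp 0 (2 * pi * (move i r \<bullet> (L *v x))) * f (matrix_inv L *v move i r))
          = cexp 0 (2 * pi * (- ((r + z) \<bullet> \<xi> M) + move i r \<bullet> (L *v x))) * f (matrix_inv L *v move i r)"
        by (simp only: i phase_def prod.case cexp_add' distrib_left add_0_left)
      also have "\<dots> = cexp 0 (2 * pi * (r \<bullet> \<eta> - (r + z) \<bullet> \<xi> N)) * f (move (N, z) r)"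
        unfolding ph mv cexp_add_integer[OF \<open>z \<bullet> \<eta> \<in> \<int>\<close>] ..
      also have "\<dots> = char_fun r \<eta> * (phase (N, z) r * f (move (N, z) r))"
        by (simp add: char_fun_cexp phase_def cexp_add' right_diff_distrib)
      also have "\<dots> = tau_fun (x, L) h r i"
        unfolding hN[symmetric] using M by (simp add: i tau_fun_eq N_def \<eta>_def)
      finally show "tau_fun (x, L) h r i
          = phase i r * (cexp 0 (2 * pi * (move i r \<bullet> (L *v x))) * f (matrix_inv L *v move i r))" ..
    qed
  qed
  then show ?thesis
    using f' tau_fun_L2[OF g] fh by (simp add: unfolds_def)
qed

definition spectral :: "(real ^ 'n \<Rightarrow> complex) \<Rightarrow> (real ^ 'n \<Rightarrow> (real ^ 'n ^ 'n) \<times> (real ^ 'n) \<Rightarrow> complex) \<Rightarrow> bool" where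
  "spectral = fourier_pair OO unfolds"

lemma spectral_intertwines:
  assumes g: "(x, L) \<in> \<Gamma>" and "spectral f h"
  shows "spectral (\<lambda>u. f (matrix_inv L *v u - x)) (tau_fun (x, L) h)"
proof -
  interpret orthogonal_pair "(*v) L" "(*v) (matrix_inv L)"
    by (rule orthogonal_pair_matrix[OF orthogonal[OF g]])
  obtain k where k: "fourier_pair f k" "unfolds k h"
    using assms(2) by (auto simp: spectral_def)
  note fk = fourier_pair_isometry[OF k(1), of x]
  then have "(\<lambda>v. cexp 0 (2 * pi * (v \<bullet> (L *v x))) * k (matrix_inv L *v v)) \<in> L2c lebesgue"
    by (simp add: fourier_pair_def)
  from unfolds_tau[OF g k(2) this] fk show ?thesis
    by (auto simp: spectral_def)
qed

sublocale spectral: unitary_relation lebesgue complex_hspace "lebesgue_on R" "fibre \<Gamma>" spectral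
  unfolding spectral_def fibre_def ell2_tensor_def index_def[symmetric]
  by (rule unitary_relation_relcompp[OF plancherel unitary_relation_unfolds])

end

theorem theorem5p3p1:
  fixes \<Gamma> :: "((real ^ 'n::finite) \<times> (real ^ 'n ^ 'n)) set"
    and \<xi> :: "real ^ 'n ^ 'n \<Rightarrow> real ^ 'n"
    and R :: "(real ^ 'n) set"
  assumes "crystallographic \<Gamma>"
    and "cross_section \<Gamma> \<xi>"
    and "fundamental_domain (dual_group \<Gamma>) R"
  shows "\<exists>U. unitary_map L2_Rn (L2_R \<Gamma> R) U \<and>
           (\<forall>g\<in>\<Gamma>. \<forall>F\<in>vecs (L2_R \<Gamma> R).
              U (shift_rep g (inv_into (vecs L2_Rn) U F)) = tau_rep \<Gamma> \<xi> R g F)"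
proof -
  interpret crystal \<Gamma> \<xi> R
    using assms by (intro crystal.intro) (simp_all add: crystallographic_def)
  show ?thesis
  proof (rule exI[of _ spectral.induced], intro conjI ballI)
    show "unitary_map L2_Rn (L2_R \<Gamma> R) spectral.induced"
      unfolding L2_Rn_def L2_R_def by (rule spectral.unitary_map_induced)
    fix g F assume g: "g \<in> \<Gamma>" and F: "F \<in> vecs (L2_R \<Gamma> R)"
    obtain x L where xL: "g = (x, L)"
      by fastforce
    have "spectral.induced (ae_class lebesgue complex_hspace
        (\<lambda>u. rep (inv_into (vecs L2_Rn) spectral.induced F) (matrix_inv L *v u - x)))
      = ae_class (lebesgue_on R) (fibre \<Gamma>) (tau_fun g (rep F))"
      unfolding L2_Rn_def
      by (rule spectral.induced_intertwines[of "\<lambda>f u. f (matrix_inv L *v u - x)"])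
        (use spectral_intertwines g F in \<open>simp_all add: xL L2_R_def\<close>)
    then show "spectral.induced (shift_rep g (inv_into (vecs L2_Rn) spectral.induced F)) = tau_rep \<Gamma> \<xi> R g F"
      by (simp add: xL tau_rep_def tau_fun_def[abs_def])
  qed
qed

end
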